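(* Let $d\in\{3,4\}$ and let $X_0,\ldots,X_d$ be independent random points, each uniformly distributed on the unit sphere $\mathbb{S}^{d-1}=\{x\in\mathbb{R}^d\colon \|x\|=1\}$. Let $T=[X_0,\ldots,X_d]$ be the convex hull of $X_0,\ldots,X_d$, and let $s_0(T)$ be the sum of the solid angles of $T$ at its vertices (normalized so that the full solid angle equals $1$). Then $$ \mathbb{E}\, s_0(T) = \begin{cases} \frac 18, &\text{ if } d=3,\\ \frac{539}{288\pi^2}-\frac 16, &\text{ if } d=4. \end{cases} $$
   Context: $\|x\|$ denotes the Euclidean norm on $\mathbb{R}^d$. For a $d$-dimensional convex polytope $P\subset\mathbb{R}^d$ with vertex set $\mathcal{F}_0(P)$, the internal (solid) angle of $P$ at a vertex $x_0$ is $$\beta(x_0,P):=\mathbb{P}[\exists\, \varepsilon>0 \text{ such that } x_0+\varepsilon U\in P],$$ where $U$ is a random vector uniformly distributed on the unit sphere $\mathbb{S}^{d-1}$. The angle sum at vertices is $s_0(P)=\sum_{x_0\in\mathcal{F}_0(P)}\beta(x_0,P)$. With probability $1$, the random convex hull $T$ is a $d$-dimensional simplex with vertices $X_0,\ldots,X_d$, so $s_0(T)$ is almost surely defined. *)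

theory Defs
  imports "HOL-Probability.Probability"
begin

text \<open>
  Uniform distribution on the unit sphere, i.e. normalised surface measure, as a Borel probability
  measure on the whole space. Surface measure enters through polar coordinates: the normalised
  surface area of a Borel set \<open>A\<close> of the sphere is the volume of the cone
  \<open>{t *\<^sub>R a | a t. a \<in> A \<and> 0 < t \<and> t \<le> 1}\<close> divided by the volume of the unit ball.
  Equivalently, it is the law of \<open>x / norm x\<close> for \<open>x\<close> uniform in the unit ball.
\<close>

definition uniform_sphere :: "'a::euclidean_space measure" where
  "uniform_sphere = distr (uniform_measure lborel (cball 0 1)) borel (\<lambda>x. x /\<^sub>R norm x)"

text \<open>
  Solid angle of \<open>P\<close> at \<open>x\<close>: the probability that a uniform random direction \<open>u\<close> points from
  \<open>x\<close> into \<open>P\<close>. Intended for a full-dimensional polytope \<open>P\<close> and a vertex \<open>x\<close>;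
  for a polytope contained in a hyperplane (and \<open>x \<in> P\<close>) it is \<open>0\<close>.
\<close>

definition solid_angle :: "'a::euclidean_space \<Rightarrow> 'a set \<Rightarrow> real" where
  "solid_angle x P = measure uniform_sphere {u. \<exists>\<epsilon>>0. x + \<epsilon> *\<^sub>R u \<in> P}"

definition vertex_angle_sum :: "'a::euclidean_space set \<Rightarrow> real" where
  "vertex_angle_sum P = (\<Sum>x | x extreme_point_of P. solid_angle x P)"


text \<open>
  The measure above is a probability measure concentrated on the sphere and invariant under
  orthogonal transformations, the properties that characterise the uniform distribution. The
  invariance lemma has the sort constraint \<open>wellorder\<close> on the index type only because the
  library's transformation theorem for volumes has it.
\<close>

lemma space_uniform_sphere [simp]: "space uniform_sphere = UNIV"
  and sets_uniform_sphere [simp, measurable_cong]: "sets uniform_sphere = sets borel"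
  by (auto simp: uniform_sphere_def)

lemma emeasure_lborel_cball_pos: "emeasure lborel (cball (0::'a::euclidean_space) 1) \<noteq> 0"
  by (simp add: emeasure_cball less_imp_neq[OF unit_ball_vol_pos, symmetric])

lemma emeasure_lborel_cball_fin: "emeasure lborel (cball (0::'a::euclidean_space) 1) \<noteq> \<infinity>"
  by (simp add: emeasure_cball)

lemma measurable_normalise [measurable]:
  "(\<lambda>x::'a::euclidean_space. x /\<^sub>R norm x) \<in> borel_measurable borel"
  by measurable

lemma prob_space_uniform_sphere: "prob_space (uniform_sphere :: 'a::euclidean_space measure)"
  unfolding uniform_sphere_def
  by (intro prob_space.prob_space_distr prob_space_uniform_measure
      emeasure_lborel_cball_pos emeasure_lborel_cball_fin) measurable

lemma AE_uniform_sphere: "AE u in (uniform_sphere :: 'a::euclidean_space measure). norm u = 1"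
proof -
  have "AE x in lborel. (x::'a) \<noteq> 0"
    by (rule AE_lborel_singleton)
  then have "AE x in uniform_measure lborel (cball (0::'a) 1). norm (x /\<^sub>R norm x) = 1"
    by (intro AE_uniform_measureI) (auto elim!: eventually_mono)
  then show ?thesis
    unfolding uniform_sphere_def by (subst AE_distr_iff) auto
qed

lemma uniform_sphere_orthogonal:
  fixes f :: "real^'n::{finite,wellorder} \<Rightarrow> real^'n::_"
  assumes f: "orthogonal_transformation f"
  shows "distr uniform_sphere borel f = uniform_sphere"
proof (rule measure_eqI)
  fix A :: "(real^'n::_) set"
  assume "A \<in> sets (distr uniform_sphere borel f)"
  then have A [measurable]: "A \<in> sets borel" by simp
  have lin: "linear f" and nrm: "\<And>x. norm (f x) = norm x"
    using f by (auto simp: orthogonal_transformation)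
  have [measurable]: "f \<in> borel_measurable borel"
    using lin by (intro borel_measurable_continuous_onI linear_continuous_on)
      (simp add: linear_conv_bounded_linear)
  let ?n = "\<lambda>x::real^'n::_. x /\<^sub>R norm x"
  let ?S = "cball 0 1 \<inter> ?n -` A" and ?R = "cball 0 1 \<inter> ?n -` (f -` A)"
  have meas: "?n -` A \<in> sets borel" "?n -` (f -` A) \<in> sets borel"
    using measurable_sets_borel[of ?n borel A] measurable_sets_borel[of "f \<circ> ?n" borel A]
    by (auto simp: vimage_comp comp_def)
  have comm: "f (?n x) = ?n (f x)" for x
    by (simp add: linear_cmul[OF lin] nrm)
  have img: "f ` ?R = ?S"
  proof
    show "f ` ?R \<subseteq> ?S" by (auto simp: nrm comm[simplified])
    show "?S \<subseteq> f ` ?R"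
    proof
      fix y assume y: "y \<in> ?S"
      obtain x where "y = f x"
        using orthogonal_transformation_surj[OF f] by (metis surjD)
      then show "y \<in> f ` ?R" using y by (auto simp: nrm comm[simplified])
    qed
  qed
  have fin: "?R \<in> lmeasurable" "?S \<in> lmeasurable"
    using meas by (auto intro!: bounded_set_imp_lmeasurable)
  have "emeasure lborel ?R = emeasure lebesgue ?R"
    using meas by simp
  also have "\<dots> = emeasure lebesgue (f ` ?R)"
    using fin measure_orthogonal_image[OF f fin(1)] img by (simp add: emeasure_eq_measure2)
  also have "\<dots> = emeasure lborel ?S"
    using meas unfolding img by simp
  finally have "emeasure lborel ?R = emeasure lborel ?S" .
  moreover have "f -` A \<in> sets borel"
    by (rule measurable_sets_borel) measurable
  ultimately show "emeasure (distr uniform_sphere borel f) A = emeasure uniform_sphere A"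
    using meas by (simp add: uniform_sphere_def emeasure_distr measurable_sets_borel)
qed simp

end

theory Submission
  imports Defs
begin

text \<open>
  By rotation invariance a random direction may be replaced by the last axis. If \<open>s\<^sub>0\<close> is the vertex
  angle sum of a simplex with vertices on the sphere, then \<open>2 * s\<^sub>0\<close> is in expectation the probability
  that the orthogonal projections \<open>y\<^sub>0, \<dots>, y\<^sub>d\<close> of the vertices to the equatorial hyperplane are not in
  convex position. By Radon's theorem this is decided by the signs of the coefficients of
  the affine dependence of the \<open>y\<^sub>j\<close>: if \<open>N\<close> is the number of pairs of coefficients with equal signs,
  the number of projections inside the hull of the others is \<open>N - 2\<close> for \<open>d = 3\<close> and \<open>(N - 4) / 2\<close>
  for \<open>d = 4\<close>. The coefficients of \<open>y\<^sub>i\<close> and \<open>y\<^sub>j\<close> have equal signs iff the hyperplane through the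
  other projections separates \<open>y\<^sub>i\<close> from \<open>y\<^sub>j\<close>. The projections have density proportional to
  \<open>1 / sqrt (1 - y \<bullet> y)\<close>, and the signed distance of that hyperplane from the centre has density
  proportional to \<open>sqrt (1 - s\<^sup>2)\<close> for \<open>d = 3\<close> and \<open>sqrt (1 - s\<^sup>2) ^ 5\<close> for \<open>d = 4\<close>; all constants of
  proportionality are recovered from the total mass. The separation probability at distance \<open>s\<close>
  comes from the law of one coordinate of a random point, and two integrals over \<open>s\<close> remain.
\<close>

section \<open>Isometries and the uniform distribution on the sphere\<close>

text \<open>In general position the line through a vertex in direction \<open>e\<close> enters the
  simplex iff the projection of that vertex along \<open>e\<close> lies in the hull of the other
  projections. Either \<open>e\<close> or \<open>- e\<close> may be the direction that enters, hence
  the factor 2. Dimensions 3 and 4 are special because only two types of sign patterns exist there: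
  2+2 or 1+3 for four coefficients (2 or 3 equal pairs), 2+3 or 1+4 for five (4 or 6 equal pairs).
  The number of interior projections is therefore an affine function of N, and the probability for a
  single pair decides everything. Six coefficients would allow 3+3, 2+4 and 1+5, with 6, 7 and 10
  equal pairs; the first two have no interior point, so no affine relation survives. By
  exchangeability all pairs have the same probability, 3/8 or q = 1/3 + 539/(720 pi^2), so that
  twice the expectation is 6 * 3/8 - 2 and four times the expectation is 10 q - 4. The computation
  takes place on nested pairs, where \<open>fst\<close> removes the last axis; an isometry matching
  the bases carries the result to \<open>real ^ 'n\<close>.\<close>

lemma inner_basis_isometry:
  fixes \<phi> :: "'a::euclidean_space \<Rightarrow> 'b::euclidean_space"
  assumes lin: "linear \<phi>" and bij: "bij_betw \<phi> Basis Basis"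
  shows "\<phi> x \<bullet> \<phi> y = x \<bullet> y"
proof -
  have basis: "\<phi> b \<bullet> \<phi> c = b \<bullet> c" if "b \<in> Basis" "c \<in> Basis" for b c
    using that bij_betwE[OF bij] bij_betw_imp_inj_on[OF bij]
    by (simp add: inner_Basis inj_on_eq_iff)
  have "\<phi> x \<bullet> \<phi> y = \<phi> (\<Sum>b\<in>Basis. (x \<bullet> b) *\<^sub>R b) \<bullet> \<phi> (\<Sum>c\<in>Basis. (y \<bullet> c) *\<^sub>R c)"
    by (simp add: euclidean_representation)
  also have "\<dots> = (\<Sum>c\<in>Basis. \<Sum>b\<in>Basis. (x \<bullet> b) * (y \<bullet> c) * (\<phi> b \<bullet> \<phi> c))"
    by (simp add: linear_sum[OF lin] linear_cmul[OF lin] inner_sum_left inner_sum_right sum_distrib_left mult_ac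
        del: euclidean_representation_sum euclidean_representation)
  also have "\<dots> = (\<Sum>c\<in>Basis. \<Sum>b\<in>Basis. (x \<bullet> b) * (y \<bullet> c) * (b \<bullet> c))"
    by (intro sum.cong refl) (simp add: basis)
  also have "\<dots> = (\<Sum>b\<in>Basis. (x \<bullet> b) *\<^sub>R b) \<bullet> (\<Sum>c\<in>Basis. (y \<bullet> c) *\<^sub>R c)"
    by (simp add: inner_sum_left inner_sum_right sum_distrib_left mult_ac
        del: euclidean_representation_sum euclidean_representation)
  finally show ?thesis by (simp add: euclidean_representation)
qed

lemma borel_measurable_linear:
  fixes f :: "'a::euclidean_space \<Rightarrow> 'b::euclidean_space"
  assumes "linear f" shows "f \<in> borel_measurable borel"
  using assms by (intro borel_measurable_continuous_onI linear_continuous_on)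
    (simp add: linear_conv_bounded_linear)

text \<open>Volume is determined by its values on boxes, and a linear map that matches the bases
  pulls a box back to a box with the same edge lengths. Volume can thus be moved between different
  types of equal dimension.\<close>

lemma distr_lborel_basis_isometry:
  fixes \<phi> :: "'a::euclidean_space \<Rightarrow> 'b::euclidean_space"
  assumes lin: "linear \<phi>" and bij: "bij_betw \<phi> Basis Basis"
  shows "distr lborel borel \<phi> = lborel"
proof (rule lborel_eqI[symmetric])
  note [measurable] = borel_measurable_linear[OF lin]
  note iso = inner_basis_isometry[OF assms]
  obtain \<psi> where lin': "linear \<psi>" and inv: "\<And>y. \<phi> (\<psi> y) = y"
  proof -
    have "span (\<phi> ` Basis) = UNIV" using bij by (simp add: bij_betw_def)
    then have "surj \<phi>"
      by (metis lin linear_span_image span_Basis)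
    then show ?thesis using linear_surjective_right_inverse[OF lin] that by (auto simp: o_def id_def fun_eq_iff)
  qed
  fix l u :: 'b assume le: "\<And>b. b \<in> Basis \<Longrightarrow> l \<bullet> b \<le> u \<bullet> b"
  have *: "l \<bullet> \<phi> b = \<psi> l \<bullet> b" for l b
    using iso[of "\<psi> l" b] by (simp add: inv)
  have "\<phi> -` box l u = box (\<psi> l) (\<psi> u)"
  proof -
    have "Basis = \<phi> ` Basis" using bij by (simp add: bij_betw_def)
    then have eq: "\<phi> x \<in> box l u \<longleftrightarrow> (\<forall>b\<in>Basis. l \<bullet> \<phi> b < \<phi> x \<bullet> \<phi> b \<and> \<phi> x \<bullet> \<phi> b < u \<bullet> \<phi> b)" for x
      unfolding mem_box by (metis (no_types, lifting) image_iff)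
    have "\<phi> x \<in> box l u \<longleftrightarrow> x \<in> box (\<psi> l) (\<psi> u)" for x
      unfolding eq unfolding iso *[of l] *[of u] mem_box ..
    then show ?thesis by auto
  qed
  moreover have "\<And>b. b \<in> Basis \<Longrightarrow> \<psi> l \<bullet> b \<le> \<psi> u \<bullet> b"
    using le bij_betwE[OF bij] by (metis *)
  moreover have "(\<Prod>b\<in>Basis. (\<psi> u - \<psi> l) \<bullet> b) = (\<Prod>b\<in>Basis. (u - l) \<bullet> b)"
  proof -
    have "(\<psi> u - \<psi> l) \<bullet> b = (u - l) \<bullet> \<phi> b" for b
      unfolding inner_diff_left unfolding * ..
    then show ?thesis using prod.reindex_bij_betw[OF bij, of "\<lambda>b. (u - l) \<bullet> b"] by simp
  qed
  ultimately show "emeasure (distr lborel borel \<phi>) (box l u) = ennreal (\<Prod>b\<in>Basis. (u - l) \<bullet> b)"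
    by (simp add: emeasure_distr emeasure_lborel_box)
qed simp

text \<open>Such a map preserves the uniform law on the unit ball and commutes with
  normalisation.\<close>

lemma distr_uniform_sphere_isometry:
  fixes \<phi> :: "'a::euclidean_space \<Rightarrow> 'b::euclidean_space"
  assumes lin: "linear \<phi>" and nrm: "\<And>x. norm (\<phi> x) = norm x" and leb: "distr lborel borel \<phi> = lborel"
  shows "distr uniform_sphere borel \<phi> = uniform_sphere"
proof -
  note [measurable] = borel_measurable_linear[OF lin]
  let ?U = "uniform_measure lborel (cball 0 1) :: 'a measure"
  let ?V = "uniform_measure lborel (cball 0 1) :: 'b measure"
  have em: "emeasure lborel (\<phi> -` B) = emeasure lborel B" if [measurable]: "B \<in> sets borel" for B
    using arg_cong[OF leb, of "\<lambda>M. emeasure M B"] by (simp add: emeasure_distr)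
  have cb: "cball 0 1 = \<phi> -` cball 0 1"
    by (auto simp: nrm)
  have UV: "distr ?U borel \<phi> = ?V"
  proof (rule measure_eqI)
    fix B :: "'b set" assume "B \<in> sets (distr ?U borel \<phi>)"
    then have B [measurable]: "B \<in> sets borel" by simp
    have "\<phi> -` B \<in> sets borel" by (rule measurable_sets_borel) measurable
    then show "emeasure (distr ?U borel \<phi>) B = emeasure ?V B"
      using em[of "cball 0 1 \<inter> B"] em[of "cball 0 1"]
      by (simp add: emeasure_distr cb[symmetric])
  qed simp
  have "distr uniform_sphere borel \<phi> = distr ?U borel (\<lambda>x. \<phi> (x /\<^sub>R norm x))"
    unfolding uniform_sphere_def by (subst distr_distr) (auto simp: comp_def)
  also have "\<dots> = distr ?U borel (\<lambda>x. \<phi> x /\<^sub>R norm (\<phi> x))"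
    by (simp add: linear_cmul[OF lin] nrm)
  also have "\<dots> = distr (distr ?U borel \<phi>) borel (\<lambda>x. x /\<^sub>R norm x)"
    by (subst distr_distr) (auto simp: comp_def)
  also have "\<dots> = uniform_sphere"
    unfolding UV uniform_sphere_def ..
  finally show ?thesis .
qed

lemma distr_uniform_sphere_basis_isometry:
  fixes \<phi> :: "'a::euclidean_space \<Rightarrow> 'b::euclidean_space"
  assumes "linear \<phi>" and "bij_betw \<phi> Basis Basis"
  shows "distr uniform_sphere borel \<phi> = uniform_sphere"
  using assms by (intro distr_uniform_sphere_isometry distr_lborel_basis_isometry)
    (simp_all add: norm_eq_sqrt_inner inner_basis_isometry)

text \<open>Any bijection between the bases extends linearly. This bridges \<open>real ^ 'n\<close>,
  where rotation invariance is established, and nested pairs, where an axis is easily split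
  off.\<close>

lemma ex_basis_isometry:
  assumes "DIM('a::euclidean_space) = DIM('b::euclidean_space)"
  obtains \<phi> :: "'a::euclidean_space \<Rightarrow> 'b::euclidean_space" and \<psi> :: "'b::euclidean_space \<Rightarrow> 'a::euclidean_space"
  where "linear \<phi>" "bij_betw \<phi> Basis Basis" "linear \<psi>" "bij_betw \<psi> Basis Basis"
    "\<And>x. \<psi> (\<phi> x) = x" "\<And>y. \<phi> (\<psi> y) = y"
proof -
  obtain f where f: "bij_betw f (Basis :: 'a set) (Basis :: 'b set)"
    using assms finite_same_card_bij by (metis finite_Basis)
  define g where "g = the_inv_into Basis f"
  have g: "bij_betw g Basis Basis"
    unfolding g_def using f by (rule bij_betw_the_inv_into)
  have fg: "f b \<in> Basis" "g (f b) = b" if "b \<in> Basis" for b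
    using that f by (auto simp: g_def bij_betw_def the_inv_into_f_f)
  have gf: "g c \<in> Basis" "f (g c) = c" if "c \<in> Basis" for c
    using that f g by (auto simp: g_def bij_betw_def f_the_inv_into_f)
  define \<phi> where "\<phi> x = (\<Sum>b\<in>Basis. (x \<bullet> b) *\<^sub>R f b)" for x
  define \<psi> where "\<psi> y = (\<Sum>c\<in>Basis. (y \<bullet> c) *\<^sub>R g c)" for y
  have lin: "linear \<phi>" "linear \<psi>"
    unfolding \<phi>_def \<psi>_def by (auto intro!: linearI simp: inner_add_left scaleR_add_left sum.distrib scaleR_sum_right)
  have sel: "(\<Sum>b\<in>Basis. (c \<bullet> b) *\<^sub>R h b) = h c" if "c \<in> Basis" for c :: "'x::euclidean_space" and h :: "'x \<Rightarrow> 'y::real_vector"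
  proof -
    have "(\<Sum>b\<in>Basis. (c \<bullet> b) *\<^sub>R h b) = (\<Sum>b\<in>Basis. if b = c then h c else 0)"
      using that by (intro sum.cong) (auto simp: inner_Basis)
    then show ?thesis using that by simp
  qed
  have fb: "\<phi> b = f b" if "b \<in> Basis" for b using sel[OF that, of f] by (simp add: \<phi>_def)
  have gb: "\<psi> b = g b" if "b \<in> Basis" for b using sel[OF that, of g] by (simp add: \<psi>_def)
  show thesis
  proof
    show "bij_betw \<phi> Basis Basis" using f fb by (simp cong: bij_betw_cong)
    show "bij_betw \<psi> Basis Basis" using g gb by (simp cong: bij_betw_cong)
    show "\<psi> (\<phi> x) = x" for x
    proof -
      have "\<psi> (\<phi> x) = (\<Sum>b\<in>Basis. (x \<bullet> b) *\<^sub>R \<psi> (f b))"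
        by (simp add: \<phi>_def linear_sum[OF lin(2)] linear_cmul[OF lin(2)])
      also have "\<dots> = x" by (simp add: gb fg euclidean_representation cong: sum.cong)
      finally show ?thesis .
    qed
    show "\<phi> (\<psi> x) = x" for x
    proof -
      have "\<phi> (\<psi> x) = (\<Sum>b\<in>Basis. (x \<bullet> b) *\<^sub>R \<phi> (g b))"
        by (simp add: \<psi>_def linear_sum[OF lin(1)] linear_cmul[OF lin(1)])
      also have "\<dots> = x" by (simp add: fb gf euclidean_representation cong: sum.cong)
      finally show ?thesis .
    qed
  qed (rule lin)+
qed

text \<open>Conjugating \<open>f\<close> with a basis isometry gives an orthogonal map of
  \<open>real ^ 'k\<close>, to which \<open>uniform_sphere_orthogonal\<close> applies.\<close>

lemma distr_uniform_sphere_orthogonal: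
  fixes f :: "'a::euclidean_space \<Rightarrow> 'a"
  assumes f: "orthogonal_transformation f" and dim: "DIM('a) = CARD('k::{finite,wellorder})"
  shows "distr uniform_sphere borel f = uniform_sphere"
proof -
  obtain \<phi> :: "'a \<Rightarrow> real^'k::{finite,wellorder}" and \<psi> where *: "linear \<phi>" "bij_betw \<phi> Basis Basis" "linear \<psi>" "bij_betw \<psi> Basis Basis"
    "\<And>x. \<psi> (\<phi> x) = x" "\<And>y. \<phi> (\<psi> y) = y"
    using ex_basis_isometry[where 'a='a and 'b="real^'k::{finite,wellorder}"] dim by auto
  have linf: "linear f" using f by (simp add: orthogonal_transformation_def)
  note [measurable] = *(1,3)[THEN borel_measurable_linear] linf[THEN borel_measurable_linear]
  have g: "orthogonal_transformation (\<phi> \<circ> f \<circ> \<psi>)"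
    using f * by (auto simp: orthogonal_transformation_def inner_basis_isometry
       intro!: linear_compose)
  have [measurable]: "(\<phi> \<circ> f \<circ> \<psi>) \<in> borel_measurable borel" by (auto simp: comp_def)
  have "distr uniform_sphere borel f = distr (distr uniform_sphere borel \<psi>) borel f"
    using * by (simp add: distr_uniform_sphere_basis_isometry)
  also have "\<dots> = distr uniform_sphere borel (\<psi> \<circ> (\<phi> \<circ> f \<circ> \<psi>))"
    by (subst distr_distr) (auto simp: comp_def * cong: measurable_cong_sets)
  also have "\<dots> = distr (distr uniform_sphere borel (\<phi> \<circ> f \<circ> \<psi>)) borel \<psi>"
    by (subst distr_distr) (auto simp: comp_def cong: measurable_cong_sets)
  also have "\<dots> = uniform_sphere"
    using * by (simp add: uniform_sphere_orthogonal[OF g] distr_uniform_sphere_basis_isometry)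
  finally show ?thesis .
qed

lemma ex_orthogonal_transformation:
  fixes u v :: "'a::euclidean_space"
  assumes "norm u = norm v"
  obtains f where "orthogonal_transformation f" "f u = v"
proof (cases "u = v")
  case True
  then show ?thesis using that[of id] by (simp add: orthogonal_transformation_def linear_id)
next
  case False
  define w where "w = u - v"
  \<comment> \<open>The reflection in the hyperplane orthogonal to \<open>w\<close>; it maps
    \<open>u\<close> to \<open>v\<close> because their norms agree.\<close>
  define f where "f x = x - (2 * (x \<bullet> w) / (w \<bullet> w)) *\<^sub>R w" for x
  have ww: "w \<bullet> w \<noteq> 0" using False by (simp add: w_def)
  have uv: "u \<bullet> u = v \<bullet> v" using assms by (simp add: norm_eq_sqrt_inner)
  have "orthogonal_transformation f"
    unfolding orthogonal_transformation_def
  proof (intro conjI allI)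
    show "linear f"
      unfolding f_def by (rule linearI) (simp_all add: inner_add_left algebra_simps add_divide_distrib)
    show "f x \<bullet> f y = x \<bullet> y" for x y
      using ww by (simp add: f_def inner_diff_left inner_diff_right inner_commute field_simps)
  qed
  moreover have "2 * (u \<bullet> w) = w \<bullet> w"
    by (simp add: w_def inner_diff_left inner_diff_right inner_commute uv)
  then have "f u = v" using ww by (simp add: f_def w_def)
  ultimately show ?thesis by (rule that)
qed

section \<open>Angle sums as cone probabilities\<close>

abbreviation lborel_nn_integral :: "('a::euclidean_space \<Rightarrow> ennreal) \<Rightarrow> ennreal" (binder "LEB " 10) where
  "lborel_nn_integral f \<equiv> \<integral>\<^sup>+x. f x \<partial>lborel"

lemma AE_lborel_hyperplane:
  fixes a :: "'a::euclidean_space"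
  assumes "a \<noteq> 0"
  shows "AE v in lborel. a \<bullet> v \<noteq> b"
proof -
  have "{v. a \<bullet> v = b} \<in> null_sets lebesgue"
    using negligible_hyperplane[of a b] assms by (simp add: negligible_iff_null_sets)
  then have "AE v in lebesgue. v \<notin> {v. a \<bullet> v = b}" by (rule AE_not_in)
  then show ?thesis by (simp add: AE_completion_iff)
qed

lemma emeasure_uniform_sphere_subspace:
  fixes a :: "'a::euclidean_space"
  assumes "a \<noteq> 0"
  shows "emeasure uniform_sphere {u. a \<bullet> u = 0} = 0"
proof -
  have "AE v in lborel. a \<bullet> v \<noteq> 0"
    using assms by (rule AE_lborel_hyperplane)
  then have "AE v in uniform_measure lborel (cball (0::'a) 1). \<not> a \<bullet> (v /\<^sub>R norm v) = 0"
    by (intro AE_uniform_measureI) (auto elim!: eventually_mono)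
  then have "AE u in uniform_sphere. \<not> a \<bullet> u = 0"
    unfolding uniform_sphere_def by (subst AE_distr_iff) auto
  then show ?thesis
    using emeasure_eq_0_AE[of "\<lambda>u. a \<bullet> u = 0" uniform_sphere] by simp
qed

text \<open>From a point of a flat set only directions parallel to the hyperplane lead into the set,
  and these form a null set of the sphere.\<close>

lemma solid_angle_flat:
  fixes a :: "'a::euclidean_space"
  assumes "a \<noteq> 0" and P: "P \<subseteq> {y. a \<bullet> y = b}" and "x \<in> P"
  shows "solid_angle x P = 0"
proof -
  have "{u. \<exists>\<epsilon>>0. x + \<epsilon> *\<^sub>R u \<in> P} \<subseteq> {u. a \<bullet> u = 0}"
  proof clarify
    fix u and \<epsilon> :: real assume "\<epsilon> > 0" "x + \<epsilon> *\<^sub>R u \<in> P"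
    then have "a \<bullet> (x + \<epsilon> *\<^sub>R u) = b" "a \<bullet> x = b" using P \<open>x \<in> P\<close> by auto
    then show "a \<bullet> u = 0" using \<open>\<epsilon> > 0\<close> by (simp add: inner_add_right)
  qed
  moreover have "{u. a \<bullet> u = 0} \<in> sets uniform_sphere"
    by (simp add: closed_hyperplane)
  ultimately have "emeasure uniform_sphere {u. \<exists>\<epsilon>>0. x + \<epsilon> *\<^sub>R u \<in> P} \<le> emeasure uniform_sphere {u. a \<bullet> u = 0}"
    by (rule emeasure_mono)
  also have "\<dots> = 0" by (rule emeasure_uniform_sphere_subspace[OF \<open>a \<noteq> 0\<close>])
  finally have "emeasure uniform_sphere {u. \<exists>\<epsilon>>0. x + \<epsilon> *\<^sub>R u \<in> P} = 0" by simp
  then show ?thesis by (simp add: solid_angle_def measure_def)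
qed

text \<open>The points need not be affinely independent: if they lie in a hyperplane, both sides are \<open>0\<close>.\<close>

lemma vertex_angle_sum_convex_hull:
  fixes x :: "nat \<Rightarrow> 'a::euclidean_space"
  defines "T \<equiv> convex hull (x ` {0..DIM('a)})"
  shows "vertex_angle_sum T = (\<Sum>i = 0..DIM('a). solid_angle (x i) T)"
proof (cases "inj_on x {0..DIM('a)} \<and> \<not> affine_dependent (x ` {0..DIM('a)})")
  case True
  then have "{y. y extreme_point_of T} = x ` {0..DIM('a)}"
    by (auto simp: T_def extreme_point_of_convex_hull_affine_independent)
  then show ?thesis
    unfolding vertex_angle_sum_def using True by (simp add: sum.reindex)
next
  case False
  let ?S = "x ` {0..DIM('a)}"
  have card: "card ?S \<le> DIM('a) + 1"
    using card_image_le[of "{0..DIM('a)}" x] by simp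
  have le: "aff_dim ?S \<le> int (card ?S) - 1"
    by (rule aff_dim_le_card) simp
  \<comment> \<open>\<open>DIM('a) + 1\<close> points span the space only if they are distinct and
    affinely independent; either failure costs a dimension.\<close>
  have "aff_dim ?S < int (DIM('a))"
  proof (cases "inj_on x {0..DIM('a)}")
    case True
    then have "affine_dependent ?S" using False by simp
    then have "aff_dim ?S \<noteq> int (card ?S) - 1"
      using affine_independent_iff_card[of ?S] by auto
    then show ?thesis using le card by linarith
  next
    case False
    then have "card ?S \<noteq> DIM('a) + 1"
      using eq_card_imp_inj_on[of "{0..DIM('a)}" x] by auto
    then show ?thesis using le card by linarith
  qed
  then obtain a b where a: "a \<noteq> 0" and "?S \<subseteq> {y. a \<bullet> y = b}"
    by (rule aff_lowdim_subset_hyperplane)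
  then have T: "T \<subseteq> {y. a \<bullet> y = b}"
    unfolding T_def by (intro hull_minimal convex_hyperplane)
  have "x i \<in> T" if "i \<in> {0..DIM('a)}" for i
    unfolding T_def using that by (intro hull_inc) auto
  moreover have "y \<in> T" if "y extreme_point_of T" for y
    using that by (simp add: extreme_point_of_def)
  ultimately show ?thesis
    unfolding vertex_angle_sum_def using solid_angle_flat[OF a T] by simp
qed

text \<open>The event inside \<open>solid_angle\<close>, as a relation between the whole vertex
  tuple and the direction, so that the two can be exchanged by Fubini.\<close>

definition cone_at :: "nat \<Rightarrow> nat \<Rightarrow> (nat \<Rightarrow> 'a::euclidean_space) \<Rightarrow> 'a \<Rightarrow> bool" where
  "cone_at d i x u \<longleftrightarrow> (\<exists>\<epsilon>>0. x i + \<epsilon> *\<^sub>R u \<in> convex hull (x ` {0..d}))"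

text \<open>Convexity allows \<open>\<epsilon>\<close> to be shrunk, so reciprocals of positive
  integers suffice and the event becomes a countable union.\<close>

lemma cone_at_iff_nat:
  assumes "i \<le> d"
  shows "cone_at d i x u \<longleftrightarrow> (\<exists>n. x i + (1 / real (Suc n)) *\<^sub>R u \<in> convex hull (x ` {0..d}))"
proof
  assume "cone_at d i x u"
  then obtain \<epsilon> where \<epsilon>: "\<epsilon> > 0" "x i + \<epsilon> *\<^sub>R u \<in> convex hull (x ` {0..d})"
    by (auto simp: cone_at_def)
  obtain n where n: "1 / real (Suc n) < \<epsilon>"
    using \<epsilon>(1) nat_approx_posE by blast
  define t where "t = 1 / real (Suc n) / \<epsilon>"
  have t: "0 \<le> t" "t \<le> 1" "t * \<epsilon> = 1 / real (Suc n)"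
    using \<epsilon>(1) n by (auto simp: t_def field_simps)
  have "(1 - t) *\<^sub>R x i + t *\<^sub>R (x i + \<epsilon> *\<^sub>R u) \<in> convex hull (x ` {0..d})"
    using t \<epsilon>(2) assms by (intro convexD_alt convex_convex_hull) (auto intro: hull_inc)
  also have "(1 - t) *\<^sub>R x i + t *\<^sub>R (x i + \<epsilon> *\<^sub>R u) = x i + (1 / real (Suc n)) *\<^sub>R u"
    unfolding t(3)[symmetric] by (simp add: algebra_simps)
  finally show "\<exists>n. x i + (1 / real (Suc n)) *\<^sub>R u \<in> convex hull (x ` {0..d})" ..
next
  assume "\<exists>n. x i + (1 / real (Suc n)) *\<^sub>R u \<in> convex hull (x ` {0..d})"
  then obtain n where "x i + (1 / real (Suc n)) *\<^sub>R u \<in> convex hull (x ` {0..d})" ..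
  then show "cone_at d i x u"
    unfolding cone_at_def by (intro exI[of _ "1 / real (Suc n)"]) simp
qed

text \<open>The hull is a linear image of the standard simplex: barycentric coordinates range over a
  compact set that does not move with the points.\<close>

lemma mem_convex_hull_range_iff:
  fixes y :: "'m::finite \<Rightarrow> 'a::euclidean_space"
  shows "z \<in> convex hull (range y) \<longleftrightarrow>
    (\<exists>t \<in> convex hull (range (\<lambda>m. axis m 1)). z = (\<Sum>m\<in>UNIV. (t $ m) *\<^sub>R y m))"
proof -
  define L :: "real^'m \<Rightarrow> 'a" where "L t = (\<Sum>m\<in>UNIV. (t $ m) *\<^sub>R y m)" for t
  have "linear L"
    unfolding L_def by (rule linearI) (simp_all add: scaleR_add_left sum.distrib scaleR_sum_right)
  moreover have "L (axis m 1) = y m" for m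
  proof -
    have "L (axis m 1) = (\<Sum>k\<in>UNIV. if k = m then y m else 0)"
      unfolding L_def by (intro sum.cong) (auto simp: axis_def)
    then show ?thesis by simp
  qed
  then have "L ` range (\<lambda>m. axis m 1) = range y" by (auto simp: image_image)
  ultimately have "convex hull (range y) = L ` (convex hull (range (\<lambda>m. axis m 1)))"
    using convex_hull_linear_image by metis
  then show ?thesis by (auto simp: L_def)
qed

text \<open>For each step length the pairs of tuple and direction that land in the hull form a
  closed set, namely the projection of a closed set along the compact simplex of barycentric
  coordinates. Tuples are reindexed by \<open>'m\<close> to become points of \<open>'a ^ 'm\<close>,
  where closedness makes sense.\<close>

lemma measurable_cone_at:
  assumes "i \<le> d" and card: "CARD('m::finite) = Suc d"
  shows "Measurable.pred (PiM {0..d} (\<lambda>_. borel) \<Otimes>\<^sub>M borel)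
    (\<lambda>(x, u :: 'a::euclidean_space). cone_at d i x u)"
proof -
  obtain h :: "'m \<Rightarrow> nat" where h: "bij_betw h UNIV {0..d}"
    using finite_same_card_bij[of "UNIV::'m set" "{0..d}"] card by auto
  obtain k where k: "h k = i"
    using h assms(1) by (metis atLeastAtMost_iff bij_betw_imp_surj_on imageE zero_le)
  define \<Delta> :: "(real^'m) set" where "\<Delta> = convex hull (range (\<lambda>m. axis m 1))"
  define H where "H n = {p :: ('a^'m) \<times> 'a. \<exists>t\<in>\<Delta>. fst p $ k + (1 / real (Suc n)) *\<^sub>R snd p
    = (\<Sum>m\<in>UNIV. (t $ m) *\<^sub>R (fst p $ m))}" for n
  have "closed (H n)" for n
  proof -
    have clo: "closed {q :: (real^'m) \<times> (('a^'m) \<times> 'a). fst (snd q) $ k + (1 / real (Suc n)) *\<^sub>R snd (snd q)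
       = (\<Sum>m\<in>UNIV. (fst q $ m) *\<^sub>R (fst (snd q) $ m))}"
      by (intro closed_Collect_eq continuous_intros)
    have comp: "compact \<Delta>"
      unfolding \<Delta>_def by (intro finite_imp_compact_convex_hull) simp
    show ?thesis
      using closed_compact_projection[OF comp clo] by (simp add: H_def Bex_def)
  qed
  then have [measurable]: "H n \<in> sets borel" for n by simp
  define v where "v x = (\<chi> m. x (h m))" for x :: "nat \<Rightarrow> 'a"
  have [measurable]: "v \<in> borel_measurable (PiM {0..d} (\<lambda>_. borel))"
  proof -
    have "h m \<in> {0..d}" for m using h by (auto simp: bij_betw_def)
    then have c: "(\<lambda>x. x (h m)) \<in> borel_measurable (PiM {0..d} (\<lambda>_. borel :: 'a measure))" for m
      by (rule measurable_component_singleton)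
    have "(\<lambda>x. v x \<bullet> b) \<in> borel_measurable (PiM {0..d} (\<lambda>_. borel))" if "b \<in> Basis" for b
    proof -
      obtain m e where "b = axis m e" using \<open>b \<in> Basis\<close> by (auto simp: Basis_vec_def)
      then show ?thesis
        using borel_measurable_inner[OF c[of m] borel_measurable_const[of e]]
        by (simp add: v_def inner_axis)
    qed
    then have "(\<lambda>x. \<Sum>b\<in>Basis. (v x \<bullet> b) *\<^sub>R b) \<in> borel_measurable (PiM {0..d} (\<lambda>_. borel))"
      by (intro borel_measurable_sum borel_measurable_scaleR borel_measurable_const)
    then show ?thesis by (simp only: euclidean_representation)
  qed
  have "cone_at d i x u \<longleftrightarrow> (\<exists>n. (v x, u) \<in> H n)" for x :: "nat \<Rightarrow> 'a" and u
  proof -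
    have "x ` {0..d} = range (\<lambda>m. x (h m))"
      using bij_betw_imp_surj_on[OF h, symmetric] by (simp add: image_image)
    moreover have "z \<in> convex hull (range (\<lambda>m. x (h m))) \<longleftrightarrow> (\<exists>t\<in>\<Delta>. z = (\<Sum>m\<in>UNIV. (t $ m) *\<^sub>R x (h m)))" for z
      unfolding \<Delta>_def by (rule mem_convex_hull_range_iff)
    ultimately show ?thesis
      by (simp add: cone_at_iff_nat[OF assms(1)] H_def v_def k)
  qed
  then show ?thesis
    by (simp add: split_beta')
qed

lemma sets_PiM_uniform_sphere [measurable_cong]:
  "sets (PiM I (\<lambda>_. uniform_sphere :: 'a::euclidean_space measure)) = sets (PiM I (\<lambda>_. borel))"
  by (intro sets_PiM_cong) auto

lemma cone_at_linear_image:
  assumes lin: "linear f" and inj: "inj f" and i: "i \<le> d"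
  shows "cone_at d i (compose {0..d} f x) (f u) \<longleftrightarrow> cone_at d i x u"
proof -
  have "convex hull (compose {0..d} f x ` {0..d}) = f ` (convex hull (x ` {0..d}))"
    by (simp add: convex_hull_linear_image[OF lin] image_image compose_def)
  moreover have "compose {0..d} f x i + \<epsilon> *\<^sub>R f u = f (x i + \<epsilon> *\<^sub>R u)" for \<epsilon>
    using i by (simp add: compose_def linear_add[OF lin] linear_cmul[OF lin])
  ultimately show ?thesis
    by (simp add: cone_at_def inj_image_mem_iff[OF inj])
qed

text \<open>The types \<open>'k\<close> and \<open>'m\<close> only supply index sets: coordinates for the rotation invariance of volume,
  which the library has on \<open>real^'k\<close> with well-ordered \<open>'k\<close>, and the vertices of the simplex.\<close>

context
  fixes d i :: nat
    and mtype :: "'m::finite itself" and ktype :: "'k::{finite,wellorder} itself"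
    and atype :: "'a::euclidean_space itself"
  assumes dim: "DIM('a) = CARD('k)" and card: "CARD('m) = Suc d" and i: "i \<le> d"
begin

text \<open>Rotating all vertices together preserves their joint law, and rotating the direction
  along with them preserves the event.\<close>

lemma emeasure_cone_at_rotate:
  fixes u v :: 'a
  assumes "norm u = norm v"
  shows "emeasure (PiM {0..d} (\<lambda>_. uniform_sphere)) {x \<in> space (PiM {0..d} (\<lambda>_. uniform_sphere)). cone_at d i x u}
       = emeasure (PiM {0..d} (\<lambda>_. uniform_sphere)) {x \<in> space (PiM {0..d} (\<lambda>_. uniform_sphere)). cone_at d i x v}"
    (is "emeasure ?P _ = _")
proof -
  obtain f :: "'a \<Rightarrow> 'a" where f: "orthogonal_transformation f" "f v = u"
    using ex_orthogonal_transformation[of v u] assms by metis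
  have lin: "linear f" using f by (simp add: orthogonal_transformation_def)
  have inj: "inj f" using f by (simp add: orthogonal_transformation_inj)
  note [measurable] = borel_measurable_linear[OF lin] measurable_cone_at[OF i card]
  have "distr ?P ?P (compose {0..d} f) = PiM {0..d} (\<lambda>_. distr uniform_sphere uniform_sphere f)"
    by (intro distr_PiM_finite_prob_space') (auto intro: prob_space_uniform_sphere)
  also have "distr uniform_sphere uniform_sphere f = (uniform_sphere :: 'a measure)"
    using distr_uniform_sphere_orthogonal[OF f(1) dim] by (simp cong: distr_cong)
  finally have P: "distr ?P ?P (compose {0..d} f) = ?P" .
  have [measurable]: "compose {0..d} f \<in> measurable ?P ?P"
    unfolding compose_def by measurable
  have m: "{x \<in> space ?P. cone_at d i x u} \<in> sets ?P" by measurable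
  have "emeasure ?P {x \<in> space ?P. cone_at d i x u}
      = emeasure ?P (compose {0..d} f -` {x \<in> space ?P. cone_at d i x u} \<inter> space ?P)"
    by (subst (1) P[symmetric]) (rule emeasure_distr[OF _ m], measurable)
  also have "compose {0..d} f -` {x \<in> space ?P. cone_at d i x u} \<inter> space ?P = {x \<in> space ?P. cone_at d i x v}"
    using cone_at_linear_image[OF lin inj i, of _ v] by (auto simp: f(2) space_PiM compose_def)
  finally show ?thesis .
qed

lemma borel_measurable_solid_angle:
  "(\<lambda>x. solid_angle (x i :: 'a) (convex hull (x ` {0..d}))) \<in> borel_measurable (PiM {0..d} (\<lambda>_. borel))"
proof -
  interpret prob_space "uniform_sphere :: 'a measure" by (rule prob_space_uniform_sphere)
  note [measurable] = measurable_cone_at[OF i card]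
  have Q: "{p \<in> space (PiM {0..d} (\<lambda>_. borel) \<Otimes>\<^sub>M (uniform_sphere :: 'a measure)). case p of (x, u) \<Rightarrow> cone_at d i x u}
     \<in> sets (PiM {0..d} (\<lambda>_. borel) \<Otimes>\<^sub>M uniform_sphere)" (is "?Q \<in> _")
    by measurable
  have "(\<lambda>x. enn2real (emeasure uniform_sphere (Pair x -` ?Q))) \<in> borel_measurable (PiM {0..d} (\<lambda>_. borel))"
    using measurable_emeasure_Pair[OF Q] by measurable
  moreover have eq: "enn2real (emeasure uniform_sphere (Pair x -` ?Q)) = solid_angle (x i) (convex hull (x ` {0..d}))"
    if "x \<in> space (PiM {0..d} (\<lambda>_. borel))" for x
    using that by (simp add: solid_angle_def measure_def cone_at_def space_pair_measure vimage_def)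
  ultimately show ?thesis by (subst measurable_cong[OF eq[symmetric]])
qed

text \<open>Fubini exchanges random simplex and random direction. For almost every direction the
  inner probability equals the one for \<open>e\<close>, so the outer average is trivial.\<close>

lemma nn_integral_solid_angle:
  fixes e :: 'a
  assumes e: "norm e = 1"
  shows "(\<integral>\<^sup>+x. ennreal (solid_angle (x i :: 'a) (convex hull (x ` {0..d}))) \<partial>PiM {0..d} (\<lambda>_. uniform_sphere))
    = emeasure (PiM {0..d} (\<lambda>_. uniform_sphere)) {x \<in> space (PiM {0..d} (\<lambda>_. uniform_sphere)). cone_at d i x e}"
    (is "integral\<^sup>N ?P _ = emeasure _ ?E")
proof -
  interpret \<sigma>: prob_space "uniform_sphere :: 'a measure" by (rule prob_space_uniform_sphere)
  interpret P: prob_space ?P by (intro prob_space_PiM prob_space_uniform_sphere)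
  interpret P: pair_sigma_finite ?P "uniform_sphere :: 'a measure" ..
  note [measurable] = measurable_cone_at[OF i card]
  have "(\<integral>\<^sup>+x. ennreal (solid_angle (x i) (convex hull (x ` {0..d}))) \<partial>?P)
      = (\<integral>\<^sup>+x. \<integral>\<^sup>+u. indicator {u. cone_at d i x u} u \<partial>uniform_sphere \<partial>?P)"
  proof (rule nn_integral_cong)
    fix x assume "x \<in> space ?P"
    then have [measurable]: "x \<in> space (PiM {0..d} (\<lambda>_. borel))" by (simp add: space_PiM)
    have "Measurable.pred uniform_sphere (\<lambda>u. cone_at d i x u)" by measurable
    then have "{u. cone_at d i x u} \<in> sets uniform_sphere" by simp
    then show "ennreal (solid_angle (x i) (convex hull (x ` {0..d})))
      = (\<integral>\<^sup>+u. indicator {u. cone_at d i x u} u \<partial>uniform_sphere)"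
      by (simp add: solid_angle_def cone_at_def) (rule \<sigma>.emeasure_eq_measure[symmetric])
  qed
  also have "\<dots> = (\<integral>\<^sup>+u. \<integral>\<^sup>+x. indicator {u. cone_at d i x u} u \<partial>?P \<partial>uniform_sphere)"
    by (rule P.Fubini'[symmetric]) (simp add: indicator_def split_beta', measurable)
  also have "\<dots> = (\<integral>\<^sup>+u. emeasure ?P ?E \<partial>(uniform_sphere :: 'a measure))"
  proof (rule nn_integral_cong_AE)
    show "AE u in uniform_sphere. (\<integral>\<^sup>+x. indicator {u. cone_at d i x u} u \<partial>?P) = emeasure ?P ?E"
      using AE_uniform_sphere
    proof eventually_elim
      fix u :: 'a assume u: "norm u = 1"
      have "(\<integral>\<^sup>+x. indicator {u. cone_at d i x u} u \<partial>?P)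
         = (\<integral>\<^sup>+x. indicator {x \<in> space ?P. cone_at d i x u} x \<partial>?P)"
        by (intro nn_integral_cong) (auto simp: indicator_def)
      also have "\<dots> = emeasure ?P {x \<in> space ?P. cone_at d i x u}"
        by (rule nn_integral_indicator) measurable
      also have "\<dots> = emeasure ?P ?E"
        by (rule emeasure_cone_at_rotate) (simp add: u e)
      finally show "(\<integral>\<^sup>+x. indicator {u. cone_at d i x u} u \<partial>?P) = emeasure ?P ?E" .
    qed
  qed
  also have "\<dots> = emeasure ?P ?E" using \<sigma>.emeasure_space_1 by simp
  finally show ?thesis .
qed

end

section \<open>The law of a projected random point\<close>

text \<open>The cut-off gives the density its own support:
  \<open>inv_sqrt_pos (1 - y \<bullet> y)\<close> vanishes off the open unit ball, whereas
  \<open>sqrt\<close> of a negative number is negative.\<close>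

definition inv_sqrt_pos :: "real \<Rightarrow> real" where
  "inv_sqrt_pos v = (if v > 0 then 1 / sqrt v else 0)"

lemma borel_measurable_inv_sqrt_pos [measurable]: "inv_sqrt_pos \<in> borel_measurable borel"
  unfolding inv_sqrt_pos_def[abs_def] by measurable

lemma inv_sqrt_pos_nonneg [simp]: "inv_sqrt_pos v \<ge> 0"
  by (simp add: inv_sqrt_pos_def)

lemma inv_sqrt_pos_scale: "r > 0 \<Longrightarrow> inv_sqrt_pos (r\<^sup>2 * v) = inv_sqrt_pos v / r"
  by (auto simp: inv_sqrt_pos_def real_sqrt_mult zero_less_mult_iff)

lemma nn_integral_even:
  fixes h :: "real \<Rightarrow> ennreal"
  assumes [measurable]: "h \<in> borel_measurable borel" and even: "\<And>w. h (- w) = h w"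
  shows "(LEB w. h w) = 2 * (LEB w. h w * indicator {0..} w)"
proof -
  have "(LEB w. h w) = (LEB w. h w * indicator {0..} w + h w * indicator {..0} w)"
    using AE_lborel_singleton[of "0::real"]
    by (intro nn_integral_cong_AE) (auto elim!: eventually_mono split: split_indicator)
  also have "\<dots> = (LEB w. h w * indicator {0..} w) + (LEB w. h w * indicator {..0} w)"
    by (rule nn_integral_add) auto
  also have "(LEB w. h w * indicator {..0} w) = (LEB w. h w * indicator {0..} w)"
    by (subst nn_integral_real_affine[where c="-1" and t=0])
       (auto simp: even intro!: nn_integral_cong split: split_indicator)
  finally show ?thesis by (simp add: mult_2)
qed

lemma nn_integral_scale:
  fixes f :: "'a::euclidean_space \<Rightarrow> ennreal"
  assumes [measurable]: "f \<in> borel_measurable borel" and "t > 0"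
  shows "(LEB v. f v) = ennreal (t ^ DIM('a)) * (LEB y. f (t *\<^sub>R y))"
  using assms(2)
  by (subst lborel_affine[of t 0]) (simp_all add: nn_integral_density nn_integral_distr nn_integral_cmult)

text \<open>Substitution \<open>t = sqrt (a\<^sup>2 + w\<^sup>2)\<close>, under which
  \<open>dw\<close> becomes \<open>t / sqrt (t\<^sup>2 - a\<^sup>2)\<close> times \<open>dt\<close>.
  The factor 2 stands for the two signs of \<open>w\<close>.\<close>

lemma nn_integral_fibre:
  fixes a :: real
  assumes a: "a > 0" and [measurable]: "A \<in> sets borel"
  shows "(LEB w. indicator A (sqrt (a\<^sup>2 + w\<^sup>2)) * indicator {..1} (a\<^sup>2 + w\<^sup>2))
    = 2 * (LEB t. indicator A t * indicator {a..1} t * ennreal (t * inv_sqrt_pos (t\<^sup>2 - a\<^sup>2)))"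
proof (cases "a \<le> 1")
  case False
  then have "a\<^sup>2 > 1" by (simp add: power2_eq_square less_1_mult)
  then have "a\<^sup>2 + w\<^sup>2 \<notin> {..1}" for w :: real
  proof -
    have "0 \<le> w\<^sup>2" by simp
    then show ?thesis using \<open>a\<^sup>2 > 1\<close> unfolding atMost_iff by linarith
  qed
  then show ?thesis using False by simp
next
  case True
  define b where "b = sqrt (1 - a\<^sup>2)"
  have b: "0 \<le> b" "a\<^sup>2 + b\<^sup>2 = 1" using True a by (auto simp: b_def power_le_one)
  have le_b: "w \<le> b \<longleftrightarrow> a\<^sup>2 + w\<^sup>2 \<le> 1" if "w \<ge> 0" for w
    using b that by (smt (verit, best) power2_le_imp_le power_mono)
  define g where "g w = sqrt (a\<^sup>2 + w\<^sup>2)" for w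
  have pos: "a\<^sup>2 + w\<^sup>2 > 0" for w using a by (simp add: add_pos_nonneg)
  have g0: "g 0 = a" "g b = 1" using a b by (auto simp: g_def)
  define f where "f t = indicator A t * (t * inv_sqrt_pos (t\<^sup>2 - a\<^sup>2))" for t
  have "(LEB t. f t * indicator {g 0..g b} t) = (LEB w. f (g w) * (w / g w) * indicator {0..b} w)"
  proof (rule nn_integral_substitution)
    show "set_borel_measurable borel {g 0..g b} f"
      unfolding f_def set_borel_measurable_def by measurable
    show "(g has_real_derivative w / g w) (at w)" for w
      unfolding g_def using pos[of w] by (auto intro!: derivative_eq_intros simp: field_simps)
    show "continuous_on {0..b} (\<lambda>w. w / g w)"
      unfolding g_def using pos by (auto intro!: continuous_intros simp: less_imp_neq[symmetric])
  qed (use b pos in \<open>auto simp: g_def\<close>)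
  also have "(LEB t. f t * indicator {g 0..g b} t)
    = (LEB t. indicator A t * indicator {a..1} t * ennreal (t * inv_sqrt_pos (t\<^sup>2 - a\<^sup>2)))"
    by (intro nn_integral_cong) (auto simp: f_def g0 split: split_indicator)
  also have "(LEB w. f (g w) * (w / g w) * indicator {0..b} w)
    = (LEB w. indicator A (g w) * indicator {..1} (a\<^sup>2 + w\<^sup>2) * indicator {0..} w)"
  proof (rule nn_integral_cong_AE)
    show "AE w in lborel. ennreal (f (g w) * (w / g w) * indicator {0..b} w)
        = indicator A (g w) * indicator {..1} (a\<^sup>2 + w\<^sup>2) * indicator {0..} w"
      using AE_lborel_singleton[of "0::real"]
    proof eventually_elim
      fix w :: real assume w: "w \<noteq> 0"
      show "ennreal (f (g w) * (w / g w) * indicator {0..b} w)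
        = indicator A (g w) * indicator {..1} (a\<^sup>2 + w\<^sup>2) * indicator {0..} w"
      proof (cases "w > 0")
        case True
        have "(g w)\<^sup>2 - a\<^sup>2 = w\<^sup>2" "g w > 0" using pos[of w] by (auto simp: g_def)
        then have "f (g w) * (w / g w) = indicator A (g w)"
          using True by (auto simp: f_def inv_sqrt_pos_def)
        then show ?thesis
          using True le_b[of w] by (auto split: split_indicator)
      qed (use w in \<open>auto split: split_indicator\<close>)
    qed
  qed
  finally show ?thesis
    by (subst nn_integral_even) (auto simp: g_def)
qed

text \<open>For a fixed projection \<open>v\<close> of a point of the ball the last coordinate is replaced by the norm \<open>t\<close>
  of the point; then \<open>v = t *\<^sub>R y\<close> with \<open>y\<close> the projection of the normalised point.\<close>

lemma distr_uniform_sphere_fst: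
  "\<exists>C. distr uniform_sphere borel (fst :: 'a::euclidean_space \<times> real \<Rightarrow> 'a) = density lborel (\<lambda>y::'a::euclidean_space. C * ennreal (inv_sqrt_pos (1 - y \<bullet> y)))"
proof -
  let ?B = "cball 0 1 :: ('a \<times> real) set"
  let ?n = "\<lambda>x :: 'a \<times> real. x /\<^sub>R norm x"
  have [simp, measurable]: "(fst :: 'a \<times> real \<Rightarrow> 'a) \<in> borel_measurable borel"
    by (intro borel_measurable_continuous_onI continuous_intros)
  have h: "(\<lambda>x :: 'a \<times> real. fst x /\<^sub>R norm x) \<in> borel_measurable borel"
    by (intro borel_measurable_scaleR borel_measurable_inverse borel_measurable_norm) simp_all
  define c where "c = emeasure lborel ?B"
  \<comment> \<open>The radial part: the scaling \<open>v = t *\<^sub>R y\<close> contributes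
    \<open>t ^ DIM('a)\<close>. Its value is left open, since normalisation fixes the overall
    constant later.\<close>
  define K where "K = (LEB t. indicator {0<..1::real} t * ennreal (t ^ DIM('a)))"
  define C where "C = 2 * K / c"
  have "emeasure (distr uniform_sphere borel (fst :: 'a \<times> real \<Rightarrow> 'a)) A = emeasure (density lborel (\<lambda>y. C * ennreal (inv_sqrt_pos (1 - y \<bullet> y)))) A"
    if [measurable]: "A \<in> sets borel" for A :: "'a set"
  proof -
    let ?k = "\<lambda>v t. indicator A (v /\<^sub>R t) * indicator {norm v..1} t * ennreal (t * inv_sqrt_pos (t\<^sup>2 - (norm v)\<^sup>2)) :: ennreal"
    let ?J = "LEB y. indicator A y * ennreal (inv_sqrt_pos (1 - y \<bullet> y))"
    have "emeasure (distr uniform_sphere borel (fst :: 'a \<times> real \<Rightarrow> 'a)) A = (\<integral>\<^sup>+y. indicator A y \<partial>distr uniform_sphere borel (fst :: 'a \<times> real \<Rightarrow> 'a))"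
      by simp
    also have "\<dots> = (\<integral>\<^sup>+x. indicator A (fst x) \<partial>(uniform_sphere :: ('a \<times> real) measure))"
      by (rule nn_integral_distr) simp_all
    also have "\<dots> = (\<integral>\<^sup>+x. indicator A (fst (?n x)) \<partial>uniform_measure lborel ?B)"
      unfolding uniform_sphere_def by (rule nn_integral_distr) measurable
    also have "\<dots> = (LEB x. indicator A (fst (?n x)) * indicator ?B x) / c"
      unfolding c_def by (rule nn_integral_uniform_measure) measurable
    also have "(LEB x. indicator A (fst (?n x)) * indicator ?B x)
      = (LEB v. LEB w. indicator A (fst (?n (v, w))) * indicator ?B (v, w))"
      unfolding lborel_prod[symmetric] by (subst lborel.nn_integral_fst[symmetric]) (auto simp: lborel_prod intro!: borel_measurable_times_ennreal measurable_compose[OF h] borel_measurable_indicator)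
    also have "\<dots> = (LEB v. 2 * (LEB t. ?k v t))"
    proof (rule nn_integral_cong_AE)
      show "AE v in lborel. (LEB w. indicator A (fst (?n (v, w))) * indicator ?B (v, w))
         = 2 * (LEB t. ?k v t)"
        using AE_lborel_singleton[of "0::'a"]
      proof eventually_elim
        fix v :: 'a assume "v \<noteq> 0"
        then have nv: "norm v > 0" by simp
        have m: "(\<lambda>t. v /\<^sub>R t) -` A \<in> sets borel" by (rule measurable_sets_borel) measurable
        show "(LEB w. indicator A (fst (?n (v, w))) * indicator ?B (v, w))
         = 2 * (LEB t. ?k v t)"
          using nn_integral_fibre[OF nv m]
          by (simp add: norm_Pair indicator_def vimage_def cong: if_cong)
      qed
    qed
    also have "\<dots> = 2 * (LEB v. LEB t. ?k v t)"
      by (rule nn_integral_cmult) (simp add: indicator_def cong: if_cong)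
    also have "(LEB v. LEB t. ?k v t)
      = (LEB t. LEB v. ?k v t)"
      by (rule lborel_pair.Fubini'[symmetric]) (simp add: split_beta' indicator_def cong: if_cong)
    also have "\<dots> = (LEB t. indicator {0<..1} t * ennreal (t ^ DIM('a)) * ?J)"
    proof (rule nn_integral_cong_AE)
      show "AE t in lborel. (LEB v. ?k v t)
         = indicator {0<..1} t * ennreal (t ^ DIM('a)) * ?J"
        using AE_lborel_singleton[of "0::real"]
      proof eventually_elim
        fix t :: real assume "t \<noteq> 0"
        show "(LEB v. ?k v t)
         = indicator {0<..1} t * ennreal (t ^ DIM('a)) * ?J"
        proof (cases "0 < t \<and> t \<le> 1")
          case True
          have "indicator A ((t *\<^sub>R y) /\<^sub>R t) * indicator {norm (t *\<^sub>R y)..1} t * ennreal (t * inv_sqrt_pos (t\<^sup>2 - (norm (t *\<^sub>R y))\<^sup>2))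
             = indicator A y * ennreal (inv_sqrt_pos (1 - y \<bullet> y))" for y :: 'a
          proof -
            have "t\<^sup>2 - (norm (t *\<^sub>R y))\<^sup>2 = t\<^sup>2 * (1 - y \<bullet> y)"
              by (simp add: power_mult_distrib dot_square_norm algebra_simps)
            \<comment> \<open>Where the density is nonzero, \<open>y\<close> lies in the unit ball,
              which already implies the constraint on the norm.\<close>
            moreover have "norm (t *\<^sub>R y) \<le> t \<or> inv_sqrt_pos (1 - y \<bullet> y) = 0"
              using True by (auto simp: inv_sqrt_pos_def dot_square_norm power2_eq_square[symmetric]
                abs_square_less_1)
            ultimately show ?thesis
              using True by (auto simp: inv_sqrt_pos_scale split: split_indicator)
          qed
          then show ?thesis
            using True by (subst nn_integral_scale[of _ t]) (auto simp: indicator_def cong: if_cong)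
        next
          case False
          then have "t \<notin> {norm v..1}" for v :: 'a using \<open>t \<noteq> 0\<close> by (force dest: order_trans[OF norm_ge_zero])
          then show ?thesis using False by auto
        qed
      qed
    qed
    also have "\<dots> = K * ?J"
      unfolding K_def by (rule nn_integral_multc) measurable
    finally have "emeasure (distr uniform_sphere borel (fst :: 'a \<times> real \<Rightarrow> 'a)) A
      = C * ?J"
      by (simp add: C_def mult_ac divide_ennreal_def)
    also have "\<dots> = (LEB y. C * (indicator A y * ennreal (inv_sqrt_pos (1 - y \<bullet> y))))"
      by (rule nn_integral_cmult[symmetric]) measurable
    also have "\<dots> = emeasure (density lborel (\<lambda>y. C * ennreal (inv_sqrt_pos (1 - y \<bullet> y)))) A"
      by (simp add: emeasure_density mult_ac)
    finally show ?thesis .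
  qed
  then show ?thesis by (intro exI measure_eqI) auto
qed

type_synonym space3 = "(real \<times> real) \<times> real"

type_synonym space4 = "space3 \<times> real"

section \<open>Random half-spaces\<close>

lemma borel_measurable_inner_const [measurable]:
  "(\<lambda>x. a \<bullet> x) \<in> borel_measurable (borel :: 'a::euclidean_space measure)"
  by (intro borel_measurable_inner) auto

lemma measurable_halfspace [measurable]:
  fixes a :: "'a::euclidean_space"
  shows "{x. a \<bullet> x < s} \<in> sets uniform_sphere" "{x. s < a \<bullet> x} \<in> sets uniform_sphere" "{x. a \<bullet> x = s} \<in> sets uniform_sphere"
  by (simp_all add: open_halfspace_lt open_halfspace_gt closed_hyperplane)

text \<open>The probability that two random points lie on different sides of the hyperplane at signed
  distance \<open>t\<close> from the centre,
  \<open>e\<close> being any unit vector.\<close>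

definition sep_prob :: "'a::euclidean_space \<Rightarrow> real \<Rightarrow> ennreal" where
  "sep_prob e t = 2 * (emeasure (distr uniform_sphere borel (\<lambda>x. e \<bullet> x)) {..<t}
    * emeasure (distr uniform_sphere borel (\<lambda>x. e \<bullet> x)) {t<..})"

context
  fixes e :: "'a::euclidean_space" and ktype :: "'k::{finite,wellorder} itself"
  assumes e: "norm e = 1" and dim: "DIM('a) = CARD('k)"
begin

text \<open>A rotation takes \<open>a /\<^sub>R norm a\<close> to \<open>e\<close>, so the
  coordinate along every unit vector has the same law.\<close>

lemma distr_uniform_sphere_inner:
  fixes a :: 'a
  assumes "a \<noteq> 0"
  shows "distr uniform_sphere borel (\<lambda>x. a \<bullet> x / norm a) = distr uniform_sphere borel (\<lambda>x. e \<bullet> x)"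
proof -
  obtain f :: "'a \<Rightarrow> 'a" where f: "orthogonal_transformation f" "f (a /\<^sub>R norm a) = e"
    using ex_orthogonal_transformation[of "a /\<^sub>R norm a" e] assms e by auto
  have [measurable]: "f \<in> borel_measurable borel"
    using f(1) by (intro borel_measurable_linear) (simp add: orthogonal_transformation_def)
  have "distr uniform_sphere borel (\<lambda>x. e \<bullet> x) = distr (distr uniform_sphere borel f) borel (\<lambda>x. e \<bullet> x)"
    by (simp add: distr_uniform_sphere_orthogonal[OF f(1) dim])
  also have "\<dots> = distr uniform_sphere borel (\<lambda>x. e \<bullet> f x)"
    by (subst distr_distr) (auto simp: comp_def)
  also have "(\<lambda>x. e \<bullet> f x) = (\<lambda>x. (a /\<^sub>R norm a) \<bullet> x)"
    using f(1) unfolding f(2)[symmetric] by (simp add: orthogonal_transformation_def)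
  finally show ?thesis by (simp add: divide_inverse mult.commute)
qed

lemma emeasure_uniform_sphere_halfspace:
  fixes a :: 'a
  assumes "a \<noteq> 0"
  shows "emeasure uniform_sphere {x. a \<bullet> x < s} = emeasure (distr uniform_sphere borel (\<lambda>x. e \<bullet> x)) {..<s / norm a}"
    and "emeasure uniform_sphere {x. s < a \<bullet> x} = emeasure (distr uniform_sphere borel (\<lambda>x. e \<bullet> x)) {s / norm a<..}"
    and "emeasure uniform_sphere {x. a \<bullet> x = s} = emeasure (distr uniform_sphere borel (\<lambda>x. e \<bullet> x)) {s / norm a}"
proof -
  have "{x. a \<bullet> x < s} = (\<lambda>x. a \<bullet> x / norm a) -` {..<s / norm a}"
    "{x. s < a \<bullet> x} = (\<lambda>x. a \<bullet> x / norm a) -` {s / norm a<..}"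
    "{x. a \<bullet> x = s} = (\<lambda>x. a \<bullet> x / norm a) -` {s / norm a}"
    using divide_less_cancel[of _ "norm a"] assms by auto
  then show "emeasure uniform_sphere {x. a \<bullet> x < s} = emeasure (distr uniform_sphere borel (\<lambda>x. e \<bullet> x)) {..<s / norm a}"
    "emeasure uniform_sphere {x. s < a \<bullet> x} = emeasure (distr uniform_sphere borel (\<lambda>x. e \<bullet> x)) {s / norm a<..}"
    "emeasure uniform_sphere {x. a \<bullet> x = s} = emeasure (distr uniform_sphere borel (\<lambda>x. e \<bullet> x)) {s / norm a}"
    unfolding distr_uniform_sphere_inner[OF assms, symmetric] by (simp_all add: emeasure_distr)
qed

text \<open>The antipodal map exchanges the two sides. Evenness permits the use of signed offsets
  whose sign depends on the order of the points.\<close>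

lemma sep_prob_even: "sep_prob e (- t) = sep_prob e t"
proof -
  have "e \<noteq> 0" using e by auto
  then have D: "distr uniform_sphere borel (\<lambda>x. e \<bullet> x) = distr uniform_sphere borel (\<lambda>x. - (e \<bullet> x))"
    using distr_uniform_sphere_inner[of "- e"] e by simp
  have *: "emeasure (distr uniform_sphere borel (\<lambda>x. e \<bullet> x)) {..<- t} = emeasure (distr uniform_sphere borel (\<lambda>x. e \<bullet> x)) {t<..}" for t
    by (subst D) (simp add: emeasure_distr vimage_def)
  show ?thesis
    unfolding sep_prob_def using *[of t] *[of "- t"] by (simp add: mult.commute)
qed

lemma borel_measurable_sep_prob [measurable]: "sep_prob e \<in> borel_measurable borel"
proof -
  let ?D = "distr uniform_sphere borel (\<lambda>x. e \<bullet> x)"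
  interpret prob_space ?D
    by (intro prob_space.prob_space_distr prob_space_uniform_sphere) measurable
  have "{p \<in> space (borel \<Otimes>\<^sub>M ?D). snd p < (fst p :: real)} \<in> sets (borel \<Otimes>\<^sub>M ?D)" "{p \<in> space (borel \<Otimes>\<^sub>M ?D). (fst p :: real) < snd p} \<in> sets (borel \<Otimes>\<^sub>M ?D)"
    by measurable
  from this[THEN measurable_emeasure_Pair] show ?thesis
    unfolding sep_prob_def by (simp add: vimage_def lessThan_def greaterThan_def space_pair_measure)
qed

text \<open>The product is negative iff each open side contains one of the points; the two ways of
  assigning them give the factor 2 in \<open>sep_prob\<close>.\<close>

lemma nn_integral_separated:
  fixes a :: 'a
  assumes "a \<noteq> 0"
  shows "(\<integral>\<^sup>+p. \<integral>\<^sup>+q. indicator {r. r < 0} ((a \<bullet> p - s) * (a \<bullet> q - s)) \<partial>uniform_sphere \<partial>uniform_sphere) = sep_prob e (s / norm a)"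
proof -
  interpret prob_space "uniform_sphere :: 'a measure" by (rule prob_space_uniform_sphere)
  let ?A = "{x. a \<bullet> x < s}" and ?B = "{x. s < a \<bullet> x}"
  let ?\<sigma> = "uniform_sphere :: 'a measure"
  have "(\<integral>\<^sup>+p. \<integral>\<^sup>+q. indicator {r. r < 0} ((a \<bullet> p - s) * (a \<bullet> q - s)) \<partial>?\<sigma> \<partial>?\<sigma>)
     = (\<integral>\<^sup>+p. \<integral>\<^sup>+q. indicator ?A p * indicator ?B q + indicator ?B p * indicator ?A q \<partial>?\<sigma> \<partial>?\<sigma>)"
    by (intro nn_integral_cong) (auto simp: mult_less_0_iff split: split_indicator)
  also have "\<dots> = (\<integral>\<^sup>+p. indicator ?A p * emeasure ?\<sigma> ?B + indicator ?B p * emeasure ?\<sigma> ?A \<partial>?\<sigma>)"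
    by (intro nn_integral_cong) (simp add: nn_integral_add nn_integral_cmult)
  also have "\<dots> = emeasure ?\<sigma> ?A * emeasure ?\<sigma> ?B + emeasure ?\<sigma> ?B * emeasure ?\<sigma> ?A"
    by (simp add: nn_integral_add nn_integral_multc)
  also have "\<dots> = sep_prob e (s / norm a)"
    unfolding sep_prob_def by (simp add: emeasure_uniform_sphere_halfspace(1,2)[OF assms] mult.commute mult_2)
  finally show ?thesis .
qed

end

text \<open>Scaling by \<open>sqrt v\<close> shows that the mass of a fibre does not depend on its
  length. This is the source of Archimedes' theorem that two coordinates fewer turn the sphere into
  a uniformly filled ball.\<close>

lemma nn_integral_inv_sqrt_pos:
  "(LEB z. ennreal (inv_sqrt_pos (v - z\<^sup>2)))
    = indicator {0<..} v * (LEB z. ennreal (inv_sqrt_pos (1 - z\<^sup>2)))"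
proof (cases "v > 0")
  case True
  define r where "r = sqrt v"
  have r: "r > 0" "v = r\<^sup>2" using True by (auto simp: r_def)
  have "v - (0 + r * z)\<^sup>2 = r\<^sup>2 * (1 - z\<^sup>2)" for z
    by (simp add: r(2) power_mult_distrib algebra_simps)
  then have "(LEB z. ennreal (inv_sqrt_pos (v - z\<^sup>2)))
     = ennreal \<bar>r\<bar> * (LEB z. ennreal (inv_sqrt_pos (1 - z\<^sup>2) / r))"
    using r(1) by (subst nn_integral_real_affine[where c=r and t=0]) (auto simp: inv_sqrt_pos_scale)
  also have "\<dots> = (LEB z. ennreal \<bar>r\<bar> * ennreal (inv_sqrt_pos (1 - z\<^sup>2) / r))"
    by (rule nn_integral_cmult[symmetric]) measurable
  also have "\<dots> = (LEB z. ennreal (inv_sqrt_pos (1 - z\<^sup>2)))"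
    using r(1) by (simp add: ennreal_mult[symmetric])
  finally show ?thesis using True by simp
next
  case False
  then have "inv_sqrt_pos (v - z\<^sup>2) = 0" for z
    by (auto simp: inv_sqrt_pos_def dest: order.strict_trans1[OF zero_le_power2])
  then show ?thesis using False by simp
qed

section \<open>The offset of a random line and of a random plane\<close>

lemma nn_integral_lborel_pair:
  fixes f :: "'a::euclidean_space \<times> 'b::euclidean_space \<Rightarrow> ennreal"
  assumes "f \<in> borel_measurable (borel \<Otimes>\<^sub>M borel)"
  shows "(LEB y. f y) = (LEB x. LEB z. f (x, z))"
  using assms unfolding lborel_prod[symmetric] by (subst lborel.nn_integral_fst[symmetric]) auto

lemma nn_integral_lborel_rotate3:
  fixes f :: "'a::euclidean_space \<Rightarrow> 'b::euclidean_space \<Rightarrow> 'c::euclidean_space \<Rightarrow> ennreal"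
  assumes [measurable]: "(\<lambda>(x, y, z). f x y z) \<in> borel_measurable (borel \<Otimes>\<^sub>M (borel \<Otimes>\<^sub>M borel))"
  shows "(LEB x. LEB y. LEB z. f x y z)
    = (LEB z. LEB x. LEB y. f x y z)"
proof -
  have "(LEB x. LEB y. LEB z. f x y z)
    = (LEB x. LEB z. LEB y. f x y z)"
    by (intro nn_integral_cong lborel_pair.Fubini') measurable
  also have "\<dots> = (LEB z. LEB x. LEB y. f x y z)"
  proof (intro lborel_pair.Fubini')
    have "(\<lambda>p. (snd (fst p), snd p, fst (fst p))) \<in> (borel \<Otimes>\<^sub>M borel) \<Otimes>\<^sub>M borel \<rightarrow>\<^sub>M borel \<Otimes>\<^sub>M (borel \<Otimes>\<^sub>M borel)"
      by measurable
    from measurable_compose[OF this assms]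
    have [measurable]: "(\<lambda>p. f (snd (fst p)) (snd p) (fst (fst p))) \<in> borel_measurable ((borel \<Otimes>\<^sub>M borel) \<Otimes>\<^sub>M borel)"
      by simp
    show "(\<lambda>(z, x). LEB y. f x y z) \<in> borel_measurable (lborel \<Otimes>\<^sub>M lborel)"
      by measurable
  qed
  finally show ?thesis .
qed

text \<open>For fixed \<open>x0\<close>, \<open>x1\<close> the heights depend linearly on slope and intercept. This replaces the affine
  Blaschke--Petkantschin formula.\<close>

lemma nn_integral_line_graph:
  fixes F :: "real \<Rightarrow> real \<Rightarrow> ennreal"
  assumes [measurable]: "(\<lambda>(z0, z1). F z0 z1) \<in> borel_measurable (borel \<Otimes>\<^sub>M borel)" and x: "x0 \<noteq> x1"
  shows "(LEB z0. LEB z1. F z0 z1)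
    = ennreal \<bar>x1 - x0\<bar> * (LEB a. LEB c. F (a * x0 + c) (a * x1 + c))"
proof -
  have "(LEB z0. LEB z1. F z0 z1)
      = (LEB z0. ennreal \<bar>x1 - x0\<bar> * (LEB a. F z0 (z0 + (x1 - x0) * a)))"
    using x by (intro nn_integral_cong nn_integral_real_affine) auto
  also have "\<dots> = ennreal \<bar>x1 - x0\<bar> * (LEB z0. LEB a. F z0 (z0 + (x1 - x0) * a))"
    by (intro nn_integral_cmult) measurable
  also have "(LEB z0. LEB a. F z0 (z0 + (x1 - x0) * a))
      = (LEB a. LEB z0. F z0 (z0 + (x1 - x0) * a))"
    by (intro lborel_pair.Fubini') measurable
  also have "\<dots> = (LEB a. ennreal \<bar>1\<bar> * (LEB c. F (a * x0 + 1 * c) ((a * x0 + 1 * c) + (x1 - x0) * a)))"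
    by (intro nn_integral_cong nn_integral_real_affine) auto
  finally show ?thesis by (simp add: algebra_simps)
qed

text \<open>The signed distance of the line through \<open>p\<close> and \<open>q\<close> from the
  origin; exchanging the points reverses the sign.\<close>

definition line_offset :: "real \<times> real \<Rightarrow> real \<times> real \<Rightarrow> real" where
  "line_offset p q = (fst q * snd p - fst p * snd q) / sqrt ((fst q - fst p)\<^sup>2 + (snd q - snd p)\<^sup>2)"

abbreviation ball_density :: "'a::euclidean_space \<Rightarrow> ennreal" where
  "ball_density y \<equiv> ennreal (inv_sqrt_pos (1 - y \<bullet> y))"

text \<open>The line at distance \<open>s\<close> cuts a chord of half-length
  \<open>r = sqrt (1 - s\<^sup>2)\<close> from the unit disc, and the density on it is a rescaled
  copy of the one-dimensional one. Two substitutions contribute \<open>(r / t)\<^sup>2\<close>, the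
  distance of the points \<open>r / t\<close> and the densities \<open>1 / r\<^sup>2\<close>, in all
  \<open>r / t ^ 3\<close>.\<close>

lemma nn_integral_line_section:
  fixes a s :: real
  defines "t \<equiv> sqrt (1 + a\<^sup>2)"
  shows "(LEB x0. LEB x1. ennreal \<bar>x1 - x0\<bar> *
      (ennreal (inv_sqrt_pos (1 - x0\<^sup>2 - (a * x0 + t * s)\<^sup>2)) * ennreal (inv_sqrt_pos (1 - x1\<^sup>2 - (a * x1 + t * s)\<^sup>2))))
    = ennreal (sqrt (1 - s\<^sup>2)) * ennreal (1 / t ^ 3) *
      (LEB u0. LEB u1. ennreal \<bar>u1 - u0\<bar> *
      (ennreal (inv_sqrt_pos (1 - u0\<^sup>2)) * ennreal (inv_sqrt_pos (1 - u1\<^sup>2))))"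
proof -
  have t: "t > 0" "t\<^sup>2 = 1 + a\<^sup>2" by (simp_all add: t_def add_pos_nonneg)
  have quad: "1 - x\<^sup>2 - (a * x + t * s)\<^sup>2 = (1 - s\<^sup>2) - (t * x + a * s)\<^sup>2" for x
  proof -
    have "x\<^sup>2 + (a * x + t * s)\<^sup>2 = (1 + a\<^sup>2) * x\<^sup>2 + 2 * a * t * s * x + t\<^sup>2 * s\<^sup>2" by (simp add: power2_eq_square algebra_simps)
    also have "\<dots> = t\<^sup>2 * x\<^sup>2 + 2 * a * t * s * x + (1 + a\<^sup>2) * s\<^sup>2" by (simp add: t(2))
    also have "\<dots> = s\<^sup>2 + (t * x + a * s)\<^sup>2" by (simp add: power2_eq_square algebra_simps)
    finally show ?thesis by simp
  qed
  show ?thesis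
  proof (cases "s\<^sup>2 < 1")
    case False
    then have "inv_sqrt_pos ((1 - s\<^sup>2) - (t * x + a * s)\<^sup>2) = 0" for x
      by (auto simp: inv_sqrt_pos_def dest: order.strict_trans1[OF zero_le_power2])
    moreover have "ennreal (sqrt (1 - s\<^sup>2)) = 0" using False by (simp add: ennreal_eq_0_iff)
    ultimately show ?thesis unfolding quad by simp
  next
    case True
    define r where "r = sqrt (1 - s\<^sup>2)"
    have r: "r > 0" "r\<^sup>2 = 1 - s\<^sup>2" using True by (auto simp: r_def)
    \<comment> \<open>Seen along the horizontal axis, the chord has half-length \<open>k\<close> and
      midpoint \<open>m\<close>, the foot of the perpendicular from the centre.\<close>
    define k where "k = r / t"
    define m where "m = - (a * s) / t"
    have k: "k > 0" using r t by (simp add: k_def)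
    have x: "t * (m + k * u) + a * s = r * u" for u
      using t(1) by (simp add: m_def k_def field_simps)
    have den: "inv_sqrt_pos (1 - (m + k * u)\<^sup>2 - (a * (m + k * u) + t * s)\<^sup>2) = inv_sqrt_pos (1 - u\<^sup>2) / r" for u
    proof -
      have "(1 - s\<^sup>2) - (r * u)\<^sup>2 = r\<^sup>2 * (1 - u\<^sup>2)"
        by (simp add: r(2)[symmetric] power_mult_distrib algebra_simps)
      then show ?thesis unfolding quad x using r(1) by (simp add: inv_sqrt_pos_scale)
    qed
    let ?q = "\<lambda>x. ennreal (inv_sqrt_pos (1 - x\<^sup>2 - (a * x + t * s)\<^sup>2))"
    let ?p = "\<lambda>x. ennreal (inv_sqrt_pos (1 - x\<^sup>2))"
    have "(LEB x0. LEB x1. ennreal \<bar>x1 - x0\<bar> * (?q x0 * ?q x1))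
      = (LEB x0. ennreal \<bar>k\<bar> * (LEB u1. ennreal \<bar>(m + k * u1) - x0\<bar> * (?q x0 * ?q (m + k * u1))))"
      using k by (intro nn_integral_cong nn_integral_real_affine) auto
    also have "\<dots> = ennreal \<bar>k\<bar> * (LEB u0. ennreal \<bar>k\<bar> * (LEB u1. ennreal \<bar>(m + k * u1) - (m + k * u0)\<bar> * (?q (m + k * u0) * ?q (m + k * u1))))"
      using k by (intro nn_integral_real_affine) auto
    also have "\<dots> = (LEB u0. LEB u1. ennreal \<bar>k\<bar> * (ennreal \<bar>k\<bar> * (ennreal \<bar>(m + k * u1) - (m + k * u0)\<bar> * (?q (m + k * u0) * ?q (m + k * u1)))))"
      by (simp add: nn_integral_cmult)
    also have "\<dots> = (LEB u0. LEB u1. ennreal (r / t ^ 3) * (ennreal \<bar>u1 - u0\<bar> * (?p u0 * ?p u1)))"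
    proof (intro nn_integral_cong)
      fix u0 u1
      have "k * (k * (\<bar>(m + k * u1) - (m + k * u0)\<bar> * ((inv_sqrt_pos (1 - u0\<^sup>2) / r) * (inv_sqrt_pos (1 - u1\<^sup>2) / r))))
         = r / t ^ 3 * (\<bar>u1 - u0\<bar> * (inv_sqrt_pos (1 - u0\<^sup>2) * inv_sqrt_pos (1 - u1\<^sup>2)))"
      proof -
        have "\<bar>(m + k * u1) - (m + k * u0)\<bar> = k * \<bar>u1 - u0\<bar>"
          using k by (simp add: right_diff_distrib[symmetric] abs_mult)
        then show ?thesis using r(1) t(1) by (simp add: k_def field_simps power2_eq_square power3_eq_cube)
      qed
      then show "ennreal \<bar>k\<bar> * (ennreal \<bar>k\<bar> * (ennreal \<bar>(m + k * u1) - (m + k * u0)\<bar> * (?q (m + k * u0) * ?q (m + k * u1))))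
         = ennreal (r / t ^ 3) * (ennreal \<bar>u1 - u0\<bar> * (?p u0 * ?p u1))"
        using k r(1) t(1) unfolding den by (simp add: ennreal_mult[symmetric])
    qed
    also have "\<dots> = ennreal (r / t ^ 3) * (LEB u0. LEB u1. ennreal \<bar>u1 - u0\<bar> * (?p u0 * ?p u1))"
      by (simp add: nn_integral_cmult)
    also have "ennreal (r / t ^ 3) = ennreal (sqrt (1 - s\<^sup>2)) * ennreal (1 / t ^ 3)"
      using r(1) t(1) by (simp add: r_def ennreal_mult[symmetric])
    finally show ?thesis .
  qed
qed

text \<open>Describing two points by their line and their positions on it separates the slope from
  the distance \<open>s\<close>. \<open>K\<close> is chosen before \<open>\<Phi>\<close>, so it can
  be found from a constant \<open>\<Phi>\<close>.\<close>

lemma line_offset_law: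
  "\<exists>K. \<forall>\<Phi>. \<Phi> \<in> borel_measurable borel \<longrightarrow> (\<forall>t. \<Phi> (- t) = \<Phi> t) \<longrightarrow>
    (LEB p. LEB q. ball_density p * ball_density q * \<Phi> (line_offset p q))
      = K * (LEB s. ennreal (sqrt (1 - s\<^sup>2)) * \<Phi> s)"
proof (intro exI allI impI)
  fix \<Phi> :: "real \<Rightarrow> ennreal"
  assume [measurable]: "\<Phi> \<in> borel_measurable borel" and even: "\<forall>t. \<Phi> (- t) = \<Phi> t"
  let ?q = "\<lambda>x z. ennreal (inv_sqrt_pos (1 - x\<^sup>2 - z\<^sup>2))"
  let ?off = "\<lambda>x0 z0 x1 z1. line_offset (x0, z0) (x1, z1)"
  let ?t = "\<lambda>a :: real. sqrt (1 + a\<^sup>2)"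
  let ?G = "\<lambda>x0 z0 x1 z1. ?q x0 z0 * ?q x1 z1 * \<Phi> (?off x0 z0 x1 z1)"
  let ?H = "\<lambda>x0 x1 \<alpha>. ennreal \<bar>x1 - x0\<bar> * (?q x0 (fst \<alpha> * x0 + snd \<alpha>) * ?q x1 (fst \<alpha> * x1 + snd \<alpha>)) *
       \<Phi> (snd \<alpha> / sqrt (1 + (fst \<alpha>)\<^sup>2))"
  let ?w = "\<lambda>a c. LEB x0. LEB x1. ennreal \<bar>x1 - x0\<bar> * (?q x0 (a * x0 + c) * ?q x1 (a * x1 + c))"
  let ?I = "LEB s. ennreal (sqrt (1 - s\<^sup>2)) * \<Phi> s"
  define W where "W = (LEB u0. LEB u1. ennreal \<bar>u1 - u0\<bar> *
      (ennreal (inv_sqrt_pos (1 - u0\<^sup>2)) * ennreal (inv_sqrt_pos (1 - u1\<^sup>2))))"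
  have bd: "ball_density (x, z) = ?q x z" for x z :: real
    by (simp add: inner_prod_def power2_eq_square algebra_simps)
  have "(LEB p. LEB q. ball_density p * ball_density q * \<Phi> (line_offset p q))
    = (LEB x0. LEB z0. LEB x1. LEB z1. ?G x0 z0 x1 z1)"
  proof -
    have "(LEB p. LEB q. ball_density p * ball_density q * \<Phi> (line_offset p q))
      = (LEB p. LEB q. ?q (fst p) (snd p) * ?q (fst q) (snd q) * \<Phi> (line_offset p q))"
      unfolding bd[symmetric] by simp
    also have "\<dots> = (LEB p. LEB x1. LEB z1. ?q (fst p) (snd p) * ?q x1 z1 * \<Phi> (line_offset p (x1, z1)))"
    proof (intro nn_integral_cong)
      fix p :: "real \<times> real"
      have "(LEB q. ?q x0 z0 * ?q (fst q) (snd q) * \<Phi> (line_offset (x0, z0) q))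
        = (LEB x1. LEB z1. ?q x0 z0 * ?q x1 z1 * \<Phi> (line_offset (x0, z0) (x1, z1)))" for x0 z0
        unfolding line_offset_def fst_conv snd_conv by (subst nn_integral_lborel_pair) measurable
      from this[of "fst p" "snd p"]
      show "(LEB q. ?q (fst p) (snd p) * ?q (fst q) (snd q) * \<Phi> (line_offset p q))
        = (LEB x1. LEB z1. ?q (fst p) (snd p) * ?q x1 z1 * \<Phi> (line_offset p (x1, z1)))"
        by simp
    qed
    also have "\<dots> = (LEB x0. LEB z0. LEB x1. LEB z1. ?G x0 z0 x1 z1)"
      unfolding line_offset_def fst_conv snd_conv by (subst nn_integral_lborel_pair) measurable
    finally show ?thesis .
  qed
  also have "\<dots> = (LEB x0. LEB x1. LEB z0. LEB z1. ?G x0 z0 x1 z1)"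
    unfolding line_offset_def fst_conv snd_conv by (intro nn_integral_cong lborel_pair.Fubini') measurable
  also have "\<dots> = (LEB x0. LEB x1. LEB \<alpha>. ?H x0 x1 \<alpha>)"
  proof (rule nn_integral_cong, rule nn_integral_cong_AE)
    fix x0 :: real
    show "AE x1 in lborel. (LEB z0. LEB z1. ?G x0 z0 x1 z1)
      = (LEB \<alpha>. ?H x0 x1 \<alpha>)"
      using AE_lborel_singleton[of x0]
    proof eventually_elim
      fix x1 :: real assume x: "x1 \<noteq> x0"
      \<comment> \<open>The offset carries the sign of \<open>x1 - x0\<close>, which the even
        function \<open>\<Phi>\<close> absorbs.\<close>
      have off: "\<Phi> (?off x0 (a * x0 + c) x1 (a * x1 + c)) = \<Phi> (c / ?t a)" for a c
      proof -
        have "(x1 - x0)\<^sup>2 + (a * x1 + c - (a * x0 + c))\<^sup>2 = (x1 - x0)\<^sup>2 * (1 + a\<^sup>2)"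
          by (simp add: power2_eq_square algebra_simps)
        then have den: "sqrt ((x1 - x0)\<^sup>2 + (a * x1 + c - (a * x0 + c))\<^sup>2) = \<bar>x1 - x0\<bar> * ?t a"
          by (simp only: real_sqrt_mult real_sqrt_abs)
        have num: "x1 * (a * x0 + c) - x0 * (a * x1 + c) = (x1 - x0) * c"
          by (simp add: algebra_simps)
        have "?off x0 (a * x0 + c) x1 (a * x1 + c) = ((x1 - x0) * c) / (\<bar>x1 - x0\<bar> * ?t a)"
          unfolding line_offset_def fst_conv snd_conv den num ..
        also have "\<dots> = sgn (x1 - x0) * (c / ?t a)"
          by (simp add: real_sgn_eq)
        finally show ?thesis using x even by (auto simp: sgn_if)
      qed
      have "(LEB z0. LEB z1. ?G x0 z0 x1 z1)
        = ennreal \<bar>x1 - x0\<bar> * (LEB a. LEB c. ?q x0 (a * x0 + c) * ?q x1 (a * x1 + c) * \<Phi> (?off x0 (a * x0 + c) x1 (a * x1 + c)))"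
        unfolding line_offset_def fst_conv snd_conv by (intro nn_integral_line_graph[OF _ x[symmetric]]) measurable
      also have "\<dots> = ennreal \<bar>x1 - x0\<bar> * (LEB \<alpha>. ?q x0 (fst \<alpha> * x0 + snd \<alpha>) * ?q x1 (fst \<alpha> * x1 + snd \<alpha>) *
       \<Phi> (snd \<alpha> / sqrt (1 + (fst \<alpha>)\<^sup>2)))"
        unfolding off by (subst nn_integral_lborel_pair) measurable
      also have "\<dots> = (LEB \<alpha>. ?H x0 x1 \<alpha>)"
        by (subst nn_integral_cmult[symmetric]) (simp_all add: mult.assoc borel_prod[symmetric])
      finally show "(LEB z0. LEB z1. ?G x0 z0 x1 z1)
      = (LEB \<alpha>. ?H x0 x1 \<alpha>)" .
    qed
  qed
  also have "\<dots> = (LEB \<alpha>. LEB x0. LEB x1. ?H x0 x1 \<alpha>)"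
    by (intro nn_integral_lborel_rotate3) (simp add: borel_prod[symmetric])
  also have "\<dots> = (LEB a. LEB c. ?w a c *
       \<Phi> (c / ?t a))"
    by (subst nn_integral_lborel_pair) (measurable, simp add: nn_integral_multc)
  \<comment> \<open>The intercept is replaced by the distance \<open>s = c / ?t a\<close>, which
    makes the weight factor as in \<open>nn_integral_line_section\<close>.\<close>
  also have "\<dots> = (LEB a. ennreal \<bar>?t a\<bar> * (LEB s. ?w a (0 + ?t a * s) *
       \<Phi> ((0 + ?t a * s) / ?t a)))"
    by (intro nn_integral_cong nn_integral_real_affine) (measurable, simp add: add_nonneg_eq_0_iff)
  also have "\<dots> = (LEB a. ennreal \<bar>?t a\<bar> * (ennreal (1 / ?t a ^ 3) * W * ?I))"
  proof (intro nn_integral_cong arg_cong[where f="\<lambda>x. _ * x"])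
    fix a :: real
    have nz: "?t a \<noteq> 0" by (simp add: add_nonneg_eq_0_iff)
    show "(LEB s. ?w a (0 + ?t a * s) *
       \<Phi> ((0 + ?t a * s) / ?t a)) = ennreal (1 / ?t a ^ 3) * W * ?I"
      unfolding add_0 nn_integral_line_section W_def[symmetric] nonzero_mult_div_cancel_left[OF nz]
      by (subst nn_integral_cmult[symmetric]) (measurable, simp add: mult_ac)
  qed
  also have "\<dots> = (LEB a. ennreal \<bar>?t a\<bar> * (ennreal (1 / ?t a ^ 3) * W)) * ?I"
    by (subst nn_integral_multc[symmetric]) (measurable, simp add: mult.assoc)
  finally show "(LEB p. LEB q. ball_density p * ball_density q * \<Phi> (line_offset p q)) = \<dots>" 
    unfolding W_def .
qed

section \<open>Three points in space and the plane through them\<close>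

lemma nn_integral_lborel_rotate4:
  fixes f :: "'a::euclidean_space \<Rightarrow> 'b::euclidean_space \<Rightarrow> 'c::euclidean_space \<Rightarrow> 'd::euclidean_space \<Rightarrow> ennreal"
  assumes [measurable]: "(\<lambda>(w, x, y, z). f w x y z) \<in> borel_measurable (borel \<Otimes>\<^sub>M (borel \<Otimes>\<^sub>M (borel \<Otimes>\<^sub>M borel)))"
  shows "(LEB w. LEB x. LEB y. LEB z. f w x y z)
    = (LEB z. LEB w. LEB x. LEB y. f w x y z)"
proof -
  have "(LEB w. LEB x. LEB y. LEB z. f w x y z)
    = (LEB w. LEB z. LEB x. LEB y. f w x y z)"
    by (intro nn_integral_cong nn_integral_lborel_rotate3) measurable
  also have "\<dots> = (LEB z. LEB w. LEB x. LEB y. f w x y z)"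
  proof (intro lborel_pair.Fubini')
    have "(\<lambda>p. (snd (fst (fst p)), snd (fst p), snd p, fst (fst (fst p)))) \<in> ((borel \<Otimes>\<^sub>M borel) \<Otimes>\<^sub>M borel) \<Otimes>\<^sub>M borel \<rightarrow>\<^sub>M borel \<Otimes>\<^sub>M (borel \<Otimes>\<^sub>M (borel \<Otimes>\<^sub>M borel))"
      by measurable
    from measurable_compose[OF this assms]
    have [measurable]: "(\<lambda>p. f (snd (fst (fst p))) (snd (fst p)) (snd p) (fst (fst (fst p)))) \<in> borel_measurable (((borel \<Otimes>\<^sub>M borel) \<Otimes>\<^sub>M borel) \<Otimes>\<^sub>M borel)"
      by simp
    show "(\<lambda>(z, w). LEB x. LEB y. f w x y z) \<in> borel_measurable (lborel \<Otimes>\<^sub>M lborel)"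
      by measurable
  qed
  finally show ?thesis .
qed

text \<open>Joint measurability of the uncurried function becomes a rule for the curried one with
  arbitrary measurable arguments, the form in which it occurs in iterated integrals.\<close>

lemma measurable_curried3:
  assumes F: "(\<lambda>(x, y, z). F x y z) \<in> A \<Otimes>\<^sub>M (B \<Otimes>\<^sub>M C) \<rightarrow>\<^sub>M D"
    and [measurable]: "f \<in> M \<rightarrow>\<^sub>M A" "g \<in> M \<rightarrow>\<^sub>M B" "h \<in> M \<rightarrow>\<^sub>M C"
  shows "(\<lambda>x. F (f x) (g x) (h x)) \<in> M \<rightarrow>\<^sub>M D"
proof -
  have "(\<lambda>x. (f x, g x, h x)) \<in> M \<rightarrow>\<^sub>M A \<Otimes>\<^sub>M (B \<Otimes>\<^sub>M C)" by measurable
  from measurable_compose[OF this F] show ?thesis by simp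
qed

lemma nn_integral_lborel_cmult3:
  fixes f :: "'a::euclidean_space \<Rightarrow> 'b::euclidean_space \<Rightarrow> 'c::euclidean_space \<Rightarrow> ennreal"
  assumes f: "(\<lambda>(x, y, z). f x y z) \<in> borel_measurable (borel \<Otimes>\<^sub>M (borel \<Otimes>\<^sub>M borel))"
  shows "(LEB x. LEB y. LEB z. c * f x y z)
    = c * (LEB x. LEB y. LEB z. f x y z)"
proof -
  note [measurable (raw)] = measurable_curried3[OF f]
  have "(LEB x. LEB y. LEB z. c * f x y z)
    = (LEB x. c * (LEB y. LEB z. f x y z))"
    by (intro nn_integral_cong, subst nn_integral_cmult, measurable, subst nn_integral_cmult, measurable)
  also have "\<dots> = c * (LEB x. LEB y. LEB z. f x y z)"
    by (intro nn_integral_cmult) measurable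
  finally show ?thesis .
qed

text \<open>Affine substitution with a triangular matrix, one coordinate at a time; the Jacobian is
  the product of the diagonal entries. Such maps suffice to carry the unit disc onto any
  ellipse.\<close>

lemma nn_integral_lborel_triangular:
  fixes G :: "real \<times> real \<Rightarrow> ennreal"
  assumes [measurable]: "G \<in> borel_measurable (borel \<Otimes>\<^sub>M borel)" and k: "k1 \<noteq> 0" "k2 \<noteq> 0"
  shows "(LEB P. G P) = ennreal \<bar>k1 * k2\<bar> * (LEB U. G (m1 + l * snd U + k1 * fst U, m2 + k2 * snd U))"
proof -
  have "(LEB P. G P) = (LEB x. LEB y. G (x, y))"
    by (rule nn_integral_lborel_pair) measurable
  also have "\<dots> = (LEB y. LEB x. G (x, y))"
    by (intro lborel_pair.Fubini') measurable
  also have "\<dots> = ennreal \<bar>k2\<bar> * (LEB v. LEB x. G (x, m2 + k2 * v))"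
    using k by (intro nn_integral_real_affine) auto
  also have "(LEB v. LEB x. G (x, m2 + k2 * v))
      = (LEB v. ennreal \<bar>k1\<bar> * (LEB u. G ((m1 + l * v) + k1 * u, m2 + k2 * v)))"
    using k by (intro nn_integral_cong nn_integral_real_affine) auto
  also have "\<dots> = ennreal \<bar>k1\<bar> * (LEB v. LEB u. G ((m1 + l * v) + k1 * u, m2 + k2 * v))"
    by (intro nn_integral_cmult) measurable
  also have "(LEB v. LEB u. G ((m1 + l * v) + k1 * u, m2 + k2 * v))
     = (LEB u. LEB v. G ((m1 + l * v) + k1 * u, m2 + k2 * v))"
    by (intro lborel_pair.Fubini') measurable
  also have "\<dots> = (LEB U. G (m1 + l * snd U + k1 * fst U, m2 + k2 * snd U))"
    by (subst nn_integral_lborel_pair) measurable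
  finally show ?thesis by (simp add: mult.assoc[symmetric] ennreal_mult[symmetric] abs_mult mult.commute)
qed

text \<open>Twice the signed area of the triangle. Its absolute value is a Jacobian below, its sign
  is the orientation of the three points.\<close>

definition area2 :: "real \<times> real \<Rightarrow> real \<times> real \<Rightarrow> real \<times> real \<Rightarrow> real" where
  "area2 P Q R = (fst Q - fst P) * (snd R - snd P) - (snd Q - snd P) * (fst R - fst P)"

lemma borel_measurable_area2 [measurable (raw)]:
  assumes [measurable]: "f \<in> borel_measurable M" "g \<in> borel_measurable M" "h \<in> borel_measurable M"
  shows "(\<lambda>x. area2 (f x) (g x) (h x)) \<in> borel_measurable M"
proof -
  have [measurable]: "f \<in> M \<rightarrow>\<^sub>M borel \<Otimes>\<^sub>M borel" "g \<in> M \<rightarrow>\<^sub>M borel \<Otimes>\<^sub>M borel" "h \<in> M \<rightarrow>\<^sub>M borel \<Otimes>\<^sub>M borel"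
    unfolding borel_prod by fact+
  show ?thesis unfolding area2_def by measurable
qed

text \<open>The heights of a plane over three points depend linearly on its coefficients, with
  determinant \<open>area2 P Q R\<close> up to sign. The substitution is a Gaussian elimination with
  pivots \<open>A\<close> and \<open>k\<close>, whose product is that determinant; a nonzero
  \<open>A\<close> is what the assumption on the first coordinates provides.\<close>

lemma nn_integral_plane_graph:
  fixes F :: "real \<Rightarrow> real \<Rightarrow> real \<Rightarrow> ennreal"
  assumes F: "(\<lambda>(z0, z1, z2). F z0 z1 z2) \<in> borel_measurable (borel \<Otimes>\<^sub>M (borel \<Otimes>\<^sub>M borel))"
    and x: "fst P \<noteq> fst Q" and D: "area2 P Q R \<noteq> 0"
  shows "(LEB z0. LEB z1. LEB z2. F z0 z1 z2)
    = ennreal \<bar>area2 P Q R\<bar> * (LEB b. LEB a. LEB c. F (a * fst P + b * snd P + c) (a * fst Q + b * snd Q + c) (a * fst R + b * snd R + c))"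
proof -
  note [measurable (raw)] = measurable_curried3[OF F]
  define A where "A = fst Q - fst P" define B where "B = snd Q - snd P"
  define C where "C = fst R - fst P" define E where "E = snd R - snd P"
  have A: "A \<noteq> 0" using x by (simp add: A_def)
  have Det: "area2 P Q R = A * E - B * C" by (simp add: area2_def A_def B_def C_def E_def)
  define k where "k = (A * E - B * C) / A"
  have k: "k \<noteq> 0" using D A by (simp add: k_def Det)
  have "(LEB z0. LEB z1. LEB z2. F z0 z1 z2)
    = (LEB z0. LEB z1. ennreal \<bar>k\<bar> * (LEB b. F z0 z1 ((z0 + C * (z1 - z0) / A) + k * b)))"
    using k by (intro nn_integral_cong nn_integral_real_affine) auto
  also have "\<dots> = (LEB z0. ennreal \<bar>k\<bar> * (LEB z1. LEB b. F z0 z1 ((z0 + C * (z1 - z0) / A) + k * b)))"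
    by (intro nn_integral_cong nn_integral_cmult) measurable
  also have "\<dots> = ennreal \<bar>k\<bar> * (LEB z0. LEB z1. LEB b. F z0 z1 ((z0 + C * (z1 - z0) / A) + k * b))"
    by (intro nn_integral_cmult) measurable
  also have "(LEB z0. LEB z1. LEB b. F z0 z1 ((z0 + C * (z1 - z0) / A) + k * b))
    = (LEB b. LEB z0. LEB z1. F z0 z1 ((z0 + C * (z1 - z0) / A) + k * b))"
    by (intro nn_integral_lborel_rotate3) measurable
  also have "\<dots> = (LEB b. LEB z0. ennreal \<bar>A\<bar> * (LEB a. F z0 ((z0 + B * b) + A * a) ((z0 + C * (((z0 + B * b) + A * a) - z0) / A) + k * b)))"
    using A by (intro nn_integral_cong nn_integral_real_affine) auto
  also have "\<dots> = (LEB b. LEB z0. ennreal \<bar>A\<bar> * (LEB a. F z0 (z0 + B * b + A * a) (z0 + C * a + E * b)))"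
  proof -
    have "(z0 + C * (((z0 + B * b) + A * a) - z0) / A) + k * b = z0 + C * a + E * b" for z0 a b
      using A by (simp add: k_def field_simps)
    then show ?thesis by (simp only:)
  qed
  also have "\<dots> = (LEB b. ennreal \<bar>A\<bar> * (LEB z0. LEB a. F z0 (z0 + B * b + A * a) (z0 + C * a + E * b)))"
    by (intro nn_integral_cong nn_integral_cmult) measurable
  also have "\<dots> = ennreal \<bar>A\<bar> * (LEB b. LEB z0. LEB a. F z0 (z0 + B * b + A * a) (z0 + C * a + E * b))"
    by (intro nn_integral_cmult) measurable
  also have "(LEB b. LEB z0. LEB a. F z0 (z0 + B * b + A * a) (z0 + C * a + E * b))
    = (LEB b. LEB a. LEB z0. F z0 (z0 + B * b + A * a) (z0 + C * a + E * b))"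
    by (intro nn_integral_cong lborel_pair.Fubini') measurable
  also have "\<dots> = (LEB b. LEB a. ennreal \<bar>1\<bar> * (LEB c. F ((a * fst P + b * snd P) + 1 * c) (((a * fst P + b * snd P) + 1 * c) + B * b + A * a) (((a * fst P + b * snd P) + 1 * c) + C * a + E * b)))"
    by (intro nn_integral_cong nn_integral_real_affine) auto
  also have "\<dots> = (LEB b. LEB a. LEB c. F (a * fst P + b * snd P + c) (a * fst Q + b * snd Q + c) (a * fst R + b * snd R + c))"
    by (simp add: A_def B_def C_def E_def algebra_simps)
  finally have "(LEB z0. LEB z1. LEB z2. F z0 z1 z2) = ennreal \<bar>k\<bar> * (ennreal \<bar>A\<bar> * \<dots>)" .
  moreover have "ennreal \<bar>k\<bar> * ennreal \<bar>A\<bar> = ennreal \<bar>area2 P Q R\<bar>"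
    using A by (simp add: ennreal_mult[symmetric] Det k_def)
  ultimately show ?thesis by (simp only: mult.assoc[symmetric])
qed

abbreviation "graph_density a b c P \<equiv>
  ennreal (inv_sqrt_pos (1 - (fst P)\<^sup>2 - (snd P)\<^sup>2 - (a * fst P + b * snd P + c)\<^sup>2))"

text \<open>The plane at distance \<open>s\<close> cuts a disc of radius
  \<open>r = sqrt (1 - s\<^sup>2)\<close> from the ball. Each of the three planar substitutions
  contributes \<open>r\<^sup>2 / t\<close>, so does the area, and the densities contribute
  \<open>1 / r ^ 3\<close>; in all \<open>r ^ 5 / t ^ 4\<close>.\<close>

lemma nn_integral_plane_section:
  fixes a b s :: real
  defines "t \<equiv> sqrt (1 + a\<^sup>2 + b\<^sup>2)"
  shows "(LEB P. LEB Q. LEB R. ennreal \<bar>area2 P Q R\<bar> *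
      (graph_density a b (t * s) P * graph_density a b (t * s) Q * graph_density a b (t * s) R))
    = ennreal (sqrt (1 - s\<^sup>2) ^ 5) * ennreal (1 / t ^ 4) *
      (LEB P. LEB Q. LEB R. ennreal \<bar>area2 P Q R\<bar> *
      (graph_density 0 0 0 P * graph_density 0 0 0 Q * graph_density 0 0 0 R))"
proof -
  define t1 where "t1 = sqrt (1 + a\<^sup>2)"
  have t: "t > 0" "t\<^sup>2 = 1 + a\<^sup>2 + b\<^sup>2" and t1: "t1 > 0" "t1\<^sup>2 = 1 + a\<^sup>2"
    by (simp_all add: t_def t1_def add_pos_nonneg)
  \<comment> \<open>The square is completed in \<open>x\<close> first and in \<open>y\<close>
    afterwards; this order makes the substitution triangular.\<close>
  have quad: "1 - x\<^sup>2 - y\<^sup>2 - (a * x + b * y + t * s)\<^sup>2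
      = (1 - s\<^sup>2) - (t1 * x + a * (b * y + t * s) / t1)\<^sup>2 - ((t * y + b * s) / t1)\<^sup>2" for x y
  proof -
    define w where "w = b * y + t * s"
    have 1: "t1\<^sup>2 * (x\<^sup>2 + (a * x + w)\<^sup>2) = (t1\<^sup>2 * x + a * w)\<^sup>2 + w\<^sup>2"
      unfolding t1(2) by (simp add: power2_eq_square algebra_simps)
    have "w\<^sup>2 + t1\<^sup>2 * y\<^sup>2 = (b\<^sup>2 + t1\<^sup>2) * y\<^sup>2 + 2 * b * t * s * y + t\<^sup>2 * s\<^sup>2"
      by (simp add: w_def power2_eq_square algebra_simps)
    also have "b\<^sup>2 + t1\<^sup>2 = t\<^sup>2" using t t1 by simp
    also have "t\<^sup>2 * y\<^sup>2 + 2 * b * t * s * y + t\<^sup>2 * s\<^sup>2 = (t * y + b * s)\<^sup>2 + (t\<^sup>2 - b\<^sup>2) * s\<^sup>2"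
      by (simp add: power2_eq_square algebra_simps)
    also have "t\<^sup>2 - b\<^sup>2 = t1\<^sup>2" using t t1 by simp
    finally have 2: "t1\<^sup>2 * (x\<^sup>2 + y\<^sup>2 + (a * x + w)\<^sup>2) = (t1\<^sup>2 * x + a * w)\<^sup>2 + (t * y + b * s)\<^sup>2 + t1\<^sup>2 * s\<^sup>2"
      using 1 by (simp add: algebra_simps)
    have 3: "t1 * x + a * w / t1 = (t1\<^sup>2 * x + a * w) / t1"
      using t1(1) by (simp add: field_simps power2_eq_square)
    have "x\<^sup>2 + y\<^sup>2 + (a * x + w)\<^sup>2 = ((t1\<^sup>2 * x + a * w)\<^sup>2 + (t * y + b * s)\<^sup>2 + t1\<^sup>2 * s\<^sup>2) / t1\<^sup>2"
      unfolding 2[symmetric] using t1(1) by simp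
    also have "\<dots> = (t1\<^sup>2 * x + a * w)\<^sup>2 / t1\<^sup>2 + (t * y + b * s)\<^sup>2 / t1\<^sup>2 + s\<^sup>2"
      using t1(1) by (simp add: add_divide_distrib)
    also have "\<dots> = (t1 * x + a * w / t1)\<^sup>2 + ((t * y + b * s) / t1)\<^sup>2 + s\<^sup>2"
      unfolding 3 power_divide ..
    finally show ?thesis unfolding w_def by (simp add: algebra_simps)
  qed
  show ?thesis
  proof (cases "s\<^sup>2 < 1")
    case False
    have "inv_sqrt_pos (1 - x\<^sup>2 - y\<^sup>2 - (a * x + b * y + t * s)\<^sup>2) = 0" for x y
    proof -
      have "(1 - s\<^sup>2) - p\<^sup>2 - q\<^sup>2 \<le> 0" for p q :: real
        using False zero_le_power2[of p] zero_le_power2[of q] by linarith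
      then show ?thesis unfolding quad inv_sqrt_pos_def by (simp add: not_less)
    qed
    moreover have "sqrt (1 - s\<^sup>2) ^ 5 \<le> 0" using False by (intro power_le_zero_eq[THEN iffD2]) auto
    then have "ennreal (sqrt (1 - s\<^sup>2) ^ 5) = 0" by (simp add: ennreal_eq_0_iff)
    ultimately show ?thesis by simp
  next
    case True
    define r where "r = sqrt (1 - s\<^sup>2)"
    have r: "r > 0" "r\<^sup>2 = 1 - s\<^sup>2" using True by (auto simp: r_def)
    \<comment> \<open>The disc projects to an ellipse in the horizontal plane. These constants
      describe the triangular map from the unit disc onto it and are found by solving
      \<open>xi\<close> and \<open>zeta\<close> for the two coordinates.\<close>
    define k1 where "k1 = r / t1"
    define k2 where "k2 = t1 * r / t"
    define m2 where "m2 = - (b * s) / t"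
    define l where "l = - (a * b * k2) / t1\<^sup>2"
    define m1 where "m1 = - (a * (b * m2 + t * s)) / t1\<^sup>2"
    have k: "k1 > 0" "k2 > 0" "k1 * k2 = r\<^sup>2 / t"
      using r t t1 by (simp_all add: k1_def k2_def power2_eq_square)
    define T where "T U = (m1 + l * snd U + k1 * fst U, m2 + k2 * snd U)" for U :: "real \<times> real"
    have [measurable]: "T \<in> borel_measurable borel"
      unfolding T_def[abs_def] borel_prod[symmetric] by measurable
    have xi: "t1 * (m1 + l * v + k1 * u) + a * (b * (m2 + k2 * v) + t * s) / t1 = r * u" for u v
      using t1(1) by (simp add: m1_def l_def k1_def field_simps power2_eq_square)
    have zeta: "(t * (m2 + k2 * v) + b * s) / t1 = r * v" for v
      using t1(1) t(1) by (simp add: m2_def k2_def field_simps)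
    have den: "graph_density a b (t * s) (T U) = ennreal (inv_sqrt_pos (1 - (fst U)\<^sup>2 - (snd U)\<^sup>2) / r)" for U
    proof -
      have "(1 - s\<^sup>2) - (r * fst U)\<^sup>2 - (r * snd U)\<^sup>2 = r\<^sup>2 * (1 - (fst U)\<^sup>2 - (snd U)\<^sup>2)"
        by (simp add: r(2)[symmetric] power_mult_distrib algebra_simps)
      then show ?thesis unfolding quad T_def fst_conv snd_conv xi zeta using r(1) by (simp add: inv_sqrt_pos_scale)
    qed
    have area: "area2 (T U) (T V) (T Y) = (k1 * k2) * area2 U V Y" for U V Y
      by (simp add: area2_def T_def algebra_simps)
    let ?f = "\<lambda>P Q R. ennreal \<bar>area2 P Q R\<bar> *
      (graph_density a b (t * s) P * graph_density a b (t * s) Q * graph_density a b (t * s) R)"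
    have sub: "(LEB P. g P) = ennreal (r\<^sup>2 / t) * (LEB U. g (T U))"
      if "g \<in> borel_measurable borel" for g :: "real \<times> real \<Rightarrow> ennreal"
      using nn_integral_lborel_triangular[of g k1 k2 m1 l m2] that k t(1) by (simp add: T_def borel_prod)
    have [measurable]: "(\<lambda>P. graph_density a b (t * s) P) \<in> borel_measurable borel"
      unfolding borel_prod[symmetric] by measurable
    have [measurable]: "(\<lambda>P. graph_density 0 0 0 P) \<in> borel_measurable borel"
      unfolding borel_prod[symmetric] by measurable
    have "(LEB P. LEB Q. LEB R. ?f P Q R)
      = (LEB P. LEB Q. ennreal (r\<^sup>2 / t) * (LEB Y. ?f P Q (T Y)))"
      by (intro nn_integral_cong sub) measurable
    also have "\<dots> = (LEB P. ennreal (r\<^sup>2 / t) * (LEB V. ennreal (r\<^sup>2 / t) * (LEB Y. ?f P (T V) (T Y))))"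
      by (intro nn_integral_cong sub) measurable
    also have "\<dots> = ennreal (r\<^sup>2 / t) * (LEB U. ennreal (r\<^sup>2 / t) * (LEB V. ennreal (r\<^sup>2 / t) * (LEB Y. ?f (T U) (T V) (T Y))))"
      by (intro sub) measurable
    also have "\<dots> = (LEB U. LEB V. LEB Y. ennreal (r\<^sup>2 / t) * (ennreal (r\<^sup>2 / t) * (ennreal (r\<^sup>2 / t) * ?f (T U) (T V) (T Y))))"
      by (simp add: nn_integral_cmult)
    also have "\<dots> = (LEB U. LEB V. LEB Y. ennreal (r ^ 5 / t ^ 4) * (ennreal \<bar>area2 U V Y\<bar> *
      (graph_density 0 0 0 U * graph_density 0 0 0 V * graph_density 0 0 0 Y)))"
    proof (intro nn_integral_cong)
      fix U V Y
      let ?g = "\<lambda>U. inv_sqrt_pos (1 - (fst U)\<^sup>2 - (snd U)\<^sup>2)"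
      have "r\<^sup>2 / t * (r\<^sup>2 / t * (r\<^sup>2 / t * (\<bar>area2 (T U) (T V) (T Y)\<bar> * (?g U / r * (?g V / r) * (?g Y / r)))))
         = r ^ 5 / t ^ 4 * (\<bar>area2 U V Y\<bar> * (?g U * ?g V * ?g Y))"
        using r(1) t(1) unfolding area k(3) abs_mult
        by (simp add: field_simps power2_eq_square power_numeral_reduce)
      then show "ennreal (r\<^sup>2 / t) * (ennreal (r\<^sup>2 / t) * (ennreal (r\<^sup>2 / t) * ?f (T U) (T V) (T Y)))
        = ennreal (r ^ 5 / t ^ 4) * (ennreal \<bar>area2 U V Y\<bar> *
      (graph_density 0 0 0 U * graph_density 0 0 0 V * graph_density 0 0 0 Y))"
        using r(1) t(1) unfolding den by (simp add: ennreal_mult[symmetric])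
    qed
    also have "\<dots> = ennreal (r ^ 5 / t ^ 4) * (LEB U. LEB V. LEB Y. (ennreal \<bar>area2 U V Y\<bar> *
      (graph_density 0 0 0 U * graph_density 0 0 0 V * graph_density 0 0 0 Y)))"
      by (rule nn_integral_lborel_cmult3) measurable
    also have "ennreal (r ^ 5 / t ^ 4) = ennreal (sqrt (1 - s\<^sup>2) ^ 5) * ennreal (1 / t ^ 4)"
      using r(1) t(1) by (simp add: r_def ennreal_mult[symmetric])
    finally show ?thesis .
  qed
qed

lemma borel_measurable_fst_snd:
  fixes f :: "'z \<Rightarrow> 'a::second_countable_topology \<times> 'b::second_countable_topology"
  assumes "f \<in> borel_measurable M"
  shows borel_measurable_fst [measurable (raw)]: "(\<lambda>x. fst (f x)) \<in> borel_measurable M"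
    and borel_measurable_snd [measurable (raw)]: "(\<lambda>x. snd (f x)) \<in> borel_measurable M"
  using assms measurable_compose[of f M borel fst borel] measurable_compose[of f M borel snd borel]
  by (simp_all add: borel_measurable_continuous_onI continuous_on_fst continuous_on_snd)

text \<open>The cross product of \<open>q - p\<close> and \<open>r - p\<close>.\<close>

definition plane_normal :: "space3 \<Rightarrow> space3 \<Rightarrow> space3 \<Rightarrow> space3" where
  "plane_normal p q r =
    ((area2 (snd (fst p), snd p) (snd (fst q), snd q) (snd (fst r), snd r),
      area2 (snd p, fst (fst p)) (snd q, fst (fst q)) (snd r, fst (fst r))),
     area2 (fst p) (fst q) (fst r))"

text \<open>Signed distance of the plane from the origin; an odd permutation of the points reverses
  the sign.\<close>

definition plane_offset :: "space3 \<Rightarrow> space3 \<Rightarrow> space3 \<Rightarrow> real" where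
  "plane_offset p q r = plane_normal p q r \<bullet> p / norm (plane_normal p q r)"

lemma borel_measurable_plane_normal [measurable (raw)]:
  assumes [measurable]: "f \<in> borel_measurable M" "g \<in> borel_measurable M" "h \<in> borel_measurable M"
  shows "(\<lambda>x. plane_normal (f x) (g x) (h x)) \<in> borel_measurable M"
  unfolding plane_normal_def by measurable

lemma borel_measurable_plane_offset [measurable (raw)]:
  assumes [measurable]: "f \<in> borel_measurable M" "g \<in> borel_measurable M" "h \<in> borel_measurable M"
  shows "(\<lambda>x. plane_offset (f x) (g x) (h x)) \<in> borel_measurable M"
  unfolding plane_offset_def by measurable

lemma plane_normal_graph:
  "plane_normal (P, a * fst P + b * snd P + c) (Q, a * fst Q + b * snd Q + c) (R, a * fst R + b * snd R + c)
    = area2 P Q R *\<^sub>R ((- a, - b), 1)"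
  by (simp add: plane_normal_def area2_def algebra_simps)

lemma plane_offset_graph:
  assumes "area2 P Q R \<noteq> 0"
  shows "plane_offset (P, a * fst P + b * snd P + c) (Q, a * fst Q + b * snd Q + c) (R, a * fst R + b * snd R + c)
    = sgn (area2 P Q R) * (c / sqrt (1 + a\<^sup>2 + b\<^sup>2))"
proof -
  have "norm ((- a, - b), 1::real) = sqrt (1 + a\<^sup>2 + b\<^sup>2)"
    by (simp add: norm_Pair add_ac)
  moreover have "((- a, - b), 1) \<bullet> (P, a * fst P + b * snd P + c) = c"
    by (simp add: inner_prod_def algebra_simps)
  ultimately show ?thesis
    unfolding plane_offset_def plane_normal_graph inner_scaleR_left norm_scaleR by (simp add: real_sgn_eq)
qed

text \<open>Three points are described by their plane and their positions in it. The integral over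
  the slopes factors out, and the distance enters only through the fifth power from
  \<open>nn_integral_plane_section\<close>.\<close>

lemma plane_offset_law:
  "\<exists>K. \<forall>\<Phi>. \<Phi> \<in> borel_measurable borel \<longrightarrow> (\<forall>t. \<Phi> (- t) = \<Phi> t) \<longrightarrow>
    (LEB p. LEB q. LEB r. ball_density p * ball_density q * ball_density r * \<Phi> (plane_offset p q r))
      = K * (LEB s. ennreal (sqrt (1 - s\<^sup>2) ^ 5) * \<Phi> s)"
proof (intro exI allI impI)
  fix \<Phi> :: "real \<Rightarrow> ennreal"
  assume [measurable]: "\<Phi> \<in> borel_measurable borel" and even: "\<forall>t. \<Phi> (- t) = \<Phi> t"
  let ?t = "\<lambda>a b :: real. sqrt (1 + a\<^sup>2 + b\<^sup>2)"
  let ?w = "\<lambda>a b c. LEB P. LEB Q. LEB R. ennreal \<bar>area2 P Q R\<bar> * (graph_density a b c P * graph_density a b c Q * graph_density a b c R)"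
  let ?I = "LEB s. ennreal (sqrt (1 - s\<^sup>2) ^ 5) * \<Phi> s"
  define G where "G p q r = ball_density p * ball_density q * ball_density r * \<Phi> (plane_offset p q r)" for p q r
  have G: "(\<lambda>(p, q, r). G p q r) \<in> borel_measurable (borel \<Otimes>\<^sub>M (borel \<Otimes>\<^sub>M borel))"
    unfolding G_def by measurable
  note [measurable (raw)] = measurable_curried3[OF G]
  define W where "W = (LEB P. LEB Q. LEB R. ennreal \<bar>area2 P Q R\<bar> *
      (graph_density 0 0 0 P * graph_density 0 0 0 Q * graph_density 0 0 0 R))"
  let ?H = "\<lambda>P Q R \<alpha>. ennreal \<bar>area2 P Q R\<bar> * (graph_density (fst (snd \<alpha>)) (fst \<alpha>) (snd (snd \<alpha>)) P *
     graph_density (fst (snd \<alpha>)) (fst \<alpha>) (snd (snd \<alpha>)) Q * graph_density (fst (snd \<alpha>)) (fst \<alpha>) (snd (snd \<alpha>)) R) *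
     \<Phi> (snd (snd \<alpha>) / sqrt (1 + (fst (snd \<alpha>))\<^sup>2 + (fst \<alpha>)\<^sup>2))"
  have graph: "G (P, a * fst P + b * snd P + c) (Q, a * fst Q + b * snd Q + c) (R, a * fst R + b * snd R + c)
    = graph_density a b c P * graph_density a b c Q * graph_density a b c R * \<Phi> (c / ?t a b)"
    if D: "area2 P Q R \<noteq> 0" for P Q R a b c
  proof -
    have "ball_density (P, z) = ennreal (inv_sqrt_pos (1 - (fst P)\<^sup>2 - (snd P)\<^sup>2 - z\<^sup>2))" for P :: "real \<times> real" and z :: real
      by (simp add: inner_prod_def power2_eq_square algebra_simps)
    moreover have "\<Phi> (sgn (area2 P Q R) * x) = \<Phi> x" for x
      using D even by (auto simp: sgn_if)
    ultimately show ?thesis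
      unfolding G_def plane_offset_graph[OF D] by (simp only:)
  qed
  have "(LEB p. LEB q. LEB r. G p q r)
    = (LEB p. LEB q. LEB R. LEB z2. G p q (R, z2))"
    by (intro nn_integral_cong nn_integral_lborel_pair) (unfold borel_prod, measurable)
  also have "\<dots> = (LEB p. LEB Q. LEB z1. LEB R. LEB z2. G p (Q, z1) (R, z2))"
    by (intro nn_integral_cong nn_integral_lborel_pair) (unfold borel_prod, measurable)
  also have "\<dots> = (LEB P. LEB z0. LEB Q. LEB z1. LEB R. LEB z2. G (P, z0) (Q, z1) (R, z2))"
    by (intro nn_integral_lborel_pair) (unfold borel_prod, measurable)
  also have "\<dots> = (LEB P. LEB z0. LEB Q. LEB R. LEB z1. LEB z2. G (P, z0) (Q, z1) (R, z2))"
    by (intro nn_integral_cong lborel_pair.Fubini') measurable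
  also have "\<dots> = (LEB P. LEB Q. LEB R. LEB z0. LEB z1. LEB z2. G (P, z0) (Q, z1) (R, z2))"
    by (intro nn_integral_cong nn_integral_lborel_rotate3[symmetric]) measurable
  also have "\<dots> = (LEB P. LEB Q. LEB R. LEB \<alpha>. ?H P Q R \<alpha>)"
  proof (rule nn_integral_cong, rule nn_integral_cong_AE)
    fix P :: "real \<times> real"
    \<comment> \<open>Almost all triples satisfy the two conditions of the elimination: distinct
      first coordinates of \<open>P\<close> and \<open>Q\<close>, and noncollinearity.\<close>
    have "AE Q in lborel. (1, 0) \<bullet> (Q :: real \<times> real) \<noteq> fst P"
      by (rule AE_lborel_hyperplane) (simp add: zero_prod_def)
    then show "AE Q in lborel. (LEB R. LEB z0. LEB z1. LEB z2. G (P, z0) (Q, z1) (R, z2))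
      = (LEB R. LEB \<alpha>. ?H P Q R \<alpha>)"
    proof eventually_elim
      fix Q :: "real \<times> real" assume "(1, 0) \<bullet> Q \<noteq> fst P"
      then have PQ: "fst P \<noteq> fst Q" by (auto simp: inner_prod_def)
      have "AE R in lborel. (- (snd Q - snd P), fst Q - fst P) \<bullet> (R :: real \<times> real) \<noteq> (fst Q - fst P) * snd P - (snd Q - snd P) * fst P"
        by (rule AE_lborel_hyperplane) (use PQ in \<open>simp add: zero_prod_def\<close>)
      then show "(LEB R. LEB z0. LEB z1. LEB z2. G (P, z0) (Q, z1) (R, z2))
      = (LEB R. LEB \<alpha>. ?H P Q R \<alpha>)"
      proof (intro nn_integral_cong_AE, eventually_elim)
        fix R :: "real \<times> real" assume "(- (snd Q - snd P), fst Q - fst P) \<bullet> (R :: real \<times> real) \<noteq> (fst Q - fst P) * snd P - (snd Q - snd P) * fst P"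
        then have D: "area2 P Q R \<noteq> 0" by (auto simp: area2_def inner_prod_def algebra_simps)
        have "(LEB z0. LEB z1. LEB z2. G (P, z0) (Q, z1) (R, z2))
          = ennreal \<bar>area2 P Q R\<bar> * (LEB b. LEB a. LEB c. graph_density a b c P * graph_density a b c Q * graph_density a b c R *
             \<Phi> (c / ?t a b))"
          unfolding graph[OF D, symmetric] by (intro nn_integral_plane_graph PQ D) measurable
        also have "\<dots> = (LEB b. LEB a. LEB c. ?H P Q R (b, a, c))"
          unfolding fst_conv snd_conv mult.assoc by (intro nn_integral_lborel_cmult3[symmetric]) measurable
        also have "\<dots> = (LEB b. LEB \<beta>. ?H P Q R (b, \<beta>))"
          by (intro nn_integral_cong nn_integral_lborel_pair[symmetric]) (unfold borel_prod fst_conv snd_conv, measurable)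
        also have "\<dots> = (LEB \<alpha>. ?H P Q R \<alpha>)"
          by (intro nn_integral_lborel_pair[symmetric]) (unfold borel_prod fst_conv snd_conv, measurable)
        finally show "(LEB z0. LEB z1. LEB z2. G (P, z0) (Q, z1) (R, z2))
          = (LEB \<alpha>. ?H P Q R \<alpha>)" .
      qed
    qed
  qed
  also have "\<dots> = (LEB \<alpha>. LEB P. LEB Q. LEB R. ?H P Q R \<alpha>)"
    by (intro nn_integral_lborel_rotate4) measurable
  also have "\<dots> = (LEB b. LEB \<beta>. LEB P. LEB Q. LEB R. ?H P Q R (b, \<beta>))"
    by (intro nn_integral_lborel_pair) (unfold borel_prod fst_conv snd_conv, measurable)
  also have "\<dots> = (LEB b. LEB a. LEB c. LEB P. LEB Q. LEB R. ?H P Q R (b, a, c))"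
    by (intro nn_integral_cong nn_integral_lborel_pair) (unfold borel_prod fst_conv snd_conv, measurable)
  also have "\<dots> = (LEB b. LEB a. LEB c. \<Phi> (c / ?t a b) * ?w a b c)"
    unfolding fst_conv snd_conv mult.commute[of _ "\<Phi> _"]
    by (intro nn_integral_cong nn_integral_lborel_cmult3) measurable
  also have "\<dots> = (LEB b. LEB a. ennreal \<bar>?t a b\<bar> * (LEB s. \<Phi> ((0 + ?t a b * s) / ?t a b) *
      ?w a b (0 + ?t a b * s)))"
  proof (intro nn_integral_cong nn_integral_real_affine)
    show "?t a b \<noteq> 0" for a b :: real
      by (simp add: add_nonneg_eq_0_iff)
  qed measurable
  also have "\<dots> = (LEB b. LEB a. ennreal \<bar>?t a b\<bar> * (ennreal (1 / ?t a b ^ 4) * W * ?I))"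
  proof (intro nn_integral_cong arg_cong[where f="\<lambda>x. _ * x"])
    fix a b :: real
    have nz: "?t a b \<noteq> 0" by (simp add: add_nonneg_eq_0_iff)
    have "(LEB s. \<Phi> s * (ennreal (sqrt (1 - s\<^sup>2) ^ 5) * ennreal (1 / ?t a b ^ 4) * W))
       = (LEB s. (ennreal (1 / ?t a b ^ 4) * W) * (ennreal (sqrt (1 - s\<^sup>2) ^ 5) * \<Phi> s))"
      by (simp only: mult_ac)
    also have "\<dots> = ennreal (1 / ?t a b ^ 4) * W * ?I"
      by (rule nn_integral_cmult) measurable
    finally show "(LEB s. \<Phi> ((0 + ?t a b * s) / ?t a b) *
      ?w a b (0 + ?t a b * s))
      = ennreal (1 / ?t a b ^ 4) * W * ?I"
      unfolding add_0 nonzero_mult_div_cancel_left[OF nz] nn_integral_plane_section W_def[symmetric] .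
  qed
  also have "\<dots> = (LEB b. LEB a. ennreal \<bar>?t a b\<bar> * (ennreal (1 / ?t a b ^ 4) * W)) *
      ?I"
    unfolding mult.assoc[symmetric] by (subst nn_integral_multc, measurable)+
  finally show "(LEB p. LEB q. LEB r. ball_density p * ball_density q * ball_density r * \<Phi> (plane_offset p q r)) = \<dots>"
    unfolding W_def G_def .
qed

section \<open>Integrals of powers of the cosine\<close>

text \<open>Substitution \<open>s = sin \<phi>\<close>. The fundamental theorem is applied in its
  interior form, with mere continuity at the ends, because \<open>arcsin\<close> is not
  differentiable at -1 and 1.\<close>

lemma nn_integral_arcsin:
  fixes g H :: "real \<Rightarrow> real"
  assumes H: "\<And>\<phi>. (H has_real_derivative g \<phi> * cos \<phi>) (at \<phi>)"
    and g: "\<And>\<phi>. - (pi / 2) \<le> \<phi> \<Longrightarrow> \<phi> \<le> pi / 2 \<Longrightarrow> 0 \<le> g \<phi>"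
    and ab: "- 1 \<le> a" "a \<le> b" "b \<le> 1"
  shows "(LEB s. ennreal (g (arcsin s)) * indicator {a..b} s) = ennreal (H (arcsin b) - H (arcsin a))"
proof (rule nn_integral_has_integral_lebesgue')
  show "0 \<le> g (arcsin s)" if "s \<in> {a..b}" for s
    using that ab by (intro g arcsin_lbound arcsin_ubound) auto
  have contH: "continuous_on UNIV H"
    using H by (meson DERIV_isCont continuous_at_imp_continuous_on)
  show "((\<lambda>s. g (arcsin s)) has_integral H (arcsin b) - H (arcsin a)) {a..b}"
  proof (rule fundamental_theorem_of_calculus_interior)
    show "continuous_on {a..b} (\<lambda>s. H (arcsin s))"
      using ab by (intro continuous_on_compose2[OF contH] continuous_on_arcsin) auto
    fix s assume "s \<in> {a<..<b}"
    then have s: "- 1 < s" "s < 1" using ab by auto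
    have "cos (arcsin s) \<noteq> 0" using s by (rule cos_arcsin_nonzero)
    moreover have "cos (arcsin s) = sqrt (1 - s\<^sup>2)" using s by (intro cos_arcsin) auto
    ultimately have c: "sqrt (1 - s\<^sup>2) \<noteq> 0" "cos (arcsin s) = sqrt (1 - s\<^sup>2)" by simp_all
    have "((\<lambda>s. H (arcsin s)) has_real_derivative g (arcsin s) * cos (arcsin s) * inverse (sqrt (1 - s\<^sup>2))) (at s)"
      by (rule DERIV_chain2[OF H DERIV_arcsin[OF s]])
    then show "((\<lambda>s. H (arcsin s)) has_vector_derivative g (arcsin s)) (at s)"
      unfolding c(2) using c(1)
      by (simp only: has_real_derivative_iff_has_vector_derivative mult.assoc right_inverse[OF c(1)] mult_1_right)
  qed (rule ab)
qed

text \<open>The classical reduction formula for antiderivatives of powers of the cosine, normalised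
  to vanish at 0.\<close>

fun cos_pow_prim :: "nat \<Rightarrow> real \<Rightarrow> real" where
  "cos_pow_prim 0 \<phi> = \<phi>"
| "cos_pow_prim (Suc 0) \<phi> = sin \<phi>"
| "cos_pow_prim (Suc (Suc n)) \<phi> = (sin \<phi> * cos \<phi> ^ Suc n + real (Suc n) * cos_pow_prim n \<phi>) / real (Suc (Suc n))"

lemma DERIV_cos_pow_prim: "(cos_pow_prim n has_real_derivative cos \<phi> ^ n) (at \<phi>)"
proof (induction n rule: induct_nat_012)
  case (ge2 n)
  have "((\<lambda>\<phi>. (sin \<phi> * cos \<phi> ^ Suc n + real (Suc n) * cos_pow_prim n \<phi>) / real (Suc (Suc n)))
    has_real_derivative (cos \<phi> * cos \<phi> ^ Suc n + sin \<phi> * (real (Suc n) * (- sin \<phi>) * cos \<phi> ^ n) + real (Suc n) * cos \<phi> ^ n) / real (Suc (Suc n))) (at \<phi>)"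
    by (rule derivative_eq_intros ge2(1) refl | simp)+
  also have "cos \<phi> * cos \<phi> ^ Suc n + sin \<phi> * (real (Suc n) * (- sin \<phi>) * cos \<phi> ^ n) + real (Suc n) * cos \<phi> ^ n
     = cos \<phi> ^ n * ((cos \<phi>)\<^sup>2 + real (Suc n) * (1 - (sin \<phi>)\<^sup>2))"
    by (simp add: power2_eq_square algebra_simps)
  also have "\<dots> / real (Suc (Suc n)) = cos \<phi> ^ Suc (Suc n)"
    unfolding cos_squared_eq[symmetric] by (simp add: power2_eq_square field_simps)
  finally show ?case by simp
qed (auto intro!: derivative_eq_intros)

lemma nn_integral_sqrt_pow:
  "(LEB s. ennreal (sqrt (1 - s\<^sup>2) ^ n) * indicator {-1..1} s) = ennreal (cos_pow_prim (Suc n) (pi / 2) - cos_pow_prim (Suc n) (- (pi / 2)))"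
proof -
  have "(LEB s. ennreal (sqrt (1 - s\<^sup>2) ^ n) * indicator {-1..1} s)
    = (LEB s. ennreal (cos (arcsin s) ^ n) * indicator {-1..1} s)"
    by (intro nn_integral_cong) (auto simp: cos_arcsin split: split_indicator)
  also have "\<dots> = ennreal (cos_pow_prim (Suc n) (arcsin 1) - cos_pow_prim (Suc n) (arcsin (- 1)))"
  proof (rule nn_integral_arcsin)
    show "(cos_pow_prim (Suc n) has_real_derivative cos \<phi> ^ n * cos \<phi>) (at \<phi>)" for \<phi>
      using DERIV_cos_pow_prim[of "Suc n" \<phi>] by (simp add: mult.commute)
  qed (auto intro!: zero_le_power cos_ge_zero)
  finally show ?thesis by simp
qed

text \<open>Outside [-1, 1] the root of the negative number \<open>1 - s\<^sup>2\<close> is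
  negative, hence so are its odd powers, and \<open>ennreal\<close> truncates them to 0. The weights
  of the offset laws thus carry their support implicitly.\<close>

lemma ennreal_sqrt_eq_indicator:
  assumes "odd n"
  shows "ennreal (sqrt (1 - s\<^sup>2) ^ n) = ennreal (sqrt (1 - s\<^sup>2) ^ n) * indicator {-1..1} s"
proof (cases "s \<in> {-1..1}")
  case False
  then have "1 < s\<^sup>2" by (auto simp: power2_eq_square abs_square_le_1[unfolded power2_eq_square] not_le[symmetric] abs_le_iff)
  then have "sqrt (1 - s\<^sup>2) < 0" by simp
  then have "sqrt (1 - s\<^sup>2) ^ n \<le> 0" using assms odd_pos[OF assms] by (simp add: power_le_zero_eq)
  then show ?thesis using False by (simp add: ennreal_eq_0_iff)
qed simp

text \<open>After the substitution \<open>s = sin \<phi>\<close>, the odd antiderivative of the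
  chord length \<open>2 * sqrt (1 - s\<^sup>2)\<close> of the unit disc.\<close>

definition semicircle_prim :: "real \<Rightarrow> real" where
  "semicircle_prim \<phi> = sin \<phi> * cos \<phi> + \<phi>"

lemma DERIV_semicircle_prim: "(semicircle_prim has_real_derivative 2 * (cos \<phi>)\<^sup>2) (at \<phi>)"
  unfolding semicircle_prim_def[abs_def]
  by (rule derivative_eq_intros refl | simp)+ (simp add: cos_squared_eq power2_eq_square algebra_simps)

lemma semicircle_prim_bound:
  assumes "- (pi / 2) \<le> \<phi>" "\<phi> \<le> pi / 2"
  shows "\<bar>semicircle_prim \<phi>\<bar> \<le> pi / 2"
proof -
  have mono: "semicircle_prim x \<le> semicircle_prim y" if "x \<le> y" for x y
    using that by (rule DERIV_nonneg_imp_nondecreasing) (use DERIV_semicircle_prim in fastforce)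
  show ?thesis
    using mono[OF assms(1)] mono[OF assms(2)] by (intro abs_leI) (simp_all add: semicircle_prim_def)
qed

lemma nn_integral_semicircle:
  assumes "- 1 \<le> a" "a \<le> b" "b \<le> 1"
  shows "(LEB s. ennreal (2 * sqrt (1 - s\<^sup>2)) * indicator {a..b} s)
    = ennreal (semicircle_prim (arcsin b) - semicircle_prim (arcsin a))"
proof -
  have "(LEB s. ennreal (2 * sqrt (1 - s\<^sup>2)) * indicator {a..b} s)
    = (LEB s. ennreal (2 * cos (arcsin s)) * indicator {a..b} s)"
    using assms by (intro nn_integral_cong) (auto simp: cos_arcsin split: split_indicator)
  also have "\<dots> = ennreal (semicircle_prim (arcsin b) - semicircle_prim (arcsin a))"
    using DERIV_semicircle_prim assms
    by (intro nn_integral_arcsin) (auto simp: power2_eq_square mult.assoc intro!: cos_ge_zero)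
  finally show ?thesis .
qed

text \<open>The antiderivative is found by repeated partial integration; it consists of the parts with
  factor \<open>\<phi>\<^sup>2\<close>, \<open>\<phi>\<close> and \<open>1\<close>.\<close>

lemma nn_integral_semicircle_separation:
  "(LEB s. ennreal (sqrt (1 - s\<^sup>2) ^ 5) * ennreal ((1 - (2 / pi * semicircle_prim (arcsin s))\<^sup>2) / 2))
    = ennreal (5 * pi / 48 + 539 / (2304 * pi))"
proof -
  let ?I = cos_pow_prim
  \<comment> \<open>\<open>?I 6 \<phi>\<close> is \<open>5 * \<phi> / 16\<close> plus a combination
    of products of the sine with odd powers of the cosine. \<open>J\<close> integrates this periodic
    rest and \<open>L\<close> integrates \<open>J\<close>, as two partial integrations of
    \<open>\<phi>\<^sup>2 * cos \<phi> ^ 6\<close> require.\<close>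
  define J where "J \<phi> = - ((cos \<phi>) ^ 6 / 36 + 5 * (cos \<phi>) ^ 4 / 96 + 5 * (cos \<phi>)\<^sup>2 / 32)" for \<phi> :: real
  define L where "L \<phi> = - (?I 6 \<phi> / 36 + 5 * ?I 4 \<phi> / 96 + 5 * ?I 2 \<phi> / 32)" for \<phi> :: real
  define H1 where "H1 \<phi> = \<phi>\<^sup>2 * ?I 6 \<phi> - 2 * (\<phi> * J \<phi> - L \<phi>) - 5 / 24 * \<phi> ^ 3" for \<phi>
  define H2 where "H2 \<phi> = 2 * (?I 8 \<phi> / 8 - \<phi> * cos \<phi> ^ 8 / 8)" for \<phi>
  define H3 where "H3 \<phi> = ?I 8 \<phi> - ?I 10 \<phi>" for \<phi>
  define H where "H \<phi> = (?I 6 \<phi> - (2 / pi)\<^sup>2 * (H1 \<phi> + H2 \<phi> + H3 \<phi>)) / 2" for \<phi>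
  have I2: "?I 2 \<phi> = (sin \<phi> * cos \<phi> + \<phi>) / 2" for \<phi>
    by (simp add: numeral_eq_Suc)
  have I4: "?I 4 \<phi> = (sin \<phi> * cos \<phi> ^ 3 + 3 * ?I 2 \<phi>) / 4" for \<phi>
    by (simp add: numeral_eq_Suc)
  have I6: "?I 6 \<phi> = (sin \<phi> * cos \<phi> ^ 5 + 5 * ?I 4 \<phi>) / 6" for \<phi>
    by (simp add: numeral_eq_Suc)
  have I8: "?I 8 \<phi> = (sin \<phi> * cos \<phi> ^ 7 + 7 * ?I 6 \<phi>) / 8" for \<phi>
    by (simp add: numeral_eq_Suc)
  have I10: "?I 10 \<phi> = (sin \<phi> * cos \<phi> ^ 9 + 9 * ?I 8 \<phi>) / 10" for \<phi>
    by (simp add: numeral_eq_Suc)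
  have dJ: "(J has_real_derivative ?I 6 \<phi> - 5 * \<phi> / 16) (at \<phi>)" for \<phi>
    unfolding J_def[abs_def]
    by (rule derivative_eq_intros refl | simp)+ (simp add: I6 I4 I2 power2_eq_square power3_eq_cube field_simps)
  have dL: "(L has_real_derivative J \<phi>) (at \<phi>)" for \<phi>
    unfolding L_def[abs_def] J_def
    by (rule derivative_eq_intros DERIV_cos_pow_prim refl | simp)+
  have d1: "(H1 has_real_derivative \<phi>\<^sup>2 * cos \<phi> ^ 6) (at \<phi>)" for \<phi>
    unfolding H1_def[abs_def]
    by (rule derivative_eq_intros DERIV_cos_pow_prim dJ dL refl | simp)+ (simp add: power2_eq_square field_simps)
  have d2: "(H2 has_real_derivative 2 * \<phi> * sin \<phi> * cos \<phi> ^ 7) (at \<phi>)" for \<phi>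
    unfolding H2_def[abs_def]
    by (rule derivative_eq_intros DERIV_cos_pow_prim refl | simp)+ (simp add: field_simps)
  have d3: "(H3 has_real_derivative (sin \<phi>)\<^sup>2 * cos \<phi> ^ 8) (at \<phi>)" for \<phi>
    unfolding H3_def[abs_def] sin_squared_eq
    by (rule derivative_eq_intros DERIV_cos_pow_prim refl | simp)+ (simp add: algebra_simps power_add[symmetric])
  have dH: "(H has_real_derivative (cos \<phi> ^ 5 * ((1 - (2 / pi * semicircle_prim \<phi>)\<^sup>2) / 2)) * cos \<phi>) (at \<phi>)" for \<phi>
  proof -
    have "(H has_real_derivative (cos \<phi> ^ 6 - (2 / pi)\<^sup>2 * (\<phi>\<^sup>2 * cos \<phi> ^ 6 + 2 * \<phi> * sin \<phi> * cos \<phi> ^ 7 + (sin \<phi>)\<^sup>2 * cos \<phi> ^ 8)) / 2) (at \<phi>)"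
      unfolding H_def[abs_def]
      by (rule derivative_eq_intros DERIV_cos_pow_prim d1 d2 d3 refl | simp)+
    also have "\<phi>\<^sup>2 * cos \<phi> ^ 6 + 2 * \<phi> * sin \<phi> * cos \<phi> ^ 7 + (sin \<phi>)\<^sup>2 * cos \<phi> ^ 8 = cos \<phi> ^ 6 * (semicircle_prim \<phi>)\<^sup>2"
      by (simp add: semicircle_prim_def power2_eq_square algebra_simps power_numeral_reduce)
    also have "(cos \<phi> ^ 6 - (2 / pi)\<^sup>2 * (cos \<phi> ^ 6 * (semicircle_prim \<phi>)\<^sup>2)) / 2
      = (cos \<phi> ^ 5 * ((1 - (2 / pi * semicircle_prim \<phi>)\<^sup>2) / 2)) * cos \<phi>"
      by (simp add: power_mult_distrib algebra_simps power_numeral_reduce)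
    finally show ?thesis .
  qed
  have nonneg: "0 \<le> (1 - (2 / pi * semicircle_prim \<phi>)\<^sup>2) / 2" if "- (pi / 2) \<le> \<phi>" "\<phi> \<le> pi / 2" for \<phi>
  proof -
    have "\<bar>2 / pi * semicircle_prim \<phi>\<bar> \<le> 1"
      using semicircle_prim_bound[OF that] by (simp add: abs_mult field_simps)
    then show ?thesis by (simp add: abs_square_le_1)
  qed
  have "(LEB s. ennreal (sqrt (1 - s\<^sup>2) ^ 5) * ennreal ((1 - (2 / pi * semicircle_prim (arcsin s))\<^sup>2) / 2))
    = (LEB s. ennreal (cos (arcsin s) ^ 5 * ((1 - (2 / pi * semicircle_prim (arcsin s))\<^sup>2) / 2)) * indicator {-1..1} s)"
  proof (intro nn_integral_cong)
    fix s :: real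
    show "ennreal (sqrt (1 - s\<^sup>2) ^ 5) * ennreal ((1 - (2 / pi * semicircle_prim (arcsin s))\<^sup>2) / 2)
      = ennreal (cos (arcsin s) ^ 5 * ((1 - (2 / pi * semicircle_prim (arcsin s))\<^sup>2) / 2)) * indicator {-1..1} s"
    proof (cases "s \<in> {-1..1}")
      case True
      then have s: "- 1 \<le> s" "s \<le> 1" by auto
      then have "cos (arcsin s) = sqrt (1 - s\<^sup>2)" by (rule cos_arcsin)
      moreover have "0 \<le> cos (arcsin s)" using s by (intro cos_ge_zero arcsin_lbound arcsin_ubound)
      ultimately show ?thesis
        using True nonneg[OF arcsin_lbound[OF s] arcsin_ubound[OF s]] by (simp add: ennreal_mult[symmetric])
    next
      case False
      then show ?thesis by (subst ennreal_sqrt_eq_indicator) auto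
    qed
  qed
  also have "\<dots> = ennreal (H (arcsin 1) - H (arcsin (- 1)))"
    using dH nonneg by (intro nn_integral_arcsin) (auto intro!: mult_nonneg_nonneg zero_le_power cos_ge_zero)
  \<comment> \<open>At both ends the cosine vanishes and every \<open>?I n\<close> reduces to a
    multiple of its argument. The leading \<open>?I 6\<close> and the cubic terms of
    \<open>H1\<close> leave \<open>5 * pi / 48\<close>; the linear terms from \<open>L\<close>,
    \<open>H2\<close> and \<open>H3\<close> contribute 980 - 315 - 126 = 539 over
    \<open>2304 * pi\<close>.\<close>
  also have "H (arcsin 1) - H (arcsin (- 1)) = 5 * pi / 48 + 539 / (2304 * pi)"
    by (simp add: H_def H1_def H2_def H3_def L_def J_def I10 I8 I6 I4 I2 field_simps power2_eq_square power3_eq_cube)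
  finally show ?thesis .
qed

section \<open>The law of one coordinate\<close>

lemma measurable_fst_borel [measurable]: "fst \<in> borel_measurable (borel :: ('a::second_countable_topology \<times> 'b::second_countable_topology) measure)"
  by (intro borel_measurable_continuous_onI continuous_intros)

lemma distr_uniform_sphere_fst_fst:
  "\<exists>c. distr uniform_sphere borel (\<lambda>x :: ('a::euclidean_space \<times> real) \<times> real. fst (fst x))
    = density lborel (\<lambda>y. c * indicator {..<1} (y \<bullet> y))"
proof -
  obtain C where C: "distr uniform_sphere borel (fst :: ('a \<times> real) \<times> real \<Rightarrow> _) = density lborel (\<lambda>y. C * ball_density y)"
    using distr_uniform_sphere_fst by blast
  define J where "J = (LEB z. ennreal (inv_sqrt_pos (1 - z\<^sup>2)))"
  have "emeasure (distr uniform_sphere borel (\<lambda>x :: ('a \<times> real) \<times> real. fst (fst x))) A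
    = emeasure (density lborel (\<lambda>y. C * J * indicator {..<1} (y \<bullet> y))) A" if [measurable]: "A \<in> sets borel" for A
  proof -
    have "distr uniform_sphere borel (\<lambda>x :: ('a \<times> real) \<times> real. fst (fst x))
      = distr (distr uniform_sphere borel (fst :: ('a \<times> real) \<times> real \<Rightarrow> _)) borel fst"
      by (subst distr_distr) (auto simp: comp_def)
    then have "emeasure (distr uniform_sphere borel (\<lambda>x :: ('a \<times> real) \<times> real. fst (fst x))) A
      = (\<integral>\<^sup>+y. indicator A y \<partial>distr (distr uniform_sphere borel (fst :: ('a \<times> real) \<times> real \<Rightarrow> _)) borel fst)"
      by simp
    also have "\<dots> = (\<integral>\<^sup>+y. indicator A (fst y) \<partial>distr uniform_sphere borel (fst :: ('a \<times> real) \<times> real \<Rightarrow> _))"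
      by (rule nn_integral_distr) auto
    also have "\<dots> = (\<integral>\<^sup>+y. C * ball_density y * indicator A (fst y) \<partial>(lborel :: ('a \<times> real) measure))"
      unfolding C by (rule nn_integral_density) measurable
    also have "\<dots> = (LEB x. LEB z. C * ball_density (x, z) * indicator A (fst (x, z :: real)))"
      by (rule nn_integral_lborel_pair) (unfold borel_prod, measurable)
    also have "\<dots> = (LEB x. LEB z. C * indicator A x * ennreal (inv_sqrt_pos ((1 - x \<bullet> x) - z\<^sup>2)))"
      by (intro nn_integral_cong) (simp add: inner_prod_def power2_eq_square diff_diff_eq mult_ac)
    also have "\<dots> = (LEB x. C * indicator A x * (indicator {0<..} (1 - x \<bullet> x) * J))"
      unfolding J_def nn_integral_inv_sqrt_pos[symmetric] by (intro nn_integral_cong nn_integral_cmult) measurable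
    also have "\<dots> = (LEB x. C * J * indicator {..<1} (x \<bullet> x) * indicator A x)"
      by (intro nn_integral_cong) (auto split: split_indicator)
    also have "\<dots> = emeasure (density lborel (\<lambda>y. C * J * indicator {..<1} (y \<bullet> y))) A"
      by (simp add: emeasure_density)
    finally show ?thesis .
  qed
  then show ?thesis by (intro exI measure_eqI) auto
qed

text \<open>Recovers a constant of proportionality from total mass 1; its finiteness comes out at
  the same time.\<close>

lemma ennreal_unique_inverse:
  fixes c :: ennreal
  assumes "c * ennreal r = 1" "r > 0"
  shows "c = ennreal (1 / r)"
proof -
  have "c = c * (ennreal r * ennreal (1 / r))"
    using assms(2) by (simp add: ennreal_mult[symmetric])
  then show ?thesis using assms(1) by (simp add: mult.assoc[symmetric])
qed

lemma ennreal_double_mult: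
  assumes "0 \<le> a" "0 \<le> b"
  shows "2 * (ennreal a * ennreal b) = ennreal (2 * (a * b))"
proof -
  have "ennreal (2 * (a * b)) = ennreal 2 * ennreal (a * b)" by (rule ennreal_mult') simp
  then show ?thesis using assms by (simp add: ennreal_mult)
qed

lemma norm_axis3: "norm ((1::real, 0::real), 0::real) = 1"
  by (simp add: norm_Pair)

lemma norm_axis4: "norm (((1::real, 0::real), 0::real), 0::real) = 1"
  by (simp add: norm_Pair)

text \<open>Archimedes' hat-box theorem; the length 2 of the interval fixes the constant.\<close>

lemma distr_uniform_sphere_axis3:
  "distr uniform_sphere borel (\<lambda>x. ((1::real, 0::real), 0::real) \<bullet> x) = density lborel (\<lambda>x. ennreal (1 / 2) * indicator {-1<..<1} x)"
proof -
  obtain c where c: "distr uniform_sphere borel (\<lambda>x :: space3. fst (fst x))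
    = density lborel (\<lambda>y. c * indicator {..<1} (y \<bullet> y))"
    using distr_uniform_sphere_fst_fst by blast
  have ind: "indicator {..<1} (y \<bullet> y) = (indicator {-1<..<1} y :: ennreal)" for y :: real
    by (auto simp: abs_square_less_1 power2_eq_square[symmetric] abs_less_iff split: split_indicator)
  have ax: "(\<lambda>x. ((1::real, 0::real), 0::real) \<bullet> x) = (\<lambda>x. fst (fst x))"
    by (auto simp: inner_prod_def)
  interpret prob_space "distr uniform_sphere borel (\<lambda>x :: space3. fst (fst x))"
    by (intro prob_space.prob_space_distr prob_space_uniform_sphere) measurable
  have "c * ennreal 2 = 1"
    using emeasure_space_1 unfolding c ind by (simp add: emeasure_density nn_integral_cmult)
  then have "c = ennreal (1 / 2)" by (rule ennreal_unique_inverse) simp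
  then show ?thesis unfolding ax c ind by simp
qed

text \<open>Two coordinates are uniform in the unit disc, so one coordinate has density proportional
  to the chord length. The constant is the inverse of the disc's area.\<close>

lemma distr_uniform_sphere_axis4:
  "distr uniform_sphere borel (\<lambda>x. (((1::real, 0::real), 0::real), 0::real) \<bullet> x)
    = density lborel (\<lambda>x. ennreal (1 / pi) * ennreal (2 * sqrt (1 - x\<^sup>2)))"
proof -
  obtain c where c: "distr uniform_sphere borel (\<lambda>x :: space4. fst (fst x))
    = density lborel (\<lambda>y. c * indicator {..<1} (y \<bullet> y))"
    using distr_uniform_sphere_fst_fst by blast
  let ?D = "distr uniform_sphere borel (\<lambda>x :: space4. fst (fst (fst x)))"
  have ax: "(\<lambda>x. (((1::real, 0::real), 0::real), 0::real) \<bullet> x) = (\<lambda>x. fst (fst (fst x)))"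
    by (auto simp: inner_prod_def)
  have chord: "(LEB y. indicator {..<1} (x\<^sup>2 + y\<^sup>2)) = ennreal (2 * sqrt (1 - x\<^sup>2))" for x :: real
  proof -
    have "indicator {..<1} (x\<^sup>2 + y\<^sup>2) = (indicator {- sqrt (1 - x\<^sup>2)<..<sqrt (1 - x\<^sup>2)} y :: ennreal)" for y
    proof -
      have "x\<^sup>2 + y\<^sup>2 < 1 \<longleftrightarrow> sqrt (y\<^sup>2) < sqrt (1 - x\<^sup>2)" unfolding real_sqrt_less_iff by auto
      then show ?thesis by (auto simp: abs_less_iff split: split_indicator)
    qed
    then have "(LEB y. indicator {..<1} (x\<^sup>2 + y\<^sup>2)) = emeasure lborel {- sqrt (1 - x\<^sup>2)<..<sqrt (1 - x\<^sup>2)}" by simp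
    also have "\<dots> = ennreal (2 * sqrt (1 - x\<^sup>2))"
      by (cases "0 \<le> sqrt (1 - x\<^sup>2)") (auto simp: ennreal_neg)
    finally show ?thesis .
  qed
  have D: "emeasure ?D A = emeasure (density lborel (\<lambda>x. c * ennreal (2 * sqrt (1 - x\<^sup>2)))) A" if [measurable]: "A \<in> sets borel" for A
  proof -
    have "?D = distr (distr uniform_sphere borel (\<lambda>x :: space4. fst (fst x))) borel fst"
      by (subst distr_distr) (auto simp: comp_def)
    then have "emeasure ?D A = (\<integral>\<^sup>+y. indicator A y \<partial>distr (distr uniform_sphere borel (\<lambda>x :: space4. fst (fst x))) borel fst)"
      by simp
    also have "\<dots> = (\<integral>\<^sup>+y. indicator A (fst y) \<partial>distr uniform_sphere borel (\<lambda>x :: space4. fst (fst x)))"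
      by (rule nn_integral_distr) auto
    also have "\<dots> = (\<integral>\<^sup>+y. c * indicator {..<1} (y \<bullet> y) * indicator A (fst y) \<partial>(lborel :: (real \<times> real) measure))"
      unfolding c by (rule nn_integral_density) measurable
    also have "\<dots> = (LEB x. LEB z. c * indicator {..<1} ((x, z) \<bullet> (x, z)) * indicator A (fst (x, z :: real)))"
      by (rule nn_integral_lborel_pair) (unfold borel_prod, measurable)
    also have "\<dots> = (LEB x. LEB z. c * indicator A x * indicator {..<1} (x\<^sup>2 + z\<^sup>2))"
      by (intro nn_integral_cong) (simp add: inner_prod_def power2_eq_square mult_ac)
    also have "\<dots> = (LEB x. c * indicator A x * ennreal (2 * sqrt (1 - x\<^sup>2)))"
      unfolding chord[symmetric] by (intro nn_integral_cong nn_integral_cmult) measurable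
    also have "\<dots> = emeasure (density lborel (\<lambda>x. c * ennreal (2 * sqrt (1 - x\<^sup>2)))) A"
      by (simp add: emeasure_density mult_ac)
    finally show ?thesis .
  qed
  interpret prob_space ?D
    by (intro prob_space.prob_space_distr prob_space_uniform_sphere) measurable
  have ind: "ennreal (2 * sqrt (1 - x\<^sup>2)) = ennreal (2 * sqrt (1 - x\<^sup>2)) * indicator {-1..1} x" for x
  proof (cases "x \<in> {-1..1}")
    case False
    then have "ennreal (sqrt (1 - x\<^sup>2)) = 0" using ennreal_sqrt_eq_indicator[of 1 x] by simp
    then show ?thesis using False by (simp add: ennreal_eq_0_iff)
  qed simp
  have "1 = emeasure ?D UNIV" using emeasure_space_1 by simp
  also have "\<dots> = c * (LEB x. ennreal (2 * sqrt (1 - x\<^sup>2)) * indicator {-1..1} x)"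
    unfolding ind[symmetric] by (subst D) (simp_all add: emeasure_density nn_integral_cmult)
  also have "(LEB x. ennreal (2 * sqrt (1 - x\<^sup>2)) * indicator {-1..1} x) = ennreal pi"
    by (subst nn_integral_semicircle) (auto simp: semicircle_prim_def)
  finally have "c = ennreal (1 / pi)" by (intro ennreal_unique_inverse) auto
  then show ?thesis unfolding ax using D by (intro measure_eqI) auto
qed

lemma sep_prob_axis3:
  assumes "- 1 < t" "t < 1"
  shows "sep_prob ((1::real, 0::real), 0::real) t = ennreal ((1 - t\<^sup>2) / 2)"
proof -
  let ?D = "distr uniform_sphere borel (\<lambda>x. ((1::real, 0::real), 0::real) \<bullet> x)"
  have "emeasure ?D {..<t} = (LEB x. ennreal (1 / 2) * indicator {-1<..<t} x)"
    unfolding distr_uniform_sphere_axis3 using assms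
    by (subst emeasure_density) (auto intro!: nn_integral_cong split: split_indicator)
  also have "\<dots> = ennreal (1 / 2) * ennreal (t - (- 1))"
    using assms by (subst nn_integral_cmult) auto
  also have "\<dots> = ennreal ((1 + t) / 2)"
    using assms by (subst ennreal_mult[symmetric]) (auto simp: add.commute)
  finally have 1: "emeasure ?D {..<t} = ennreal ((1 + t) / 2)" .
  have "emeasure ?D {t<..} = (LEB x. ennreal (1 / 2) * indicator {t<..<1} x)"
    unfolding distr_uniform_sphere_axis3 using assms
    by (subst emeasure_density) (auto intro!: nn_integral_cong split: split_indicator)
  also have "\<dots> = ennreal (1 / 2) * ennreal (1 - t)"
    using assms by (subst nn_integral_cmult) auto
  also have "\<dots> = ennreal ((1 - t) / 2)"
    using assms by (subst ennreal_mult[symmetric]) auto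
  finally have 2: "emeasure ?D {t<..} = ennreal ((1 - t) / 2)" .
  have "2 * (ennreal ((1 + t) / 2) * ennreal ((1 - t) / 2)) = ennreal (2 * ((1 + t) / 2 * ((1 - t) / 2)))"
    using assms by (intro ennreal_double_mult) auto
  also have "2 * ((1 + t) / 2 * ((1 - t) / 2)) = (1 - t\<^sup>2) / 2"
    by (simp add: power2_eq_square field_simps)
  finally show ?thesis unfolding sep_prob_def 1 2 .
qed

text \<open>The sides have mass \<open>(1 + b) / 2\<close> and \<open>(1 - b) / 2\<close>, where
  \<open>b\<close> is \<open>semicircle_prim (arcsin t)\<close> rescaled to [-1, 1]. The formula has
  the same shape as in \<open>sep_prob_axis3\<close>, where \<open>b = t\<close>.\<close>

lemma sep_prob_axis4:
  assumes "- 1 < t" "t < 1"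
  shows "sep_prob (((1::real, 0::real), 0::real), 0::real) t = ennreal ((1 - (2 / pi * semicircle_prim (arcsin t))\<^sup>2) / 2)"
proof -
  let ?D = "distr uniform_sphere borel (\<lambda>x. (((1::real, 0::real), 0::real), 0::real) \<bullet> x)"
  let ?A = "semicircle_prim (arcsin t)"
  have neg: "ennreal (2 * sqrt (1 - x\<^sup>2)) = 0" if "x \<notin> {-1..1}" for x
    using that ennreal_sqrt_eq_indicator[of 1 x] by (simp add: ennreal_eq_0_iff)
  have A: "\<bar>?A\<bar> \<le> pi / 2"
    using assms by (intro semicircle_prim_bound arcsin_lbound arcsin_ubound) auto
  have "emeasure ?D {..<t} = (LEB x. ennreal (1 / pi) * (ennreal (2 * sqrt (1 - x\<^sup>2)) * indicator {-1..t} x))"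
    unfolding distr_uniform_sphere_axis4
    by (subst emeasure_density; (intro nn_integral_cong_AE)?)
       (use AE_lborel_singleton[of t] neg assms in \<open>auto elim!: eventually_mono split: split_indicator\<close>)
  also have "\<dots> = ennreal (1 / pi) * ennreal (?A - semicircle_prim (arcsin (- 1)))"
    using assms by (simp add: nn_integral_cmult nn_integral_semicircle)
  finally have 1: "emeasure ?D {..<t} = ennreal ((1 + 2 / pi * ?A) / 2)"
    using A by (simp add: ennreal_mult[symmetric] semicircle_prim_def[of "- (pi / 2)"] abs_le_iff field_simps)
  have "emeasure ?D {t<..} = (LEB x. ennreal (1 / pi) * (ennreal (2 * sqrt (1 - x\<^sup>2)) * indicator {t..1} x))"
    unfolding distr_uniform_sphere_axis4
    by (subst emeasure_density; (intro nn_integral_cong_AE)?)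
       (use AE_lborel_singleton[of t] neg assms in \<open>auto elim!: eventually_mono split: split_indicator\<close>)
  also have "\<dots> = ennreal (1 / pi) * ennreal (semicircle_prim (arcsin 1) - ?A)"
    using assms by (simp add: nn_integral_cmult nn_integral_semicircle)
  finally have 2: "emeasure ?D {t<..} = ennreal ((1 - 2 / pi * ?A) / 2)"
    using A by (simp add: ennreal_mult[symmetric] semicircle_prim_def[of "pi / 2"] abs_le_iff field_simps)
  have le: "\<bar>2 / pi * ?A\<bar> \<le> 1" using A by (simp add: abs_mult field_simps)
  have "2 * (ennreal ((1 + b) / 2) * ennreal ((1 - b) / 2)) = ennreal ((1 - b\<^sup>2) / 2)" if "\<bar>b\<bar> \<le> 1" for b
  proof -
    have "2 * (ennreal ((1 + b) / 2) * ennreal ((1 - b) / 2)) = ennreal (2 * ((1 + b) / 2 * ((1 - b) / 2)))"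
      using that by (intro ennreal_double_mult) auto
    also have "2 * ((1 + b) / 2 * ((1 - b) / 2)) = (1 - b\<^sup>2) / 2"
      by (simp add: power2_eq_square field_simps)
    finally show ?thesis .
  qed
  from this[OF le] show ?thesis unfolding sep_prob_def 1 2 .
qed

section \<open>Products of distributions and cones of simplices\<close>

context sigma_finite_measure
begin

lemma product_sigma_finite_const: "product_sigma_finite (\<lambda>_ :: nat. M)"
  by (simp add: product_sigma_finite_def sigma_finite_measure_axioms)

text \<open>By \<open>dep\<close> the second argument of \<open>f\<close> is not read at
  \<open>i\<close>, so coordinate \<open>i\<close> can be split off as the outer integral.\<close>

lemma nn_integral_PiM_insert:
  fixes f :: "'a \<Rightarrow> (nat \<Rightarrow> 'a) \<Rightarrow> ennreal"
  assumes I: "finite I" "i \<notin> I"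
    and f: "(\<lambda>x. f (x i) x) \<in> borel_measurable (PiM (insert i I) (\<lambda>_. M))"
    and dep: "\<And>y z x. f y (x(i := z)) = f y x"
  shows "(\<integral>\<^sup>+x. f (x i) x \<partial>PiM (insert i I) (\<lambda>_. M)) = (\<integral>\<^sup>+y. \<integral>\<^sup>+x. f y x \<partial>PiM I (\<lambda>_. M) \<partial>M)"
proof -
  interpret product_sigma_finite "\<lambda>_ :: nat. M" by (rule product_sigma_finite_const)
  show ?thesis by (subst product_nn_integral_insert_rev[OF I f]) (simp add: dep)
qed

lemma nn_integral_PiM_2:
  assumes [measurable]: "(\<lambda>(p, q). f p q) \<in> borel_measurable (M \<Otimes>\<^sub>M M)" and "distinct [a, b]"
  shows "(\<integral>\<^sup>+x. f (x a) (x b) \<partial>PiM {a, b} (\<lambda>_ :: nat. M)) = (\<integral>\<^sup>+p. \<integral>\<^sup>+q. f p q \<partial>M \<partial>M)"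
proof -
  interpret product_sigma_finite "\<lambda>_ :: nat. M" by (rule product_sigma_finite_const)
  have "(\<integral>\<^sup>+x. f (x a) (x b) \<partial>PiM {a, b} (\<lambda>_ :: nat. M)) = (\<integral>\<^sup>+p. \<integral>\<^sup>+x. f p (x b) \<partial>PiM {b} (\<lambda>_. M) \<partial>M)"
    using assms(2) by (intro nn_integral_PiM_insert[where f="\<lambda>p x. f p (x b)"]) auto
  also have "\<dots> = (\<integral>\<^sup>+p. \<integral>\<^sup>+q. f p q \<partial>M \<partial>M)"
    by (intro nn_integral_cong product_nn_integral_singleton) measurable
  finally show ?thesis .
qed

lemma nn_integral_PiM_3:
  assumes f: "(\<lambda>(p, q, r). f p q r) \<in> borel_measurable (M \<Otimes>\<^sub>M (M \<Otimes>\<^sub>M M))" and "distinct [a, b, c]"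
  shows "(\<integral>\<^sup>+x. f (x a) (x b) (x c) \<partial>PiM {a, b, c} (\<lambda>_ :: nat. M)) = (\<integral>\<^sup>+p. \<integral>\<^sup>+q. \<integral>\<^sup>+r. f p q r \<partial>M \<partial>M \<partial>M)"
proof -
  note [measurable (raw)] = measurable_curried3[OF f]
  have "(\<integral>\<^sup>+x. f (x a) (x b) (x c) \<partial>PiM {a, b, c} (\<lambda>_ :: nat. M)) = (\<integral>\<^sup>+p. \<integral>\<^sup>+x. f p (x b) (x c) \<partial>PiM {b, c} (\<lambda>_. M) \<partial>M)"
    using assms(2) by (intro nn_integral_PiM_insert[where f="\<lambda>p x. f p (x b) (x c)"]) auto
  also have "\<dots> = (\<integral>\<^sup>+p. \<integral>\<^sup>+q. \<integral>\<^sup>+r. f p q r \<partial>M \<partial>M \<partial>M)"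
    using assms(2) by (intro nn_integral_cong nn_integral_PiM_2) auto
  finally show ?thesis .
qed

lemma measurable_curried4:
  assumes F: "(\<lambda>(w, x, y, z). F w x y z) \<in> A \<Otimes>\<^sub>M (B \<Otimes>\<^sub>M (C \<Otimes>\<^sub>M D)) \<rightarrow>\<^sub>M E"
    and [measurable]: "f \<in> N \<rightarrow>\<^sub>M A" "g \<in> N \<rightarrow>\<^sub>M B" "h \<in> N \<rightarrow>\<^sub>M C" "k \<in> N \<rightarrow>\<^sub>M D"
  shows "(\<lambda>x. F (f x) (g x) (h x) (k x)) \<in> N \<rightarrow>\<^sub>M E"
proof -
  have "(\<lambda>x. (f x, g x, h x, k x)) \<in> N \<rightarrow>\<^sub>M A \<Otimes>\<^sub>M (B \<Otimes>\<^sub>M (C \<Otimes>\<^sub>M D))" by measurable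
  from measurable_compose[OF this F] show ?thesis by simp
qed

lemma nn_integral_PiM_4:
  assumes f: "(\<lambda>(p, q, r, s). f p q r s) \<in> borel_measurable (M \<Otimes>\<^sub>M (M \<Otimes>\<^sub>M (M \<Otimes>\<^sub>M M)))"
    and "distinct [a, b, c, d]"
  shows "(\<integral>\<^sup>+x. f (x a) (x b) (x c) (x d) \<partial>PiM {a, b, c, d} (\<lambda>_ :: nat. M))
    = (\<integral>\<^sup>+p. \<integral>\<^sup>+q. \<integral>\<^sup>+r. \<integral>\<^sup>+s. f p q r s \<partial>M \<partial>M \<partial>M \<partial>M)"
proof -
  note [measurable (raw)] = measurable_curried4[OF f]
  have "(\<integral>\<^sup>+x. f (x a) (x b) (x c) (x d) \<partial>PiM {a, b, c, d} (\<lambda>_ :: nat. M))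
      = (\<integral>\<^sup>+p. \<integral>\<^sup>+x. f p (x b) (x c) (x d) \<partial>PiM {b, c, d} (\<lambda>_. M) \<partial>M)"
    using assms(2) by (intro nn_integral_PiM_insert[where f="\<lambda>p x. f p (x b) (x c) (x d)"]) auto
  also have "\<dots> = (\<integral>\<^sup>+p. \<integral>\<^sup>+q. \<integral>\<^sup>+r. \<integral>\<^sup>+s. f p q r s \<partial>M \<partial>M \<partial>M \<partial>M)"
    using assms(2) by (intro nn_integral_cong nn_integral_PiM_3) auto
  finally show ?thesis .
qed

lemma measurable_curried5:
  assumes F: "(\<lambda>(v, w, x, y, z). F v w x y z) \<in> A \<Otimes>\<^sub>M (B \<Otimes>\<^sub>M (C \<Otimes>\<^sub>M (D \<Otimes>\<^sub>M E))) \<rightarrow>\<^sub>M G"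
    and [measurable]: "f \<in> N \<rightarrow>\<^sub>M A" "g \<in> N \<rightarrow>\<^sub>M B" "h \<in> N \<rightarrow>\<^sub>M C" "k \<in> N \<rightarrow>\<^sub>M D" "l \<in> N \<rightarrow>\<^sub>M E"
  shows "(\<lambda>x. F (f x) (g x) (h x) (k x) (l x)) \<in> N \<rightarrow>\<^sub>M G"
proof -
  have "(\<lambda>x. (f x, g x, h x, k x, l x)) \<in> N \<rightarrow>\<^sub>M A \<Otimes>\<^sub>M (B \<Otimes>\<^sub>M (C \<Otimes>\<^sub>M (D \<Otimes>\<^sub>M E)))" by measurable
  from measurable_compose[OF this F] show ?thesis by simp
qed

lemma nn_integral_PiM_5:
  assumes f: "(\<lambda>(p, q, r, s, t). f p q r s t) \<in> borel_measurable (M \<Otimes>\<^sub>M (M \<Otimes>\<^sub>M (M \<Otimes>\<^sub>M (M \<Otimes>\<^sub>M M))))"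
    and "distinct [a, b, c, d, e]"
  shows "(\<integral>\<^sup>+x. f (x a) (x b) (x c) (x d) (x e) \<partial>PiM {a, b, c, d, e} (\<lambda>_ :: nat. M))
    = (\<integral>\<^sup>+p. \<integral>\<^sup>+q. \<integral>\<^sup>+r. \<integral>\<^sup>+s. \<integral>\<^sup>+t. f p q r s t \<partial>M \<partial>M \<partial>M \<partial>M \<partial>M)"
proof -
  note [measurable (raw)] = measurable_curried5[OF f]
  have "(\<integral>\<^sup>+x. f (x a) (x b) (x c) (x d) (x e) \<partial>PiM {a, b, c, d, e} (\<lambda>_ :: nat. M))
      = (\<integral>\<^sup>+p. \<integral>\<^sup>+x. f p (x b) (x c) (x d) (x e) \<partial>PiM {b, c, d, e} (\<lambda>_. M) \<partial>M)"
    using assms(2) by (intro nn_integral_PiM_insert[where f="\<lambda>p x. f p (x b) (x c) (x d) (x e)"]) auto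
  also have "\<dots> = (\<integral>\<^sup>+p. \<integral>\<^sup>+q. \<integral>\<^sup>+r. \<integral>\<^sup>+s. \<integral>\<^sup>+t. f p q r s t \<partial>M \<partial>M \<partial>M \<partial>M \<partial>M)"
    using assms(2) by (intro nn_integral_cong nn_integral_PiM_4) auto
  finally show ?thesis .
qed

end

lemma nn_integral_zero_if_AE:
  assumes "AE x in M. f x = (0::ennreal)"
  shows "(\<integral>\<^sup>+x. f x \<partial>M) = 0"
  using nn_integral_cong_AE[OF assms] by simp

text \<open>The indicator of the failure set has integral 0 once the product integral is written as
  an iterated one. General position can therefore be imposed one point at a time.\<close>

lemma (in sigma_finite_measure) AE_PiM_4:
  assumes P: "Measurable.pred (M \<Otimes>\<^sub>M (M \<Otimes>\<^sub>M (M \<Otimes>\<^sub>M M))) (\<lambda>(p, q, r, s). P p q r s)"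
    and "distinct [a, b, c, d]"
    and ae: "AE p in M. AE q in M. AE r in M. AE s in M. P p q r s"
  shows "AE x in PiM {a, b, c, d} (\<lambda>_ :: nat. M). P (x a) (x b) (x c) (x d)"
proof -
  note [measurable (raw)] = measurable_curried4[OF P]
  let ?f = "\<lambda>p q r s. if P p q r s then 0 else 1 :: ennreal"
  have "(\<integral>\<^sup>+p. \<integral>\<^sup>+q. \<integral>\<^sup>+r. \<integral>\<^sup>+s. ?f p q r s \<partial>M \<partial>M \<partial>M \<partial>M) = 0"
    using ae
    by (intro nn_integral_zero_if_AE) (auto elim!: eventually_mono intro!: nn_integral_zero_if_AE)
  moreover have "(\<integral>\<^sup>+x. ?f (x a) (x b) (x c) (x d) \<partial>PiM {a, b, c, d} (\<lambda>_ :: nat. M))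
    = (\<integral>\<^sup>+p. \<integral>\<^sup>+q. \<integral>\<^sup>+r. \<integral>\<^sup>+s. ?f p q r s \<partial>M \<partial>M \<partial>M \<partial>M)"
    by (intro nn_integral_PiM_4 assms(2)) measurable
  ultimately have "AE x in PiM {a, b, c, d} (\<lambda>_ :: nat. M). ?f (x a) (x b) (x c) (x d) = 0"
    by (subst nn_integral_0_iff_AE[symmetric]) auto
  then show ?thesis by (auto elim!: eventually_mono split: if_splits)
qed

lemma (in sigma_finite_measure) AE_PiM_5:
  assumes P: "Measurable.pred (M \<Otimes>\<^sub>M (M \<Otimes>\<^sub>M (M \<Otimes>\<^sub>M (M \<Otimes>\<^sub>M M)))) (\<lambda>(p, q, r, s, t). P p q r s t)"
    and "distinct [a, b, c, d, e]"
    and ae: "AE p in M. AE q in M. AE r in M. AE s in M. AE t in M. P p q r s t"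
  shows "AE x in PiM {a, b, c, d, e} (\<lambda>_ :: nat. M). P (x a) (x b) (x c) (x d) (x e)"
proof -
  note [measurable (raw)] = measurable_curried5[OF P]
  let ?f = "\<lambda>p q r s t. if P p q r s t then 0 else 1 :: ennreal"
  have "(\<integral>\<^sup>+p. \<integral>\<^sup>+q. \<integral>\<^sup>+r. \<integral>\<^sup>+s. \<integral>\<^sup>+t. ?f p q r s t \<partial>M \<partial>M \<partial>M \<partial>M \<partial>M) = 0"
    using ae
    by (intro nn_integral_zero_if_AE) (auto elim!: eventually_mono intro!: nn_integral_zero_if_AE)
  moreover have "(\<integral>\<^sup>+x. ?f (x a) (x b) (x c) (x d) (x e) \<partial>PiM {a, b, c, d, e} (\<lambda>_ :: nat. M))
    = (\<integral>\<^sup>+p. \<integral>\<^sup>+q. \<integral>\<^sup>+r. \<integral>\<^sup>+s. \<integral>\<^sup>+t. ?f p q r s t \<partial>M \<partial>M \<partial>M \<partial>M \<partial>M)"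
    by (intro nn_integral_PiM_5 assms(2)) measurable
  ultimately have "AE x in PiM {a, b, c, d, e} (\<lambda>_ :: nat. M). ?f (x a) (x b) (x c) (x d) (x e) = 0"
    by (subst nn_integral_0_iff_AE[symmetric]) auto
  then show ?thesis by (auto elim!: eventually_mono split: if_splits)
qed

text \<open>Weights are attached to indices instead of points, so coinciding points are covered and
  a point of the hull is directly given by a weight function.\<close>

lemma convex_hull_finite_image:
  fixes x :: "'i \<Rightarrow> 'a::real_vector"
  assumes "finite I"
  shows "convex hull (x ` I) = {(\<Sum>j\<in>I. t j *\<^sub>R x j) | t. (\<forall>j\<in>I. 0 \<le> t j) \<and> sum t I = 1}" (is "_ = ?S")
proof (rule antisym)
  show "?S \<subseteq> convex hull (x ` I)"
    by (auto intro!: convex_sum[OF assms convex_convex_hull] intro: hull_inc)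
  show "convex hull (x ` I) \<subseteq> ?S"
  proof (rule hull_minimal)
    show "x ` I \<subseteq> ?S"
    proof clarify
      fix i assume i: "i \<in> I"
      have "(\<Sum>j\<in>I. (if j = i then 1 else 0) *\<^sub>R x j) = (\<Sum>j\<in>I. if j = i then x i else 0)"
        by (intro sum.cong) auto
      also have "\<dots> = x i" using assms i by simp
      finally show "\<exists>t. x i = (\<Sum>j\<in>I. t j *\<^sub>R x j) \<and> (\<forall>j\<in>I. 0 \<le> t j) \<and> sum t I = 1"
        using assms i by (intro exI[of _ "\<lambda>j. if j = i then 1 else 0"]) simp
    qed
    show "convex ?S"
    proof (rule convexI, clarify)
      fix u v :: real and t t' :: "'i \<Rightarrow> real" assume "0 \<le> u" "0 \<le> v" "u + v = 1"
        and "\<forall>j\<in>I. 0 \<le> t j" "sum t I = 1" "\<forall>j\<in>I. 0 \<le> t' j" "sum t' I = 1"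
      then show "\<exists>s. u *\<^sub>R (\<Sum>j\<in>I. t j *\<^sub>R x j) + v *\<^sub>R (\<Sum>j\<in>I. t' j *\<^sub>R x j) = (\<Sum>j\<in>I. s j *\<^sub>R x j)
          \<and> (\<forall>j\<in>I. 0 \<le> s j) \<and> sum s I = 1"
        by (intro exI[of _ "\<lambda>j. u * t j + v * t' j"])
          (auto simp: scaleR_add_left sum.distrib scaleR_sum_right sum_distrib_left[symmetric])
    qed
  qed
qed

text \<open>\<open>l\<close> spans the affine dependences of the projections of the points along the last axis, so
  the last axis points into the simplex at \<open>x i\<close> iff all other entries of \<open>l\<close> have the right sign.\<close>

lemma cone_at_last_axis_iff:
  fixes x :: "nat \<Rightarrow> 'b::euclidean_space \<times> real" and l :: "nat \<Rightarrow> real"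
  assumes nz: "\<And>j. j \<le> d \<Longrightarrow> l j \<noteq> 0"
    and l: "(\<Sum>j\<le>d. l j) = 0" "(\<Sum>j\<le>d. l j *\<^sub>R fst (x j)) = 0"
    and \<kappa>: "(\<Sum>j\<le>d. l j * snd (x j)) = \<kappa>" "\<kappa> \<noteq> 0"
    and unique: "\<And>m j. (\<Sum>j\<le>d. m j) = 0 \<Longrightarrow> (\<Sum>j\<le>d. m j *\<^sub>R fst (x j)) = 0 \<Longrightarrow> m 0 = 0 \<Longrightarrow> j \<le> d \<Longrightarrow> m j = 0"
    and i: "i \<le> d" and \<sigma>: "\<bar>\<sigma>\<bar> = 1"
  shows "cone_at d i x (0, \<sigma>) \<longleftrightarrow> (\<forall>j\<le>d. j \<noteq> i \<longrightarrow> 0 < \<sigma> * \<kappa> * l j)"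
proof -
  have lx: "(\<Sum>j\<le>d. l j *\<^sub>R x j) = (0, \<kappa>)"
    using l(2) \<kappa>(1) by (simp add: prod_eq_iff fst_sum snd_sum)
  have sumi: "(\<Sum>j\<le>d. (if j = i then 1 else 0 :: real)) = 1" "(\<Sum>j\<le>d. (if j = i then 1 else 0 :: real) *\<^sub>R x j) = x i"
  proof -
    have "(\<Sum>j\<le>d. (if j = i then 1 else 0 :: real) *\<^sub>R x j) = (\<Sum>j\<le>d. if j = i then x i else 0)"
      by (intro sum.cong) auto
    then show "(\<Sum>j\<le>d. (if j = i then 1 else 0 :: real) *\<^sub>R x j) = x i" using i by simp
  qed (use i in simp)
  have hull: "convex hull (x ` {0..d}) = {(\<Sum>j\<le>d. t j *\<^sub>R x j) | t. (\<forall>j\<le>d. 0 \<le> t j) \<and> (\<Sum>j\<le>d. t j) = 1}"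
    unfolding atLeast0AtMost by (subst convex_hull_finite_image) auto
  show ?thesis
  proof
    assume "cone_at d i x (0, \<sigma>)"
    then obtain \<epsilon> t where \<epsilon>: "\<epsilon> > 0" and t: "\<And>j. j \<le> d \<Longrightarrow> 0 \<le> t j" "(\<Sum>j\<le>d. t j) = 1"
      and eq: "x i + \<epsilon> *\<^sub>R (0, \<sigma>) = (\<Sum>j\<le>d. t j *\<^sub>R x j)"
      unfolding cone_at_def hull by auto
    \<comment> \<open>Subtracting the barycentric coordinates of \<open>x i\<close> leaves
      coefficients with sum 0 that annihilate the projections. Such coefficients are determined by
      their entry at 0, so they are the multiple \<open>c\<close> of \<open>l\<close>.\<close>
    define m where "m j = t j - (if j = i then 1 else 0)" for j
    define c where "c = m 0 / l 0"
    have m: "(\<Sum>j\<le>d. m j) = 0" "(\<Sum>j\<le>d. m j *\<^sub>R x j) = (0, \<epsilon> * \<sigma>)"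
      unfolding m_def scaleR_diff_left sum_subtractf sumi t(2) eq[symmetric] by simp_all
    have m': "(\<Sum>j\<le>d. m j *\<^sub>R fst (x j)) = 0" "(\<Sum>j\<le>d. m j * snd (x j)) = \<epsilon> * \<sigma>"
      using m(2) by (simp_all add: prod_eq_iff fst_sum snd_sum)
    have mc: "m j = c * l j" if "j \<le> d" for j
    proof -
      have "m j - c * l j = 0"
      proof (rule unique[of "\<lambda>j. m j - c * l j"])
        show "(\<Sum>j\<le>d. m j - c * l j) = 0"
          by (simp add: sum_subtractf sum_distrib_left[symmetric] m l)
        show "(\<Sum>j\<le>d. (m j - c * l j) *\<^sub>R fst (x j)) = 0"
          by (simp add: scaleR_diff_left sum_subtractf m' scaleR_scaleR[symmetric] scaleR_sum_right[symmetric] l del: scaleR_scaleR)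
        show "m 0 - c * l 0 = 0" using nz[of 0] by (simp add: c_def)
      qed (rule that)
      then show ?thesis by simp
    qed
    have "c * \<kappa> = (\<Sum>j\<le>d. m j * snd (x j))"
      unfolding \<kappa>(1)[symmetric] sum_distrib_left by (intro sum.cong) (auto simp: mc)
    then have c: "c = \<epsilon> * \<sigma> / \<kappa>" using \<kappa>(2) m'(2) by (simp add: field_simps)
    show "\<forall>j\<le>d. j \<noteq> i \<longrightarrow> 0 < \<sigma> * \<kappa> * l j"
    proof (intro allI impI)
      fix j assume j: "j \<le> d" "j \<noteq> i"
      have "0 \<le> c * l j" using t(1)[OF j(1)] mc[OF j(1)] j by (simp add: m_def)
      moreover have "c \<noteq> 0" using c \<epsilon> \<sigma> \<kappa>(2) by auto
      ultimately have "0 < c * l j" using nz[OF j(1)] by (simp add: order_less_le)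
      then have "0 < (\<kappa>\<^sup>2 / \<epsilon>) * (c * l j)"
        using \<epsilon> \<kappa>(2) by (intro mult_pos_pos[OF _ \<open>0 < c * l j\<close>]) auto
      also have "(\<kappa>\<^sup>2 / \<epsilon>) * (c * l j) = \<sigma> * \<kappa> * l j"
        using \<epsilon> \<kappa>(2) by (simp add: c power2_eq_square)
      finally show "0 < \<sigma> * \<kappa> * l j" .
    qed
  next
    assume pos: "\<forall>j\<le>d. j \<noteq> i \<longrightarrow> 0 < \<sigma> * \<kappa> * l j"
    \<comment> \<open>The step length is chosen to make \<open>\<bar>c * l i\<bar> = 1\<close>; the
      weight of \<open>x i\<close> starts at 1 and thus stays nonnegative.\<close>
    define \<eta> where "\<eta> = \<bar>\<kappa>\<bar> / \<bar>l i\<bar>"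
    define c where "c = \<eta> * \<sigma> / \<kappa>"
    define t where "t j = (if j = i then 1 else 0) + c * l j" for j
    have \<eta>: "\<eta> > 0" using nz[OF i] \<kappa>(2) by (simp add: \<eta>_def)
    have "\<bar>c * l i\<bar> = 1"
      using nz[OF i] \<kappa>(2) \<sigma> by (simp add: c_def \<eta>_def abs_mult)
    then have "0 \<le> t i" by (simp add: t_def abs_if split: if_splits)
    moreover have "0 \<le> t j" if "j \<le> d" "j \<noteq> i" for j
    proof -
      have "0 \<le> \<eta> / \<kappa>\<^sup>2 * (\<sigma> * \<kappa> * l j)"
        using pos that \<eta> by (simp add: less_imp_le)
      also have "\<dots> = t j" using that \<kappa>(2) by (simp add: t_def c_def power2_eq_square)
      finally show ?thesis .
    qed
    ultimately have "\<forall>j\<le>d. 0 \<le> t j" by metis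
    moreover have "(\<Sum>j\<le>d. t j) = 1"
      unfolding t_def sum.distrib sumi sum_distrib_left[symmetric] l by simp
    moreover have "(\<Sum>j\<le>d. t j *\<^sub>R x j) = x i + \<eta> *\<^sub>R (0, \<sigma>)"
      unfolding t_def scaleR_add_left sum.distrib sumi scaleR_scaleR[symmetric] scaleR_sum_right[symmetric] lx
      using \<kappa>(2) by (simp add: c_def)
    ultimately have "x i + \<eta> *\<^sub>R (0, \<sigma>) \<in> convex hull (x ` {0..d})"
      unfolding hull mem_Collect_eq by (intro exI[of _ t] conjI) (rule sym, assumption+)
    then show "cone_at d i x (0, \<sigma>)"
      unfolding cone_at_def using \<eta> by blast
  qed
qed

section \<open>Expected angle sums\<close>

context
  fixes mtype :: "'m::finite itself" and ktype :: "'k::{finite,wellorder} itself"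
    and atype :: "'a::euclidean_space itself"
  assumes dim: "DIM('a) = CARD('k)" and card: "CARD('m) = Suc DIM('a)"
begin

lemma borel_measurable_vertex_angle_sum:
  "(\<lambda>x. vertex_angle_sum (convex hull (x ` {0..DIM('a)}))) \<in> borel_measurable (PiM {0..DIM('a)} (\<lambda>_. borel :: 'a measure))"
  unfolding vertex_angle_sum_convex_hull
  by (intro borel_measurable_sum borel_measurable_solid_angle[OF dim card]) auto

text \<open>By rotation invariance \<open>e\<close> and \<open>- e\<close> point into the simplex
  with the same probability. Counting both makes the integrand a quantity that depends only on the
  projections along \<open>e\<close> in general position.\<close>

lemma nn_integral_vertex_angle_sum:
  fixes e :: 'a
  assumes e: "norm e = 1"
  shows "2 * (\<integral>\<^sup>+x. ennreal (vertex_angle_sum (convex hull (x ` {0..DIM('a)}))) \<partial>PiM {0..DIM('a)} (\<lambda>_. uniform_sphere :: 'a measure))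
    = (\<integral>\<^sup>+x. (\<Sum>i = 0..DIM('a). of_bool (cone_at (DIM('a)) i x e) + of_bool (cone_at (DIM('a)) i x (- e))) \<partial>PiM {0..DIM('a)} (\<lambda>_. uniform_sphere :: 'a measure))"
    (is "2 * (\<integral>\<^sup>+x. _ \<partial>?P) = _")
proof -
  let ?d = "DIM('a)"
  have m: "Measurable.pred ?P (\<lambda>x. cone_at ?d i x u)" if "i \<le> ?d" for i u
  proof -
    note [measurable] = measurable_cone_at[OF that card, where 'a='a]
    show ?thesis by measurable
  qed
  have ind: "(\<integral>\<^sup>+x. of_bool (cone_at ?d i x u) \<partial>?P) = emeasure ?P {x \<in> space ?P. cone_at ?d i x u}" if "i \<le> ?d" for i u
  proof -
    have "(\<integral>\<^sup>+x. of_bool (cone_at ?d i x u) \<partial>?P) = (\<integral>\<^sup>+x. indicator {x \<in> space ?P. cone_at ?d i x u} x \<partial>?P)"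
      by (intro nn_integral_cong) (auto simp: indicator_def)
    also have "\<dots> = emeasure ?P {x \<in> space ?P. cone_at ?d i x u}"
      using m[OF that, of u] by (intro nn_integral_indicator) simp
    finally show ?thesis .
  qed
  have "(\<integral>\<^sup>+x. ennreal (vertex_angle_sum (convex hull (x ` {0..?d}))) \<partial>?P)
    = (\<integral>\<^sup>+x. (\<Sum>i = 0..?d. ennreal (solid_angle (x i) (convex hull (x ` {0..?d})))) \<partial>?P)"
    unfolding vertex_angle_sum_convex_hull by (simp add: sum_ennreal solid_angle_def)
  also have "\<dots> = (\<Sum>i = 0..?d. emeasure ?P {x \<in> space ?P. cone_at ?d i x e})"
  proof (subst nn_integral_sum)
    show "(\<lambda>x. ennreal (solid_angle (x i) (convex hull (x ` {0..?d})))) \<in> borel_measurable ?P" if "i \<in> {0..?d}" for i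
      using borel_measurable_solid_angle[OF dim card, of i] that by (simp cong: measurable_cong_sets add: sets_PiM_uniform_sphere)
  qed (auto intro!: sum.cong nn_integral_solid_angle[OF dim card _ e])
  finally have "2 * (\<integral>\<^sup>+x. ennreal (vertex_angle_sum (convex hull (x ` {0..?d}))) \<partial>?P)
    = (\<Sum>i = 0..?d. emeasure ?P {x \<in> space ?P. cone_at ?d i x e} + emeasure ?P {x \<in> space ?P. cone_at ?d i x (- e)})"
    using emeasure_cone_at_rotate[OF dim card, where u = "- e" and v = e]
    by (simp add: sum_distrib_left mult_2)
  also have "\<dots> = (\<Sum>i = 0..?d. \<integral>\<^sup>+x. of_bool (cone_at ?d i x e) + of_bool (cone_at ?d i x (- e)) \<partial>?P)"
  proof (intro sum.cong refl)
    fix i assume "i \<in> {0..?d}"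
    then have i: "i \<le> ?d" by simp
    note [measurable] = m[OF i]
    show "emeasure ?P {x \<in> space ?P. cone_at ?d i x e} + emeasure ?P {x \<in> space ?P. cone_at ?d i x (- e)}
      = (\<integral>\<^sup>+x. of_bool (cone_at ?d i x e) + of_bool (cone_at ?d i x (- e)) \<partial>?P)"
      unfolding ind[OF i, symmetric] by (rule nn_integral_add[symmetric]) measurable
  qed
  also have "\<dots> = (\<integral>\<^sup>+x. (\<Sum>i = 0..?d. of_bool (cone_at ?d i x e) + of_bool (cone_at ?d i x (- e))) \<partial>?P)"
  proof (rule nn_integral_sum[symmetric])
    fix i assume "i \<in> {0..?d}"
    then have [measurable]: "Measurable.pred ?P (\<lambda>x. cone_at ?d i x u)" for u using m[of i] by simp
    show "(\<lambda>x. of_bool (cone_at ?d i x e) + of_bool (cone_at ?d i x (- e)) :: ennreal) \<in> borel_measurable ?P"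
      by measurable
  qed
  finally show ?thesis .
qed

text \<open>Independence makes the law of the tuple a product, and a basis isometry moves it to the
  type on which the integral is evaluated. As angle sums are nonnegative and \<open>v\<close> is
  finite, integrability comes with the value.\<close>

lemma expectation_vertex_angle_sum:
  fixes X :: "nat \<Rightarrow> 'w \<Rightarrow> 'c::euclidean_space"
  assumes dim': "DIM('c) = DIM('a)" and M: "prob_space M"
    and indep: "prob_space.indep_vars M (\<lambda>_. borel) X {0..DIM('a)}"
    and X: "\<And>i. i \<in> {0..DIM('a)} \<Longrightarrow> distr M borel (X i) = uniform_sphere"
    and v: "(\<integral>\<^sup>+x. ennreal (vertex_angle_sum (convex hull (x ` {0..DIM('a)}))) \<partial>PiM {0..DIM('a)} (\<lambda>_. uniform_sphere :: 'a measure)) = ennreal v"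
    and "0 \<le> v"
  shows "integrable M (\<lambda>\<omega>. vertex_angle_sum (convex hull ((\<lambda>i. X i \<omega>) ` {0..DIM('a)})))
    \<and> prob_space.expectation M (\<lambda>\<omega>. vertex_angle_sum (convex hull ((\<lambda>i. X i \<omega>) ` {0..DIM('a)}))) = v"
proof -
  interpret M: prob_space M by fact
  let ?I = "{0..DIM('a)}"
  obtain \<phi> :: "'c \<Rightarrow> 'a" and \<psi> where iso: "linear \<phi>" "bij_betw \<phi> Basis Basis" "\<And>x. \<psi> (\<phi> x) = x"
    using ex_basis_isometry[where 'a='c and 'b='a] dim' by metis
  have inj: "inj \<phi>" using iso(3) by (metis injI)
  note [measurable] = borel_measurable_linear[OF iso(1)]
  define Y where "Y i \<omega> = \<phi> (X i \<omega>)" for i \<omega>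
  define Z where "Z \<omega> = (\<lambda>i\<in>?I. Y i \<omega>)" for \<omega>
  have rvX [measurable]: "X i \<in> borel_measurable M" if "i \<in> ?I" for i
    using indep that by (auto simp: M.indep_vars_def)
  have "M.indep_vars (\<lambda>_. borel) (\<lambda>i. \<phi> \<circ> X i) ?I"
    by (rule M.indep_vars_compose[OF indep]) measurable
  then have indepY: "M.indep_vars (\<lambda>_. borel) Y ?I"
    by (simp add: Y_def[abs_def] comp_def)
  have rvY: "Y i \<in> borel_measurable M" if "i \<in> ?I" for i
    using that unfolding Y_def by measurable
  have dY: "distr M borel (Y i) = uniform_sphere" if i: "i \<in> ?I" for i
  proof -
    have "distr M borel (Y i) = distr (distr M borel (X i)) borel \<phi>"
      using i by (subst distr_distr) (auto simp: comp_def Y_def[abs_def])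
    then show ?thesis
      using X[OF i] distr_uniform_sphere_basis_isometry[OF iso(1,2)] by simp
  qed
  have "distr M (PiM ?I (\<lambda>_. borel)) Z = PiM ?I (\<lambda>i. distr M borel (Y i))"
    using indepY M.indep_vars_iff_distr_eq_PiM'[where I="?I" and X=Y and M'="\<lambda>_. borel"] rvY
    by (simp add: Z_def[abs_def])
  also have "\<dots> = PiM ?I (\<lambda>_. uniform_sphere)"
    by (intro PiM_cong refl dY)
  finally have law: "distr M (PiM ?I (\<lambda>_. borel)) Z = PiM ?I (\<lambda>_. uniform_sphere)" .
  have Z [measurable]: "Z \<in> M \<rightarrow>\<^sub>M PiM ?I (\<lambda>_. borel)"
    unfolding Z_def[abs_def] using rvY by (intro measurable_restrict) auto
  \<comment> \<open>The isometry maps cones to cones and the uniform law on one sphere to that on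
    the other, so it preserves angles although the types differ.\<close>
  have eq: "vertex_angle_sum (convex hull ((\<lambda>i. X i \<omega>) ` ?I)) = vertex_angle_sum (convex hull (Z \<omega> ` ?I))" for \<omega>
  proof -
    have "solid_angle (X i \<omega>) (convex hull ((\<lambda>i. X i \<omega>) ` ?I)) = solid_angle (Z \<omega> i) (convex hull (Z \<omega> ` ?I))"
      if i: "i \<in> ?I" for i
    proof -
      have i': "i \<le> DIM('a)" using i by simp
      note [measurable] = measurable_cone_at[OF i' card, where 'a='a]
      have Zc: "Z \<omega> = compose ?I \<phi> (\<lambda>i. X i \<omega>)"
        by (auto simp: Z_def Y_def compose_def)
      then have "Z \<omega> \<in> space (PiM ?I (\<lambda>_. borel))" by (simp add: space_PiM compose_def)
      then have "Measurable.pred borel (\<lambda>v. cone_at (DIM('a)) i (Z \<omega>) v)" by measurable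
      then have "{v. cone_at (DIM('a)) i (Z \<omega>) v} \<in> sets borel" by simp
      then have "measure uniform_sphere {v. cone_at (DIM('a)) i (Z \<omega>) v} = measure uniform_sphere {u. cone_at (DIM('a)) i (Z \<omega>) (\<phi> u)}"
        by (subst distr_uniform_sphere_basis_isometry[OF iso(1,2), symmetric]) (simp add: measure_distr vimage_def)
      also have "{u. cone_at (DIM('a)) i (Z \<omega>) (\<phi> u)} = {u. cone_at (DIM('a)) i (\<lambda>i. X i \<omega>) u}"
        unfolding Zc cone_at_linear_image[OF iso(1) inj i'] ..
      finally show ?thesis by (simp add: solid_angle_def cone_at_def)
    qed
    then show ?thesis
      using vertex_angle_sum_convex_hull[of "\<lambda>i. X i \<omega>"] vertex_angle_sum_convex_hull[of "Z \<omega>"]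
      by (simp add: dim')
  qed
  have "has_bochner_integral M (\<lambda>\<omega>. vertex_angle_sum (convex hull (Z \<omega> ` ?I))) v"
  proof (rule has_bochner_integral_nn_integral)
    show "(\<lambda>\<omega>. vertex_angle_sum (convex hull (Z \<omega> ` ?I))) \<in> borel_measurable M"
      by (rule measurable_compose[OF Z borel_measurable_vertex_angle_sum])
    show "AE \<omega> in M. 0 \<le> vertex_angle_sum (convex hull (Z \<omega> ` ?I))"
      by (simp add: vertex_angle_sum_def solid_angle_def sum_nonneg)
    have "(\<integral>\<^sup>+\<omega>. ennreal (vertex_angle_sum (convex hull (Z \<omega> ` ?I))) \<partial>M)
       = (\<integral>\<^sup>+x. ennreal (vertex_angle_sum (convex hull (x ` ?I))) \<partial>distr M (PiM ?I (\<lambda>_. borel)) Z)"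
      using borel_measurable_vertex_angle_sum by (subst nn_integral_distr) auto
    then show "(\<integral>\<^sup>+\<omega>. ennreal (vertex_angle_sum (convex hull (Z \<omega> ` ?I))) \<partial>M) = ennreal v"
      unfolding law v .
  qed fact
  then show ?thesis
    unfolding eq by (simp add: has_bochner_integral_iff)
qed

end

section \<open>Tetrahedra\<close>

text \<open>A hyperplane fixes a single value of the coordinate along its normal, and that
  coordinate has a density.\<close>

lemma AE_uniform_sphere_hyperplane:
  fixes a e :: "'a::euclidean_space"
  assumes e: "norm e = 1" and dim: "DIM('a) = CARD('k::{finite,wellorder})"
    and dens: "distr uniform_sphere borel (\<lambda>x. e \<bullet> x) = density lborel f"
    and f [measurable]: "f \<in> borel_measurable borel" and a: "a \<noteq> 0"
  shows "AE x in uniform_sphere. a \<bullet> x \<noteq> s"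
proof -
  have "emeasure uniform_sphere {x. a \<bullet> x = s} = emeasure (density lborel f) {s / norm a}"
    unfolding emeasure_uniform_sphere_halfspace(3)[OF e dim a] dens ..
  also have "\<dots> = (LEB x. f x * indicator {s / norm a} x)"
    by (rule emeasure_density) auto
  also have "\<dots> = 0"
    using AE_lborel_singleton[of "s / norm a"]
    by (intro nn_integral_zero_if_AE) (auto elim!: eventually_mono)
  finally show ?thesis
    by (intro AE_I'[of "{x. a \<bullet> x = s}"] null_setsI) auto
qed

lemma nn_integral_uniform_sphere_fst:
  fixes f :: "'a::euclidean_space \<Rightarrow> ennreal"
  assumes C: "distr uniform_sphere borel (fst :: 'a \<times> real \<Rightarrow> 'a) = density lborel (\<lambda>y. C * ball_density y)"
    and [measurable]: "f \<in> borel_measurable borel"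
  shows "(\<integral>\<^sup>+p. f (fst p) \<partial>(uniform_sphere :: ('a \<times> real) measure)) = (LEB P. C * (ball_density P * f P))"
proof -
  have "(\<integral>\<^sup>+p. f (fst p) \<partial>(uniform_sphere :: ('a \<times> real) measure)) = (\<integral>\<^sup>+P. f P \<partial>distr uniform_sphere borel (fst :: 'a \<times> real \<Rightarrow> 'a))"
    by (rule nn_integral_distr[symmetric]) auto
  also have "\<dots> = (LEB P. C * ball_density P * f P)"
    unfolding C by (rule nn_integral_density) measurable
  finally show ?thesis by (simp add: mult.assoc)
qed

lemma nn_integral_archimedes_separation:
  "(LEB s. ennreal (sqrt (1 - s\<^sup>2)) * ennreal ((1 - s\<^sup>2) / 2)) = ennreal (1 / 2) * ennreal (3 * pi / 8)"
proof -
  have "ennreal (sqrt (1 - s\<^sup>2)) * ennreal ((1 - s\<^sup>2) / 2)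
      = ennreal (1 / 2) * (ennreal (sqrt (1 - s\<^sup>2) ^ 3) * indicator {-1..1} s)" for s :: real
  proof (cases "s \<in> {-1..1}")
    case True
    then have s: "0 \<le> 1 - s\<^sup>2" by (simp add: abs_square_le_1 abs_le_iff)
    then have "sqrt (1 - s\<^sup>2) * ((1 - s\<^sup>2) / 2) = 1 / 2 * sqrt (1 - s\<^sup>2) ^ 3"
      by (simp add: power3_eq_cube)
    then have "ennreal (sqrt (1 - s\<^sup>2)) * ennreal ((1 - s\<^sup>2) / 2) = ennreal (1 / 2 * sqrt (1 - s\<^sup>2) ^ 3)"
      using s by (subst ennreal_mult[symmetric]) auto
    also have "\<dots> = ennreal (1 / 2) * ennreal (sqrt (1 - s\<^sup>2) ^ 3)"
      by (rule ennreal_mult') simp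
    finally show ?thesis using True by simp
  next
    case False
    then show ?thesis using ennreal_sqrt_eq_indicator[of 1 s] by simp
  qed
  then have "(LEB s. ennreal (sqrt (1 - s\<^sup>2)) * ennreal ((1 - s\<^sup>2) / 2))
    = ennreal (1 / 2) * (LEB s. ennreal (sqrt (1 - s\<^sup>2) ^ 3) * indicator {-1..1} s)"
    by (simp only:) (rule nn_integral_cmult, measurable)
  also have "(LEB s. ennreal (sqrt (1 - s\<^sup>2) ^ 3) * indicator {-1..1} s) = ennreal (3 * pi / 8)"
    unfolding nn_integral_sqrt_pow by (simp add: numeral_eq_Suc)
  finally show ?thesis .
qed

definition line_normal :: "real \<times> real \<Rightarrow> real \<times> real \<Rightarrow> real \<times> real" where
  "line_normal P Q = (- (snd Q - snd P), fst Q - fst P)"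

lemma area2_line_normal: "area2 P Q R = line_normal P Q \<bullet> R - line_normal P Q \<bullet> P"
  by (simp add: area2_def line_normal_def inner_prod_def algebra_simps)

lemma line_offset_line_normal: "line_offset P Q = line_normal P Q \<bullet> P / norm (line_normal P Q)"
  by (simp add: line_offset_def line_normal_def norm_prod_def inner_prod_def algebra_simps power2_commute)

lemma borel_measurable_line_offset [measurable (raw)]:
  assumes [measurable]: "f \<in> borel_measurable M" "g \<in> borel_measurable M"
  shows "(\<lambda>x. line_offset (f x) (g x)) \<in> borel_measurable M"
  unfolding line_offset_def by measurable

abbreviation "sphere3 \<equiv> (uniform_sphere :: space3 measure)"

lemma DIM3: "DIM(space3) = CARD(3)"
  by simp

lemma AE_uniform_sphere3_hyperplane:
  "a \<noteq> 0 \<Longrightarrow> AE x in sphere3. a \<bullet> x \<noteq> s"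
  by (rule AE_uniform_sphere_hyperplane[OF norm_axis3 DIM3 distr_uniform_sphere_axis3]) auto

lemma AE_uniform_sphere3_distinct:
  "AE q in sphere3. line_normal (fst p) (fst q) \<noteq> 0"
proof -
  have "AE q in sphere3. ((1, 0), 0) \<bullet> q \<noteq> fst (fst p)"
    by (rule AE_uniform_sphere3_hyperplane) (simp add: zero_prod_def)
  then show ?thesis
    by eventually_elim (auto simp: line_normal_def zero_prod_def inner_prod_def)
qed

lemma line_offset_sphere_law:
  fixes \<Phi> :: "real \<Rightarrow> ennreal"
  assumes [measurable]: "\<Phi> \<in> borel_measurable borel" and even: "\<And>t. \<Phi> (- t) = \<Phi> t"
  shows "(\<integral>\<^sup>+p. \<integral>\<^sup>+q. \<Phi> (line_offset (fst p) (fst q)) \<partial>sphere3 \<partial>sphere3)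
    = ennreal (2 / pi) * (LEB s. ennreal (sqrt (1 - s\<^sup>2)) * \<Phi> s)"
proof -
  let ?\<sigma> = sphere3
  interpret prob_space ?\<sigma> by (rule prob_space_uniform_sphere)
  obtain C where C: "distr uniform_sphere borel (fst :: space3 \<Rightarrow> _) = density lborel (\<lambda>y. C * ball_density y)"
    using distr_uniform_sphere_fst by blast
  from line_offset_law obtain K where K: "\<forall>\<Phi>. \<Phi> \<in> borel_measurable borel \<longrightarrow> (\<forall>t. \<Phi> (- t) = \<Phi> t) \<longrightarrow>
    (LEB p. LEB q. ball_density p * ball_density q * \<Phi> (line_offset p q))
      = K * (LEB s. ennreal (sqrt (1 - s\<^sup>2)) * \<Phi> s)"
    by (rule exE)
  have main: "(\<integral>\<^sup>+p. \<integral>\<^sup>+q. \<Psi> (line_offset (fst p) (fst q)) \<partial>?\<sigma> \<partial>?\<sigma>)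
    = C * (C * K) * (LEB s. ennreal (sqrt (1 - s\<^sup>2)) * \<Psi> s)"
    if [measurable]: "\<Psi> \<in> borel_measurable borel" and even: "\<And>t. \<Psi> (- t) = \<Psi> t" for \<Psi>
  proof -
    have "(\<integral>\<^sup>+p. \<integral>\<^sup>+q. \<Psi> (line_offset (fst p) (fst q)) \<partial>?\<sigma> \<partial>?\<sigma>)
      = (\<integral>\<^sup>+p. (LEB Q. C * (ball_density Q * \<Psi> (line_offset (fst p) Q))) \<partial>?\<sigma>)"
      by (intro nn_integral_cong nn_integral_uniform_sphere_fst[OF C]) measurable
    also have "\<dots> = (LEB P. C * (ball_density P * (LEB Q. C * (ball_density Q * \<Psi> (line_offset P Q)))))"
      by (intro nn_integral_uniform_sphere_fst[OF C]) measurable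
    also have "\<dots> = (LEB P. (C * C) * (LEB Q. ball_density P * ball_density Q * \<Psi> (line_offset P Q)))"
    proof (rule nn_integral_cong)
      fix P :: "real \<times> real"
      have *: "(LEB Q. c * (ball_density Q * \<Psi> (line_offset P Q))) = c * (LEB Q. ball_density Q * \<Psi> (line_offset P Q))" for c
        by (rule nn_integral_cmult) measurable
      show "C * (ball_density P * (LEB Q. C * (ball_density Q * \<Psi> (line_offset P Q))))
        = (C * C) * (LEB Q. ball_density P * ball_density Q * \<Psi> (line_offset P Q))"
        unfolding *[of C] mult.assoc *[of "ball_density P"] by (simp only: mult.left_commute[of "ball_density P" C])
    qed
    also have "\<dots> = (C * C) * (LEB P. LEB Q. ball_density P * ball_density Q * \<Psi> (line_offset P Q))"
      by (rule nn_integral_cmult) measurable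
    also have "\<dots> = C * (C * K) * (LEB s. ennreal (sqrt (1 - s\<^sup>2)) * \<Psi> s)"
      unfolding K[rule_format, OF that] by (simp add: mult_ac)
    finally show ?thesis .
  qed
  have "(LEB s. ennreal (sqrt (1 - s\<^sup>2))) = (LEB s. ennreal (sqrt (1 - s\<^sup>2) ^ 1) * indicator {-1..1} s)"
    using ennreal_sqrt_eq_indicator[of 1] unfolding power_one_right by (intro nn_integral_cong) auto
  also have "\<dots> = ennreal (pi / 2)"
    unfolding nn_integral_sqrt_pow by (simp add: numeral_eq_Suc)
  finally have half: "(LEB s. ennreal (sqrt (1 - s\<^sup>2))) = ennreal (pi / 2)" .
  \<comment> \<open>The constant function 1 determines the product of the unknown constants: its
    mean is 1, and the half disc has area \<open>pi / 2\<close>.\<close>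
  have "C * (C * K) * ennreal (pi / 2) = 1"
    using main[of "\<lambda>_. 1"] emeasure_space_1 half by simp
  then have "C * (C * K) = ennreal (1 / (pi / 2))"
    by (rule ennreal_unique_inverse) simp
  then show ?thesis using main[OF assms] by simp
qed

text \<open>The line through two projections lifts to a plane parallel to the last axis, with normal
  \<open>(line_normal (fst p) (fst q), 0)\<close>. It separates projections iff the plane separates
  the points of the sphere themselves, so \<open>sep_prob\<close> applies in the full space.\<close>

lemma nn_integral_separated3:
  "(\<integral>\<^sup>+p. \<integral>\<^sup>+q. \<integral>\<^sup>+r. \<integral>\<^sup>+s. indicator {..<0} (area2 (fst p) (fst q) (fst r) * area2 (fst p) (fst q) (fst s))
      \<partial>sphere3 \<partial>sphere3 \<partial>sphere3 \<partial>sphere3) = ennreal (3 / 8)"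
proof -
  let ?\<sigma> = sphere3
  let ?e = "((1::real, 0::real), 0::real)"
  let ?i = "\<lambda>p q r s. indicator {..<0} (area2 (fst p) (fst q) (fst r) * area2 (fst p) (fst q) (fst s)) :: ennreal"
  have "(\<integral>\<^sup>+p. \<integral>\<^sup>+q. \<integral>\<^sup>+r. \<integral>\<^sup>+s. ?i p q r s \<partial>?\<sigma> \<partial>?\<sigma> \<partial>?\<sigma> \<partial>?\<sigma>)
    = (\<integral>\<^sup>+p. \<integral>\<^sup>+q. sep_prob ?e (line_offset (fst p) (fst q)) \<partial>?\<sigma> \<partial>?\<sigma>)"
  proof (rule nn_integral_cong, rule nn_integral_cong_AE)
    fix p :: space3
    show "AE q in ?\<sigma>. (\<integral>\<^sup>+r. \<integral>\<^sup>+s. ?i p q r s \<partial>?\<sigma> \<partial>?\<sigma>)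
      = sep_prob ?e (line_offset (fst p) (fst q))"
      using AE_uniform_sphere3_distinct[of p]
    proof eventually_elim
      fix q :: space3 assume "line_normal (fst p) (fst q) \<noteq> 0"
      then have a: "(line_normal (fst p) (fst q), 0::real) \<noteq> 0" by (simp add: zero_prod_def)
      have "area2 (fst p) (fst q) (fst r) = (line_normal (fst p) (fst q), 0) \<bullet> r - line_normal (fst p) (fst q) \<bullet> fst p"
        for r :: space3
        by (simp add: area2_line_normal inner_prod_def)
      then show "(\<integral>\<^sup>+r. \<integral>\<^sup>+s. ?i p q r s \<partial>?\<sigma> \<partial>?\<sigma>)
        = sep_prob ?e (line_offset (fst p) (fst q))"
        using nn_integral_separated[OF norm_axis3 DIM3 a, of "line_normal (fst p) (fst q) \<bullet> fst p"]
        by (simp add: lessThan_def line_offset_line_normal norm_Pair)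
    qed
  qed
  also have "\<dots> = ennreal (2 / pi) * (LEB s. ennreal (sqrt (1 - s\<^sup>2)) * sep_prob ?e s)"
    by (intro line_offset_sphere_law borel_measurable_sep_prob[OF norm_axis3 DIM3] sep_prob_even[OF norm_axis3 DIM3])
  also have "(LEB s. ennreal (sqrt (1 - s\<^sup>2)) * sep_prob ?e s)
    = (LEB s. ennreal (sqrt (1 - s\<^sup>2)) * ennreal ((1 - s\<^sup>2) / 2))"
  proof (rule nn_integral_cong)
    fix s :: real
    show "ennreal (sqrt (1 - s\<^sup>2)) * sep_prob ?e s = ennreal (sqrt (1 - s\<^sup>2)) * ennreal ((1 - s\<^sup>2) / 2)"
    proof (cases "- 1 < s \<and> s < 1")
      case False
      then have "1 \<le> s\<^sup>2" using abs_square_less_1[of s] by auto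
      then have "ennreal (sqrt (1 - s\<^sup>2)) = 0" by (simp add: ennreal_eq_0_iff)
      then show ?thesis by simp
    qed (simp add: sep_prob_axis3)
  qed
  also have "\<dots> = ennreal (1 / 2) * ennreal (3 * pi / 8)"
    by (rule nn_integral_archimedes_separation)
  also have "ennreal (2 / pi) * (ennreal (1 / 2) * ennreal (3 * pi / 8)) = ennreal (2 / pi * (1 / 2 * (3 * pi / 8)))"
    by (subst ennreal_mult', simp)+ (rule refl)
  finally show ?thesis by simp
qed

section \<open>Signs in the affine dependence of four points in the plane\<close>

lemma sum_atMost_3: "(\<Sum>j\<le>(3::nat). f j) = f 0 + f 1 + f 2 + f 3"
  by (simp add: numeral_eq_Suc)

lemma all_le_3: "(\<forall>j\<le>(3::nat). P j) \<longleftrightarrow> P 0 \<and> P 1 \<and> P 2 \<and> P 3"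
  by (auto simp: le_Suc_eq numeral_eq_Suc)

text \<open>Radon: four points of the plane are in convex position or one of them lies in the convex hull of
  the others, according to whether two or three pairs of coefficients have equal signs.\<close>

lemma count_signs_3:
  fixes a b c d \<kappa> :: real
  assumes "a + b + c + d = 0" "a \<noteq> 0" "b \<noteq> 0" "c \<noteq> 0" "d \<noteq> 0" "\<kappa> \<noteq> 0"
  shows "2 + ((of_bool (0 < \<kappa> * b \<and> 0 < \<kappa> * c \<and> 0 < \<kappa> * d) + of_bool (\<kappa> * b < 0 \<and> \<kappa> * c < 0 \<and> \<kappa> * d < 0))
    + (of_bool (0 < \<kappa> * a \<and> 0 < \<kappa> * c \<and> 0 < \<kappa> * d) + of_bool (\<kappa> * a < 0 \<and> \<kappa> * c < 0 \<and> \<kappa> * d < 0))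
    + (of_bool (0 < \<kappa> * a \<and> 0 < \<kappa> * b \<and> 0 < \<kappa> * d) + of_bool (\<kappa> * a < 0 \<and> \<kappa> * b < 0 \<and> \<kappa> * d < 0))
    + (of_bool (0 < \<kappa> * a \<and> 0 < \<kappa> * b \<and> 0 < \<kappa> * c) + of_bool (\<kappa> * a < 0 \<and> \<kappa> * b < 0 \<and> \<kappa> * c < 0)))
    = (of_bool (0 < a * b) + of_bool (0 < a * c) + of_bool (0 < a * d) + of_bool (0 < b * c) + of_bool (0 < b * d)
      + of_bool (0 < c * d) :: ennreal)"
proof -
  have "a > 0 \<or> a < 0" "b > 0 \<or> b < 0" "c > 0 \<or> c < 0" "d > 0 \<or> d < 0" "\<kappa> > 0 \<or> \<kappa> < 0"
    using assms by linarith+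
  then show ?thesis
    using assms(1) by (elim disjE) (simp_all add: zero_less_mult_iff mult_less_0_iff less_asym)
qed

text \<open>Together with \<open>radon_3\<close> this is Cramer's rule: up to an alternating sign,
  the coefficient of a point is the signed area of the triangle formed by the other three.\<close>

lemma radon_sum_3: "area2 Q R S - area2 P R S + area2 P Q S - area2 P Q R = 0"
  by (simp add: area2_def algebra_simps)

lemma radon_3:
  "area2 Q R S *\<^sub>R P - area2 P R S *\<^sub>R Q + area2 P Q S *\<^sub>R R - area2 P Q R *\<^sub>R S = 0"
  by (simp add: area2_def prod_eq_iff algebra_simps)

lemma affine_independent_3:
  assumes "a + b + c = 0" "a *\<^sub>R P + b *\<^sub>R Q + c *\<^sub>R R = 0" and A: "area2 P Q R \<noteq> 0"
  shows "a = 0" "b = 0" "c = 0"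
proof -
  have 1: "a * fst P + b * fst Q + c * fst R = 0" "a * snd P + b * snd Q + c * snd R = 0"
    using assms(2) by (simp_all add: prod_eq_iff)
  have a: "a = - b - c" using assms(1) by simp
  have "b * area2 P Q R = 0" "c * area2 P Q R = 0"
    using 1 unfolding a area2_def by algebra+
  then show "b = 0" "c = 0" using A by auto
  then show "a = 0" using a by simp
qed

lemma vertices_3:
  assumes "distinct [a, b, c, d]" "{a, b, c, d} \<subseteq> {0..3::nat}"
  shows "{0..3} = {a, b, c, d}"
proof (rule card_subset_eq[symmetric])
  show "card {a, b, c, d} = card {0..3::nat}" using assms(1) by simp
qed (use assms in auto)

lemma AE_area2_nonzero:
  assumes "distinct [a, b, c, d]" "{a, b, c, d} \<subseteq> {0..3::nat}"
  shows "AE x in PiM {0..3::nat} (\<lambda>_. sphere3). area2 (fst (x a)) (fst (x b)) (fst (x c)) \<noteq> 0"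
proof -
  interpret prob_space sphere3 by (rule prob_space_uniform_sphere)
  have "AE p in sphere3. AE q in sphere3. AE r in sphere3. AE s in sphere3. area2 (fst p) (fst q) (fst r) \<noteq> 0"
  proof (rule AE_I2)
    fix p :: space3
    show "AE q in sphere3. AE r in sphere3. AE s in sphere3. area2 (fst p) (fst q) (fst r) \<noteq> 0"
      using AE_uniform_sphere3_distinct[of p]
    proof eventually_elim
      fix q :: space3 assume "line_normal (fst p) (fst q) \<noteq> 0"
      then have "AE r in sphere3. (line_normal (fst p) (fst q), 0) \<bullet> r \<noteq> line_normal (fst p) (fst q) \<bullet> fst p"
        by (intro AE_uniform_sphere3_hyperplane) (simp add: zero_prod_def)
      then show "AE r in sphere3. AE s in sphere3. area2 (fst p) (fst q) (fst r) \<noteq> 0"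
        by eventually_elim (simp add: area2_line_normal inner_prod_def)
    qed
  qed
  then show ?thesis
    unfolding vertices_3[OF assms] by (intro AE_PiM_4 assms(1)) measurable
qed

text \<open>The dependence of the projections applied to the last coordinates, which is the
  \<open>\<kappa>\<close> of \<open>cone_at_last_axis_iff\<close>. Up to sign it is the determinant
  that vanishes iff the four points are coplanar.\<close>

abbreviation radon_height_3 :: "space3 \<Rightarrow> space3 \<Rightarrow> space3 \<Rightarrow> space3 \<Rightarrow> real" where
  "radon_height_3 p q r s \<equiv> area2 (fst q) (fst r) (fst s) * snd p - area2 (fst p) (fst r) (fst s) * snd q
    + area2 (fst p) (fst q) (fst s) * snd r - area2 (fst p) (fst q) (fst r) * snd s"

text \<open>As a function of the last point the height is affine, and its normal has last component
  \<open>- area2\<close>, nonzero for almost all choices of the first three points.\<close>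

lemma AE_radon_height_3: "AE x in PiM {0..3::nat} (\<lambda>_. sphere3). radon_height_3 (x 0) (x 1) (x 2) (x 3) \<noteq> 0"
proof -
  interpret prob_space sphere3 by (rule prob_space_uniform_sphere)
  have "AE p in sphere3. AE q in sphere3. AE r in sphere3. AE s in sphere3. radon_height_3 p q r s \<noteq> 0"
  proof (rule AE_I2)
    fix p :: space3
    show "AE q in sphere3. AE r in sphere3. AE s in sphere3. radon_height_3 p q r s \<noteq> 0"
      using AE_uniform_sphere3_distinct[of p]
    proof eventually_elim
      fix q :: space3 assume "line_normal (fst p) (fst q) \<noteq> 0"
      then have "AE r in sphere3. (line_normal (fst p) (fst q), 0) \<bullet> r \<noteq> line_normal (fst p) (fst q) \<bullet> fst p"
        by (intro AE_uniform_sphere3_hyperplane) (simp add: zero_prod_def)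
      then show "AE r in sphere3. AE s in sphere3. radon_height_3 p q r s \<noteq> 0"
      proof eventually_elim
        fix r :: space3
        assume "(line_normal (fst p) (fst q), 0) \<bullet> r \<noteq> line_normal (fst p) (fst q) \<bullet> fst p"
        then have A: "area2 (fst p) (fst q) (fst r) \<noteq> 0" by (simp add: area2_line_normal inner_prod_def)
        let ?n = "(snd p *\<^sub>R line_normal (fst q) (fst r) - snd q *\<^sub>R line_normal (fst p) (fst r) + snd r *\<^sub>R line_normal (fst p) (fst q),
          - area2 (fst p) (fst q) (fst r))"
        let ?s = "snd p * (line_normal (fst q) (fst r) \<bullet> fst q) - snd q * (line_normal (fst p) (fst r) \<bullet> fst p)
          + snd r * (line_normal (fst p) (fst q) \<bullet> fst p)"
        have "radon_height_3 p q r s = ?n \<bullet> s - ?s" for s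
          unfolding area2_line_normal[of _ _ "fst s"]
          by (simp add: inner_prod_def inner_add_left inner_diff_left algebra_simps)
        moreover have "AE s in sphere3. ?n \<bullet> s \<noteq> ?s"
          using A by (intro AE_uniform_sphere3_hyperplane) (simp add: zero_prod_def)
        ultimately show "AE s in sphere3. radon_height_3 p q r s \<noteq> 0" by simp
      qed
    qed
  qed
  moreover have "{0..3} = {0, 1, 2, 3::nat}" by (rule vertices_3) auto
  ultimately show ?thesis by (simp only:) (intro AE_PiM_4, measurable)
qed

lemma nn_integral_PiM_separated3:
  assumes "distinct [a, b, c, d]" "{a, b, c, d} \<subseteq> {0..3::nat}"
  shows "(\<integral>\<^sup>+x. indicator {..<0} (area2 (fst (x a)) (fst (x b)) (fst (x c)) * area2 (fst (x a)) (fst (x b)) (fst (x d)))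
    \<partial>PiM {0..3::nat} (\<lambda>_. sphere3)) = ennreal (3 / 8)"
proof -
  interpret prob_space sphere3 by (rule prob_space_uniform_sphere)
  show ?thesis
    unfolding vertices_3[OF assms] nn_integral_separated3[symmetric]
    by (rule nn_integral_PiM_4[OF _ assms(1)]) measurable
qed

text \<open>The product of two coefficients is minus the product of the positions of the two points
  relative to the line through the others, so equal signs mean separation. The 2 is added on the
  left because subtraction in \<open>ennreal\<close> is truncated.\<close>

lemma cone_count_3:
  fixes x :: "nat \<Rightarrow> space3"
  defines "D \<equiv> \<lambda>i j k. area2 (fst (x i)) (fst (x j)) (fst (x k))"
  assumes nz: "D 1 2 3 \<noteq> 0" "D 0 2 3 \<noteq> 0" "D 0 1 3 \<noteq> 0" "D 0 1 2 \<noteq> 0"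
    and h: "radon_height_3 (x 0) (x 1) (x 2) (x 3) \<noteq> 0"
  shows "2 + (\<Sum>i = 0..3. of_bool (cone_at 3 i x (0, 1)) + of_bool (cone_at 3 i x (0, - 1)))
    = (indicator {..<0} (D 2 3 0 * D 2 3 1) + indicator {..<0} (D 1 3 0 * D 1 3 2) + indicator {..<0} (D 1 2 0 * D 1 2 3)
      + indicator {..<0} (D 0 3 1 * D 0 3 2) + indicator {..<0} (D 0 2 1 * D 0 2 3) + indicator {..<0} (D 0 1 2 * D 0 1 3) :: ennreal)"
proof -
  define l :: "nat \<Rightarrow> real" where "l j = (if j = 0 then D 1 2 3 else if j = 1 then - D 0 2 3 else if j = 2 then D 0 1 3 else - D 0 1 2)" for j
  define \<kappa> where "\<kappa> = radon_height_3 (x 0) (x 1) (x 2) (x 3)"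
  have l: "l 0 = D 1 2 3" "l 1 = - D 0 2 3" "l 2 = D 0 1 3" "l 3 = - D 0 1 2" by (simp_all add: l_def)
  have suml: "l 0 + l 1 + l 2 + l 3 = 0"
    using radon_sum_3[of "fst (x 1)" "fst (x 2)" "fst (x 3)" "fst (x 0)"] unfolding l D_def by simp
  have cone: "cone_at 3 i x (0, \<sigma>) \<longleftrightarrow> (\<forall>j\<le>3. j \<noteq> i \<longrightarrow> 0 < \<sigma> * \<kappa> * l j)" if "i \<le> 3" "\<bar>\<sigma>\<bar> = 1" for i \<sigma>
  proof (rule cone_at_last_axis_iff[OF _ _ _ _ _ _ that])
    show "l j \<noteq> 0" if "j \<le> 3" for j using nz by (simp add: l_def)
    show "(\<Sum>j\<le>3. l j) = 0" using suml by (simp only: sum_atMost_3)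
    show "(\<Sum>j\<le>3. l j *\<^sub>R fst (x j)) = 0"
      using radon_3[of "fst (x 1)" "fst (x 2)" "fst (x 3)" "fst (x 0)"] unfolding sum_atMost_3 l D_def by simp
    show "(\<Sum>j\<le>3. l j * snd (x j)) = \<kappa>" unfolding sum_atMost_3 l D_def \<kappa>_def by simp
    show "\<kappa> \<noteq> 0" using h by (simp add: \<kappa>_def)
    fix m :: "nat \<Rightarrow> real" and j :: nat
    assume m: "(\<Sum>j\<le>3. m j) = 0" "(\<Sum>j\<le>3. m j *\<^sub>R fst (x j)) = 0" "m 0 = 0" and "j \<le> 3"
    have "m 1 + m 2 + m 3 = 0" "m 1 *\<^sub>R fst (x 1) + m 2 *\<^sub>R fst (x 2) + m 3 *\<^sub>R fst (x 3) = 0"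
      using m unfolding sum_atMost_3 by simp_all
    note affine_independent_3[OF this nz(1)[unfolded D_def]]
    then have "\<forall>j\<le>3. m j = 0" unfolding all_le_3 using m(3) by simp
    then show "m j = 0" using \<open>j \<le> 3\<close> by simp
  qed
  have prods: "l 0 * l 1 = - (D 2 3 0 * D 2 3 1)" "l 0 * l 2 = - (D 1 3 0 * D 1 3 2)" "l 0 * l 3 = - (D 1 2 0 * D 1 2 3)"
    "l 1 * l 2 = - (D 0 3 1 * D 0 3 2)" "l 1 * l 3 = - (D 0 2 1 * D 0 2 3)" "l 2 * l 3 = - (D 0 1 2 * D 0 1 3)"
    unfolding l D_def area2_def by (simp_all add: algebra_simps)
  have ind: "indicator {..<0} y = (of_bool (0 < - y) :: ennreal)" for y :: real
    by (simp add: indicator_def)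
  have "(\<Sum>i = 0..3. of_bool (cone_at 3 i x (0, 1)) + of_bool (cone_at 3 i x (0, - 1)) :: ennreal)
    = (of_bool (0 < \<kappa> * l 1 \<and> 0 < \<kappa> * l 2 \<and> 0 < \<kappa> * l 3) + of_bool (\<kappa> * l 1 < 0 \<and> \<kappa> * l 2 < 0 \<and> \<kappa> * l 3 < 0))
    + (of_bool (0 < \<kappa> * l 0 \<and> 0 < \<kappa> * l 2 \<and> 0 < \<kappa> * l 3) + of_bool (\<kappa> * l 0 < 0 \<and> \<kappa> * l 2 < 0 \<and> \<kappa> * l 3 < 0))
    + (of_bool (0 < \<kappa> * l 0 \<and> 0 < \<kappa> * l 1 \<and> 0 < \<kappa> * l 3) + of_bool (\<kappa> * l 0 < 0 \<and> \<kappa> * l 1 < 0 \<and> \<kappa> * l 3 < 0))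
    + (of_bool (0 < \<kappa> * l 0 \<and> 0 < \<kappa> * l 1 \<and> 0 < \<kappa> * l 2) + of_bool (\<kappa> * l 0 < 0 \<and> \<kappa> * l 1 < 0 \<and> \<kappa> * l 2 < 0))"
    unfolding atLeast0AtMost sum_atMost_3 by (simp add: cone all_le_3)
  then show ?thesis
    unfolding ind prods[symmetric] using count_signs_3[OF suml, of \<kappa>] nz h by (simp only: l \<kappa>_def) auto
qed

lemma nn_integral_vertex_angle_sum_3:
  "(\<integral>\<^sup>+x. ennreal (vertex_angle_sum (convex hull (x ` {0..3}))) \<partial>PiM {0..3::nat} (\<lambda>_. sphere3)) = ennreal (1 / 8)"
proof -
  let ?P = "PiM {0..3::nat} (\<lambda>_. sphere3)"
  let ?V = "\<integral>\<^sup>+x. ennreal (vertex_angle_sum (convex hull (x ` {0..3}))) \<partial>?P"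
  interpret prob_space ?P by (intro prob_space_PiM prob_space_uniform_sphere)
  have card: "CARD(4) = Suc DIM(space3)" by simp
  have e: "norm ((0::real \<times> real), 1::real) = 1" by (simp add: norm_Pair)
  have dim: "DIM(space3) = 3" and neg: "- ((0::real \<times> real), 1::real) = (0, - 1)" by simp_all
  let ?c = "\<lambda>x. (\<Sum>i = 0..3. of_bool (cone_at 3 i x (0, 1)) + of_bool (cone_at 3 i x (0, - 1))) :: ennreal"
  let ?s = "\<lambda>a b c d x. indicator {..<0} (area2 (fst (x a)) (fst (x b)) (fst (x c)) * area2 (fst (x a)) (fst (x b)) (fst (x d))) :: ennreal"
  have V: "2 * ?V = (\<integral>\<^sup>+x. ?c x \<partial>?P)"
    using nn_integral_vertex_angle_sum[OF DIM3 card e] unfolding dim neg .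
  have "(\<lambda>x. ?c x) \<in> borel_measurable ?P"
  proof (intro borel_measurable_sum)
    fix i :: nat assume "i \<in> {0..3}"
    then have i: "i \<le> 3" by simp
    have "CARD(4) = Suc 3" by simp
    note [measurable] = measurable_cone_at[OF i this, where 'a="space3"]
    show "(\<lambda>x. of_bool (cone_at 3 i x (0, 1)) + of_bool (cone_at 3 i x (0, - 1)) :: ennreal) \<in> borel_measurable ?P"
      by measurable
  qed
  then have "2 + 2 * ?V = (\<integral>\<^sup>+x. 2 + ?c x \<partial>?P)"
    unfolding V using emeasure_space_1 by (simp add: nn_integral_add)
  also have "\<dots> = (\<integral>\<^sup>+x. ?s 2 3 0 1 x + ?s 1 3 0 2 x + ?s 1 2 0 3 x + ?s 0 3 1 2 x + ?s 0 2 1 3 x + ?s 0 1 2 3 x \<partial>?P)"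
  proof (rule nn_integral_cong_AE)
    have "AE x in ?P. area2 (fst (x 1)) (fst (x 2)) (fst (x 3)) \<noteq> 0" by (rule AE_area2_nonzero[of 1 2 3 0]) auto
    moreover have "AE x in ?P. area2 (fst (x 0)) (fst (x 2)) (fst (x 3)) \<noteq> 0" by (rule AE_area2_nonzero[of 0 2 3 1]) auto
    moreover have "AE x in ?P. area2 (fst (x 0)) (fst (x 1)) (fst (x 3)) \<noteq> 0" by (rule AE_area2_nonzero[of 0 1 3 2]) auto
    moreover have "AE x in ?P. area2 (fst (x 0)) (fst (x 1)) (fst (x 2)) \<noteq> 0" by (rule AE_area2_nonzero[of 0 1 2 3]) auto
    moreover note AE_radon_height_3
    ultimately show "AE x in ?P. 2 + ?c x = ?s 2 3 0 1 x + ?s 1 3 0 2 x + ?s 1 2 0 3 x + ?s 0 3 1 2 x + ?s 0 2 1 3 x + ?s 0 1 2 3 x"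
      by eventually_elim (rule cone_count_3)
  qed
  also have "\<dots> = ennreal (3 / 8) + ennreal (3 / 8) + ennreal (3 / 8) + ennreal (3 / 8) + ennreal (3 / 8) + ennreal (3 / 8)"
  proof -
    have m: "(\<lambda>x. ?s a b c d x) \<in> borel_measurable ?P" if "{a, b, c, d} \<subseteq> {0..3}" for a b c d
    proof -
      have [measurable]: "(\<lambda>x. x j) \<in> borel_measurable ?P" if "j \<in> {a, b, c, d}" for j
        using that \<open>{a, b, c, d} \<subseteq> {0..3}\<close> measurable_component_singleton[of j "{0..3}" "\<lambda>_. sphere3"] by (auto cong: measurable_cong_sets)
      show ?thesis by measurable
    qed
    show ?thesis
      by (simp add: nn_integral_add borel_measurable_add m nn_integral_PiM_separated3)
  qed
  also have "\<dots> = ennreal (9 / 4)" by (simp flip: ennreal_plus)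
  finally have *: "2 + 2 * ?V = ennreal (9 / 4)" .
  \<comment> \<open>The finite right-hand side forces \<open>?V\<close> to be finite, after which
    the equation can be solved over the reals.\<close>
  then have "?V \<noteq> \<infinity>" by (auto simp: ennreal_mult_eq_top_iff)
  then obtain v where v: "?V = ennreal v" "0 \<le> v" by (cases ?V) auto
  have "ennreal (2 + 2 * v) = ennreal (9 / 4)" using * v by (simp add: ennreal_mult)
  then have "v = 1 / 8" using v(2) by (subst (asm) ennreal_inj) auto
  then show ?thesis using v by simp
qed

section \<open>Four-dimensional simplices\<close>

abbreviation "sphere4 \<equiv> (uniform_sphere :: space4 measure)"

text \<open>Six times the signed volume of the tetrahedron, written as the position of
  \<open>S\<close> relative to the oriented plane through the other points.\<close>

definition volume3 :: "space3 \<Rightarrow> space3 \<Rightarrow> space3 \<Rightarrow> space3 \<Rightarrow> real" where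
  "volume3 P Q R S = plane_normal P Q R \<bullet> S - plane_normal P Q R \<bullet> P"

lemma borel_measurable_volume3 [measurable (raw)]:
  assumes [measurable]: "f \<in> borel_measurable M" "g \<in> borel_measurable M" "h \<in> borel_measurable M" "k \<in> borel_measurable M"
  shows "(\<lambda>x. volume3 (f x) (g x) (h x) (k x)) \<in> borel_measurable M"
  unfolding volume3_def by measurable

lemma DIM4: "DIM(space4) = CARD(4)"
  by simp

lemma AE_uniform_sphere4_hyperplane:
  "a \<noteq> 0 \<Longrightarrow> AE x in sphere4. a \<bullet> x \<noteq> s"
  by (rule AE_uniform_sphere_hyperplane[OF norm_axis4 DIM4 distr_uniform_sphere_axis4]) auto

text \<open>A nonzero last component of the normal suffices. It says that the projections to the
  first two coordinates are not collinear, a hyperplane condition on \<open>r\<close> once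
  \<open>p\<close> and \<open>q\<close> differ there.\<close>

lemma AE_uniform_sphere4_noncollinear:
  "AE q in sphere4. AE r in sphere4. plane_normal (fst p) (fst q) (fst r) \<noteq> 0"
proof -
  have "AE q in sphere4. (((1, 0), 0), 0) \<bullet> q \<noteq> fst (fst (fst p))"
    by (rule AE_uniform_sphere4_hyperplane) (simp add: zero_prod_def)
  then show ?thesis
  proof eventually_elim
    fix q :: space4
    let ?l = "line_normal (fst (fst p)) (fst (fst q))"
    assume "(((1, 0), 0), 0) \<bullet> q \<noteq> fst (fst (fst p))"
    then have "?l \<noteq> 0" by (auto simp: line_normal_def zero_prod_def inner_prod_def)
    then have "AE r in sphere4. ((?l, 0), 0) \<bullet> r \<noteq> ?l \<bullet> fst (fst p)"
      by (intro AE_uniform_sphere4_hyperplane) (simp add: zero_prod_def)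
    then show "AE r in sphere4. plane_normal (fst p) (fst q) (fst r) \<noteq> 0"
    proof eventually_elim
      fix r :: space4 assume "((?l, 0), 0) \<bullet> r \<noteq> ?l \<bullet> fst (fst p)"
      then have "area2 (fst (fst p)) (fst (fst q)) (fst (fst r)) \<noteq> 0"
        by (simp add: area2_line_normal inner_prod_def)
      then show "plane_normal (fst p) (fst q) (fst r) \<noteq> 0"
        by (simp add: plane_normal_def zero_prod_def)
    qed
  qed
qed

lemma plane_offset_sphere_law:
  fixes \<Phi> :: "real \<Rightarrow> ennreal"
  assumes [measurable]: "\<Phi> \<in> borel_measurable borel" and even: "\<And>t. \<Phi> (- t) = \<Phi> t"
  shows "(\<integral>\<^sup>+p. \<integral>\<^sup>+q. \<integral>\<^sup>+r. \<Phi> (plane_offset (fst p) (fst q) (fst r)) \<partial>sphere4 \<partial>sphere4 \<partial>sphere4)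
    = ennreal (16 / (5 * pi)) * (LEB s. ennreal (sqrt (1 - s\<^sup>2) ^ 5) * \<Phi> s)"
proof -
  interpret prob_space sphere4 by (rule prob_space_uniform_sphere)
  obtain C where C: "distr uniform_sphere borel (fst :: space4 \<Rightarrow> _) = density lborel (\<lambda>y. C * ball_density y)"
    using distr_uniform_sphere_fst by blast
  from plane_offset_law obtain K where K: "\<forall>\<Phi>. \<Phi> \<in> borel_measurable borel \<longrightarrow> (\<forall>t. \<Phi> (- t) = \<Phi> t) \<longrightarrow>
    (LEB p. LEB q. LEB r. ball_density p * ball_density q * ball_density r * \<Phi> (plane_offset p q r))
      = K * (LEB s. ennreal (sqrt (1 - s\<^sup>2) ^ 5) * \<Phi> s)"
    by (rule exE)
  have main: "(\<integral>\<^sup>+p. \<integral>\<^sup>+q. \<integral>\<^sup>+r. \<Psi> (plane_offset (fst p) (fst q) (fst r)) \<partial>sphere4 \<partial>sphere4 \<partial>sphere4)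
    = C * C * C * K * (LEB s. ennreal (sqrt (1 - s\<^sup>2) ^ 5) * \<Psi> s)"
    if [measurable]: "\<Psi> \<in> borel_measurable borel" and even: "\<And>t. \<Psi> (- t) = \<Psi> t" for \<Psi>
  proof -
    let ?g = "\<lambda>P Q R. ball_density P * ball_density Q * ball_density R * \<Psi> (plane_offset P Q R)"
    have "(\<integral>\<^sup>+p. \<integral>\<^sup>+q. \<integral>\<^sup>+r. \<Psi> (plane_offset (fst p) (fst q) (fst r)) \<partial>sphere4 \<partial>sphere4 \<partial>sphere4)
      = (\<integral>\<^sup>+p. \<integral>\<^sup>+q. (LEB R. C * (ball_density R * \<Psi> (plane_offset (fst p) (fst q) R))) \<partial>sphere4 \<partial>sphere4)"
      by (intro nn_integral_cong nn_integral_uniform_sphere_fst[OF C]) measurable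
    also have "\<dots> = (\<integral>\<^sup>+p. (LEB Q. C * (ball_density Q * (LEB R. C * (ball_density R * \<Psi> (plane_offset (fst p) Q R))))) \<partial>sphere4)"
      by (intro nn_integral_cong nn_integral_uniform_sphere_fst[OF C]) measurable
    also have "\<dots> = (LEB P. C * (ball_density P * (LEB Q. C * (ball_density Q * (LEB R. C * (ball_density R * \<Psi> (plane_offset P Q R)))))))"
      by (intro nn_integral_uniform_sphere_fst[OF C]) measurable
    also have "\<dots> = (LEB P. LEB Q. LEB R. (C * C * C) * ?g P Q R)"
    proof (rule nn_integral_cong)
      fix P :: space3
      have 1: "C * (ball_density Q * (LEB R. C * (ball_density R * \<Psi> (plane_offset P Q R))))
        = (LEB R. C * (ball_density Q * (C * (ball_density R * \<Psi> (plane_offset P Q R)))))" for Q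
        unfolding mult.assoc[symmetric, of C "ball_density Q"] by (rule nn_integral_cmult[symmetric]) measurable
      have 2: "C * (ball_density P * (LEB Q. f Q)) = (LEB Q. C * (ball_density P * f Q))"
        if [measurable]: "f \<in> borel_measurable borel" for f :: "space3 \<Rightarrow> ennreal"
        unfolding mult.assoc[symmetric, of C "ball_density P"] by (rule nn_integral_cmult[symmetric]) measurable
      have "C * (ball_density P * (LEB Q. C * (ball_density Q * (LEB R. C * (ball_density R * \<Psi> (plane_offset P Q R))))))
        = (LEB Q. C * (ball_density P * (LEB R. C * (ball_density Q * (C * (ball_density R * \<Psi> (plane_offset P Q R)))))))"
        unfolding 1 by (rule 2) measurable
      also have "\<dots> = (LEB Q. LEB R. C * (ball_density P * (C * (ball_density Q * (C * (ball_density R * \<Psi> (plane_offset P Q R)))))))"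
        by (intro nn_integral_cong 2) measurable
      also have "\<dots> = (LEB Q. LEB R. (C * C * C) * ?g P Q R)"
        by (simp only: mult_ac)
      finally show "C * (ball_density P * (LEB Q. C * (ball_density Q * (LEB R. C * (ball_density R * \<Psi> (plane_offset P Q R))))))
        = (LEB Q. LEB R. (C * C * C) * ?g P Q R)" .
    qed
    also have "\<dots> = (C * C * C) * (LEB P. LEB Q. LEB R. ?g P Q R)"
      by (intro nn_integral_lborel_cmult3) measurable
    finally show ?thesis unfolding K[rule_format, OF that] by (simp only: mult.assoc)
  qed
  have "(LEB s. ennreal (sqrt (1 - s\<^sup>2) ^ 5)) = (LEB s. ennreal (sqrt (1 - s\<^sup>2) ^ 5) * indicator {-1..1} s)"
    using ennreal_sqrt_eq_indicator[of 5] by (intro nn_integral_cong) auto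
  also have "\<dots> = ennreal (5 * pi / 16)"
    unfolding nn_integral_sqrt_pow by (simp add: numeral_eq_Suc)
  finally have total: "(LEB s. ennreal (sqrt (1 - s\<^sup>2) ^ 5)) = ennreal (5 * pi / 16)" .
  \<comment> \<open>Again the constant function 1 fixes the product of constants, now as the inverse
    of \<open>5 * pi / 16\<close>.\<close>
  have "C * C * C * K * ennreal (5 * pi / 16) = 1"
    using main[of "\<lambda>_. 1"] emeasure_space_1 total by simp
  then have "C * C * C * K = ennreal (1 / (5 * pi / 16))"
    by (rule ennreal_unique_inverse) simp
  then show ?thesis using main[OF assms] by simp
qed

text \<open>A plane through three projections lifts to a hyperplane parallel to the last axis, so
  \<open>sep_prob\<close> applies to the points of the sphere. The value is the product of
  \<open>16 / (5 * pi)\<close> and \<open>5 * pi / 48 + 539 / (2304 * pi)\<close>.\<close>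

lemma nn_integral_separated4:
  "(\<integral>\<^sup>+p. \<integral>\<^sup>+q. \<integral>\<^sup>+r. \<integral>\<^sup>+s. \<integral>\<^sup>+t. indicator {..<0} (volume3 (fst p) (fst q) (fst r) (fst s) * volume3 (fst p) (fst q) (fst r) (fst t))
      \<partial>sphere4 \<partial>sphere4 \<partial>sphere4 \<partial>sphere4 \<partial>sphere4) = ennreal (1 / 3 + 539 / (720 * pi\<^sup>2))"
proof -
  let ?e = "(((1::real, 0::real), 0::real), 0::real)"
  let ?i = "\<lambda>p q r s t. indicator {..<0} (volume3 (fst p) (fst q) (fst r) (fst s) * volume3 (fst p) (fst q) (fst r) (fst t)) :: ennreal"
  have "(\<integral>\<^sup>+p. \<integral>\<^sup>+q. \<integral>\<^sup>+r. \<integral>\<^sup>+s. \<integral>\<^sup>+t. ?i p q r s t \<partial>sphere4 \<partial>sphere4 \<partial>sphere4 \<partial>sphere4 \<partial>sphere4)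
    = (\<integral>\<^sup>+p. \<integral>\<^sup>+q. \<integral>\<^sup>+r. sep_prob ?e (plane_offset (fst p) (fst q) (fst r)) \<partial>sphere4 \<partial>sphere4 \<partial>sphere4)"
  proof (rule nn_integral_cong, rule nn_integral_cong_AE)
    fix p :: space4
    show "AE q in sphere4. (\<integral>\<^sup>+r. \<integral>\<^sup>+s. \<integral>\<^sup>+t. ?i p q r s t \<partial>sphere4 \<partial>sphere4 \<partial>sphere4)
      = (\<integral>\<^sup>+r. sep_prob ?e (plane_offset (fst p) (fst q) (fst r)) \<partial>sphere4)"
      using AE_uniform_sphere4_noncollinear[of p]
    proof eventually_elim
      fix q :: space4
      assume "AE r in sphere4. plane_normal (fst p) (fst q) (fst r) \<noteq> 0"
      then show "(\<integral>\<^sup>+r. \<integral>\<^sup>+s. \<integral>\<^sup>+t. ?i p q r s t \<partial>sphere4 \<partial>sphere4 \<partial>sphere4)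
      = (\<integral>\<^sup>+r. sep_prob ?e (plane_offset (fst p) (fst q) (fst r)) \<partial>sphere4)"
      proof (intro nn_integral_cong_AE, eventually_elim)
        fix r :: space4
        let ?n = "plane_normal (fst p) (fst q) (fst r)"
        assume "?n \<noteq> 0"
        then have a: "(?n, 0::real) \<noteq> 0" by (simp add: zero_prod_def)
        have "volume3 (fst p) (fst q) (fst r) (fst s) = (?n, 0) \<bullet> s - ?n \<bullet> fst p" for s :: space4
          by (simp add: volume3_def inner_prod_def)
        then show "(\<integral>\<^sup>+s. \<integral>\<^sup>+t. ?i p q r s t \<partial>sphere4 \<partial>sphere4)
          = sep_prob ?e (plane_offset (fst p) (fst q) (fst r))"
          using nn_integral_separated[OF norm_axis4 DIM4 a, of "?n \<bullet> fst p"]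
          by (simp add: lessThan_def plane_offset_def norm_Pair[of ?n 0])
      qed
    qed
  qed
  also have "\<dots> = ennreal (16 / (5 * pi)) * (LEB s. ennreal (sqrt (1 - s\<^sup>2) ^ 5) * sep_prob ?e s)"
    by (intro plane_offset_sphere_law borel_measurable_sep_prob[OF norm_axis4 DIM4] sep_prob_even[OF norm_axis4 DIM4])
  also have "(LEB s. ennreal (sqrt (1 - s\<^sup>2) ^ 5) * sep_prob ?e s)
    = (LEB s. ennreal (sqrt (1 - s\<^sup>2) ^ 5) * ennreal ((1 - (2 / pi * semicircle_prim (arcsin s))\<^sup>2) / 2))"
  proof (rule nn_integral_cong)
    fix s :: real
    show "ennreal (sqrt (1 - s\<^sup>2) ^ 5) * sep_prob ?e s
      = ennreal (sqrt (1 - s\<^sup>2) ^ 5) * ennreal ((1 - (2 / pi * semicircle_prim (arcsin s))\<^sup>2) / 2)"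
    proof (cases "- 1 < s \<and> s < 1")
      case False
      then have "1 \<le> s\<^sup>2" using abs_square_less_1[of s] by auto
      then have "sqrt (1 - s\<^sup>2) ^ 5 \<le> 0" by (simp add: power_le_zero_eq)
      then have "ennreal (sqrt (1 - s\<^sup>2) ^ 5) = 0" by (simp only: ennreal_eq_0_iff)
      then show ?thesis by simp
    qed (simp add: sep_prob_axis4)
  qed
  also have "\<dots> = ennreal (5 * pi / 48 + 539 / (2304 * pi))"
    by (rule nn_integral_semicircle_separation)
  also have "ennreal (16 / (5 * pi)) * ennreal (5 * pi / 48 + 539 / (2304 * pi)) = ennreal (16 / (5 * pi) * (5 * pi / 48 + 539 / (2304 * pi)))"
    by (rule ennreal_mult'[symmetric]) simp
  also have "16 / (5 * pi) * (5 * pi / 48 + 539 / (2304 * pi)) = 1 / 3 + 539 / (720 * pi\<^sup>2)"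
    by (simp add: field_simps power2_eq_square)
  finally show ?thesis .
qed

section \<open>Signs in the affine dependence of five points in space\<close>

lemma sum_atMost_4: "(\<Sum>j\<le>(4::nat). f j) = f 0 + f 1 + f 2 + f 3 + f 4"
  by (simp add: numeral_eq_Suc)

lemma all_le_4: "(\<forall>j\<le>(4::nat). P j) \<longleftrightarrow> P 0 \<and> P 1 \<and> P 2 \<and> P 3 \<and> P 4"
  by (auto simp: le_Suc_eq numeral_eq_Suc)

text \<open>A single deviating sign leaves 6 equal pairs instead of 4, so an interior projection
  raises the count by 2. The sign of \<open>\<kappa>\<close> only exchanges the two alternatives in
  each summand.\<close>

lemma count_signs_4:
  fixes a b c d e \<kappa> :: real
  assumes "a + b + c + d + e = 0" "a \<noteq> 0" "b \<noteq> 0" "c \<noteq> 0" "d \<noteq> 0" "e \<noteq> 0" "\<kappa> \<noteq> 0"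
  shows "4 + 2 * ((of_bool (0 < \<kappa> * b \<and> 0 < \<kappa> * c \<and> 0 < \<kappa> * d \<and> 0 < \<kappa> * e) + of_bool (\<kappa> * b < 0 \<and> \<kappa> * c < 0 \<and> \<kappa> * d < 0 \<and> \<kappa> * e < 0))
    + (of_bool (0 < \<kappa> * a \<and> 0 < \<kappa> * c \<and> 0 < \<kappa> * d \<and> 0 < \<kappa> * e) + of_bool (\<kappa> * a < 0 \<and> \<kappa> * c < 0 \<and> \<kappa> * d < 0 \<and> \<kappa> * e < 0))
    + (of_bool (0 < \<kappa> * a \<and> 0 < \<kappa> * b \<and> 0 < \<kappa> * d \<and> 0 < \<kappa> * e) + of_bool (\<kappa> * a < 0 \<and> \<kappa> * b < 0 \<and> \<kappa> * d < 0 \<and> \<kappa> * e < 0))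
    + (of_bool (0 < \<kappa> * a \<and> 0 < \<kappa> * b \<and> 0 < \<kappa> * c \<and> 0 < \<kappa> * e) + of_bool (\<kappa> * a < 0 \<and> \<kappa> * b < 0 \<and> \<kappa> * c < 0 \<and> \<kappa> * e < 0))
    + (of_bool (0 < \<kappa> * a \<and> 0 < \<kappa> * b \<and> 0 < \<kappa> * c \<and> 0 < \<kappa> * d) + of_bool (\<kappa> * a < 0 \<and> \<kappa> * b < 0 \<and> \<kappa> * c < 0 \<and> \<kappa> * d < 0)))
    = (of_bool (0 < a * b) + of_bool (0 < a * c) + of_bool (0 < a * d) + of_bool (0 < a * e) + of_bool (0 < b * c) + of_bool (0 < b * d) + of_bool (0 < b * e) + of_bool (0 < c * d) + of_bool (0 < c * e) + of_bool (0 < d * e) :: ennreal)"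
proof -
  have "a > 0 \<or> a < 0" "b > 0 \<or> b < 0" "c > 0 \<or> c < 0" "d > 0 \<or> d < 0" "e > 0 \<or> e < 0" "\<kappa> > 0 \<or> \<kappa> < 0"
    using assms by linarith+
  then show ?thesis
    using assms(1) by (elim disjE) (simp_all add: zero_less_mult_iff mult_less_0_iff less_asym)
qed

text \<open>\<open>volume3\<close> is alternating in its four points; this rule and the following
  ones record the signs for moving the last point to an earlier place.\<close>

lemma volume3_last_third: "volume3 P Q S R = - volume3 P Q R S"
  by (simp add: volume3_def plane_normal_def area2_def inner_prod_def algebra_simps)

lemma volume3_swap_middle: "volume3 P R Q S = - volume3 P Q R S"
  by (simp add: volume3_def plane_normal_def area2_def inner_prod_def algebra_simps)

lemma volume3_swap_first: "volume3 Q P R S = - volume3 P Q R S"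
  by (simp add: volume3_def plane_normal_def area2_def inner_prod_def algebra_simps)

lemma volume3_last_second: "volume3 P R S Q = volume3 P Q R S"
  using volume3_last_third[of P R Q S] volume3_swap_middle[of P R Q S] by simp

lemma volume3_last_first: "volume3 Q R S P = - volume3 P Q R S"
  using volume3_last_second[of Q R S P] volume3_swap_first[of Q P R S] by simp

text \<open>Cramer's rule again, with \<open>radon_4\<close>: each coefficient is the signed volume
  of the tetrahedron formed by the other four points.\<close>

lemma radon_sum_4:
  "volume3 Q R S T - volume3 P R S T + volume3 P Q S T - volume3 P Q R T + volume3 P Q R S = 0"
  by (simp add: volume3_def plane_normal_def area2_def inner_prod_def algebra_simps)

lemma radon_4:
  "volume3 Q R S T *\<^sub>R P - volume3 P R S T *\<^sub>R Q + volume3 P Q S T *\<^sub>R R - volume3 P Q R T *\<^sub>R S + volume3 P Q R S *\<^sub>R T = 0"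
  by (simp add: volume3_def plane_normal_def area2_def inner_prod_def prod_eq_iff algebra_simps)

text \<open>The normal of the plane through \<open>P\<close>, \<open>Q\<close>, \<open>R\<close> has
  the same inner product with all three, so pairing it with the dependence leaves only
  \<open>d * volume3 P Q R S\<close>.\<close>

lemma affine_independent_4_last:
  assumes "a + b + c + d = 0" "a *\<^sub>R P + b *\<^sub>R Q + c *\<^sub>R R + d *\<^sub>R S = 0" and V: "volume3 P Q R S \<noteq> 0"
  shows "d = 0"
proof -
  let ?n = "plane_normal P Q R"
  have n: "?n \<bullet> Q = ?n \<bullet> P" "?n \<bullet> R = ?n \<bullet> P"
    by (simp_all add: plane_normal_def area2_def inner_prod_def algebra_simps)
  have "?n \<bullet> (a *\<^sub>R P + b *\<^sub>R Q + c *\<^sub>R R + d *\<^sub>R S) = (a + b + c + d) * (?n \<bullet> P) + d * volume3 P Q R S"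
    by (simp add: inner_add_right n volume3_def algebra_simps)
  then show ?thesis using assms by simp
qed

lemma affine_independent_4:
  assumes "a + b + c + d = 0" "a *\<^sub>R P + b *\<^sub>R Q + c *\<^sub>R R + d *\<^sub>R S = 0" and V: "volume3 P Q R S \<noteq> 0"
  shows "a = 0" "b = 0" "c = 0" "d = 0"
proof -
  show "d = 0" by (rule affine_independent_4_last[OF assms])
  show "c = 0"
    using affine_independent_4_last[of a b d c P Q S R] assms volume3_last_third[of P Q S R] by (simp add: add_ac)
  show "b = 0"
    using affine_independent_4_last[of a c d b P R S Q] assms volume3_last_second[of P R S Q] by (simp add: add_ac)
  show "a = 0"
    using affine_independent_4_last[of b c d a Q R S P] assms volume3_last_first[of Q R S P] by (simp add: add_ac)
qed

lemma vertices_4: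
  assumes "distinct [a, b, c, d, e]" "{a, b, c, d, e} \<subseteq> {0..4::nat}"
  shows "{0..4} = {a, b, c, d, e}"
proof (rule card_subset_eq[symmetric])
  show "card {a, b, c, d, e} = card {0..4::nat}" using assms(1) by simp
qed (use assms in auto)

text \<open>Almost surely the first three projections span a plane; only the conditions on the last
  two points remain to be treated case by case.\<close>

lemma AE_volume3_chain:
  assumes "\<And>p q r. plane_normal (fst p) (fst q) (fst r) \<noteq> 0 \<Longrightarrow> AE s in sphere4. AE t in sphere4. P p q r s t"
  shows "AE p in sphere4. AE q in sphere4. AE r in sphere4. AE s in sphere4. AE t in sphere4. P p q r s t"
proof (rule AE_I2)
  fix p :: space4
  show "AE q in sphere4. AE r in sphere4. AE s in sphere4. AE t in sphere4. P p q r s t"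
    using AE_uniform_sphere4_noncollinear[of p] by (auto elim!: eventually_mono intro: assms)
qed

lemma AE_uniform_sphere4_volume3:
  assumes "plane_normal (fst p) (fst q) (fst r) \<noteq> 0"
  shows "AE s in sphere4. volume3 (fst p) (fst q) (fst r) (fst s) \<noteq> 0"
proof -
  have "AE s in sphere4. (plane_normal (fst p) (fst q) (fst r), 0) \<bullet> s \<noteq> plane_normal (fst p) (fst q) (fst r) \<bullet> fst p"
    using assms by (intro AE_uniform_sphere4_hyperplane) (simp add: zero_prod_def)
  then show ?thesis
    by eventually_elim (simp add: volume3_def inner_prod_def[of "(_, _)"])
qed

lemma AE_volume3_nonzero:
  assumes "distinct [a, b, c, d, e]" "{a, b, c, d, e} \<subseteq> {0..4::nat}"
  shows "AE x in PiM {0..4::nat} (\<lambda>_. sphere4). volume3 (fst (x a)) (fst (x b)) (fst (x c)) (fst (x d)) \<noteq> 0"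
proof -
  interpret prob_space sphere4 by (rule prob_space_uniform_sphere)
  have "AE p in sphere4. AE q in sphere4. AE r in sphere4. AE s in sphere4. AE t in sphere4. volume3 (fst p) (fst q) (fst r) (fst s) \<noteq> 0"
    by (rule AE_volume3_chain) (auto elim!: eventually_mono dest!: AE_uniform_sphere4_volume3)
  then show ?thesis
    unfolding vertices_4[OF assms] by (intro AE_PiM_5 assms(1)) measurable
qed

abbreviation radon_height_4 :: "space4 \<Rightarrow> space4 \<Rightarrow> space4 \<Rightarrow> space4 \<Rightarrow> space4 \<Rightarrow> real" where
  "radon_height_4 p q r s t \<equiv> volume3 (fst q) (fst r) (fst s) (fst t) * snd p - volume3 (fst p) (fst r) (fst s) (fst t) * snd q
    + volume3 (fst p) (fst q) (fst s) (fst t) * snd r - volume3 (fst p) (fst q) (fst r) (fst t) * snd s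
    + volume3 (fst p) (fst q) (fst r) (fst s) * snd t"

lemma AE_radon_height_4: "AE x in PiM {0..4::nat} (\<lambda>_. sphere4). radon_height_4 (x 0) (x 1) (x 2) (x 3) (x 4) \<noteq> 0"
proof -
  interpret prob_space sphere4 by (rule prob_space_uniform_sphere)
  have "AE p in sphere4. AE q in sphere4. AE r in sphere4. AE s in sphere4. AE t in sphere4. radon_height_4 p q r s t \<noteq> 0"
  proof (rule AE_volume3_chain)
    fix p q r :: space4
    assume "plane_normal (fst p) (fst q) (fst r) \<noteq> 0"
    from AE_uniform_sphere4_volume3[OF this]
    show "AE s in sphere4. AE t in sphere4. radon_height_4 p q r s t \<noteq> 0"
    proof eventually_elim
      fix s :: space4
      assume V: "volume3 (fst p) (fst q) (fst r) (fst s) \<noteq> 0"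
      let ?n = "(snd p *\<^sub>R plane_normal (fst q) (fst r) (fst s) - snd q *\<^sub>R plane_normal (fst p) (fst r) (fst s)
        + snd r *\<^sub>R plane_normal (fst p) (fst q) (fst s) - snd s *\<^sub>R plane_normal (fst p) (fst q) (fst r),
        volume3 (fst p) (fst q) (fst r) (fst s))"
      let ?c = "snd p * (plane_normal (fst q) (fst r) (fst s) \<bullet> fst q) - snd q * (plane_normal (fst p) (fst r) (fst s) \<bullet> fst p)
        + snd r * (plane_normal (fst p) (fst q) (fst s) \<bullet> fst p) - snd s * (plane_normal (fst p) (fst q) (fst r) \<bullet> fst p)"
      have "radon_height_4 p q r s t = ?n \<bullet> t - ?c" for t
        unfolding volume3_def[of _ _ _ "fst t"]
        by (simp add: inner_prod_def[of "(_, _)"] inner_add_left inner_diff_left algebra_simps)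
      moreover have "AE t in sphere4. ?n \<bullet> t \<noteq> ?c"
        using V by (intro AE_uniform_sphere4_hyperplane) (simp add: zero_prod_def)
      ultimately show "AE t in sphere4. radon_height_4 p q r s t \<noteq> 0" by simp
    qed
  qed
  moreover have "{0..4} = {0, 1, 2, 3, 4::nat}" by (rule vertices_4) auto
  ultimately show ?thesis by (simp only:) (intro AE_PiM_5, measurable)
qed

lemma nn_integral_PiM_separated4:
  assumes "distinct [a, b, c, d, e]" "{a, b, c, d, e} \<subseteq> {0..4::nat}"
  shows "(\<integral>\<^sup>+x. indicator {..<0} (volume3 (fst (x a)) (fst (x b)) (fst (x c)) (fst (x d)) * volume3 (fst (x a)) (fst (x b)) (fst (x c)) (fst (x e)))
    \<partial>PiM {0..4::nat} (\<lambda>_. sphere4)) = ennreal (1 / 3 + 539 / (720 * pi\<^sup>2))"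
proof -
  interpret prob_space sphere4 by (rule prob_space_uniform_sphere)
  show ?thesis
    unfolding vertices_4[OF assms] nn_integral_separated4[symmetric]
    by (rule nn_integral_PiM_5[OF _ assms(1)]) measurable
qed

lemma cone_count_4:
  fixes x :: "nat \<Rightarrow> space4"
  defines "D \<equiv> \<lambda>i j k m. volume3 (fst (x i)) (fst (x j)) (fst (x k)) (fst (x m))"
  assumes nz: "D 1 2 3 4 \<noteq> 0" "D 0 2 3 4 \<noteq> 0" "D 0 1 3 4 \<noteq> 0" "D 0 1 2 4 \<noteq> 0" "D 0 1 2 3 \<noteq> 0"
    and h: "radon_height_4 (x 0) (x 1) (x 2) (x 3) (x 4) \<noteq> 0"
  shows "4 + 2 * (\<Sum>i = 0..4. of_bool (cone_at 4 i x (0, 1)) + of_bool (cone_at 4 i x (0, - 1)))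
    = (indicator {..<0} (D 2 3 4 0 * D 2 3 4 1) + indicator {..<0} (D 1 3 4 0 * D 1 3 4 2) + indicator {..<0} (D 1 2 4 0 * D 1 2 4 3) + indicator {..<0} (D 1 2 3 0 * D 1 2 3 4) + indicator {..<0} (D 0 3 4 1 * D 0 3 4 2) + indicator {..<0} (D 0 2 4 1 * D 0 2 4 3) + indicator {..<0} (D 0 2 3 1 * D 0 2 3 4) + indicator {..<0} (D 0 1 4 2 * D 0 1 4 3) + indicator {..<0} (D 0 1 3 2 * D 0 1 3 4) + indicator {..<0} (D 0 1 2 3 * D 0 1 2 4) :: ennreal)"
proof -
  define l :: "nat \<Rightarrow> real" where "l j = (if j = 0 then D 1 2 3 4 else if j = 1 then - D 0 2 3 4 else if j = 2 then D 0 1 3 4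
    else if j = 3 then - D 0 1 2 4 else D 0 1 2 3)" for j
  define \<kappa> where "\<kappa> = radon_height_4 (x 0) (x 1) (x 2) (x 3) (x 4)"
  have l: "l 0 = D 1 2 3 4" "l 1 = - D 0 2 3 4" "l 2 = D 0 1 3 4" "l 3 = - D 0 1 2 4" "l 4 = D 0 1 2 3" by (simp_all add: l_def)
  have suml: "l 0 + l 1 + l 2 + l 3 + l 4 = 0"
    using radon_sum_4[of "fst (x 1)" "fst (x 2)" "fst (x 3)" "fst (x 4)" "fst (x 0)"] unfolding l D_def by simp
  have cone: "cone_at 4 i x (0, \<sigma>) \<longleftrightarrow> (\<forall>j\<le>4. j \<noteq> i \<longrightarrow> 0 < \<sigma> * \<kappa> * l j)" if "i \<le> 4" "\<bar>\<sigma>\<bar> = 1" for i \<sigma>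
  proof (rule cone_at_last_axis_iff[OF _ _ _ _ _ _ that])
    show "l j \<noteq> 0" if "j \<le> 4" for j using nz by (simp add: l_def)
    show "(\<Sum>j\<le>4. l j) = 0" using suml by (simp only: sum_atMost_4)
    show "(\<Sum>j\<le>4. l j *\<^sub>R fst (x j)) = 0"
      using radon_4[of "fst (x 1)" "fst (x 2)" "fst (x 3)" "fst (x 4)" "fst (x 0)"] unfolding sum_atMost_4 l D_def by simp
    show "(\<Sum>j\<le>4. l j * snd (x j)) = \<kappa>" unfolding sum_atMost_4 l D_def \<kappa>_def by simp
    show "\<kappa> \<noteq> 0" using h by (simp add: \<kappa>_def)
    fix m :: "nat \<Rightarrow> real" and j :: nat
    assume m: "(\<Sum>j\<le>4. m j) = 0" "(\<Sum>j\<le>4. m j *\<^sub>R fst (x j)) = 0" "m 0 = 0" and "j \<le> 4"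
    have "m 1 + m 2 + m 3 + m 4 = 0" "m 1 *\<^sub>R fst (x 1) + m 2 *\<^sub>R fst (x 2) + m 3 *\<^sub>R fst (x 3) + m 4 *\<^sub>R fst (x 4) = 0"
      using m unfolding sum_atMost_4 by simp_all
    note affine_independent_4[OF this nz(1)[unfolded D_def]]
    then have "\<forall>j\<le>4. m j = 0" unfolding all_le_4 using m(3) by simp
    then show "m j = 0" using \<open>j \<le> 4\<close> by simp
  qed
  \<comment> \<open>All determinants are reduced to the five with increasing indices. The signs are
    those of the cycles of length 2, 3 or 4 that move the last argument forward.\<close>
  have perm: "D 2 3 4 0 = - D 0 2 3 4"
    "D 2 3 4 1 = - D 1 2 3 4"
    "D 1 3 4 0 = - D 0 1 3 4"
    "D 1 3 4 2 = D 1 2 3 4"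
    "D 1 2 4 0 = - D 0 1 2 4"
    "D 1 2 4 3 = - D 1 2 3 4"
    "D 1 2 3 0 = - D 0 1 2 3"
    "D 0 3 4 1 = D 0 1 3 4"
    "D 0 3 4 2 = D 0 2 3 4"
    "D 0 2 4 1 = D 0 1 2 4"
    "D 0 2 4 3 = - D 0 2 3 4"
    "D 0 2 3 1 = D 0 1 2 3"
    "D 0 1 4 2 = - D 0 1 2 4"
    "D 0 1 4 3 = - D 0 1 3 4"
    "D 0 1 3 2 = - D 0 1 2 3"
    unfolding D_def by (rule volume3_last_first volume3_last_second volume3_last_third)+
  have prods: "l 0 * l 1 = - (D 2 3 4 0 * D 2 3 4 1)"
    "l 0 * l 2 = - (D 1 3 4 0 * D 1 3 4 2)"
    "l 0 * l 3 = - (D 1 2 4 0 * D 1 2 4 3)"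
    "l 0 * l 4 = - (D 1 2 3 0 * D 1 2 3 4)"
    "l 1 * l 2 = - (D 0 3 4 1 * D 0 3 4 2)"
    "l 1 * l 3 = - (D 0 2 4 1 * D 0 2 4 3)"
    "l 1 * l 4 = - (D 0 2 3 1 * D 0 2 3 4)"
    "l 2 * l 3 = - (D 0 1 4 2 * D 0 1 4 3)"
    "l 2 * l 4 = - (D 0 1 3 2 * D 0 1 3 4)"
    "l 3 * l 4 = - (D 0 1 2 3 * D 0 1 2 4)"
    unfolding l perm by simp_all
  have ind: "indicator {..<0} y = (of_bool (0 < - y) :: ennreal)" for y :: real
    by (simp add: indicator_def)
  have "(\<Sum>i = 0..4. of_bool (cone_at 4 i x (0, 1)) + of_bool (cone_at 4 i x (0, - 1)) :: ennreal)
    = (of_bool (0 < \<kappa> * l 1 \<and> 0 < \<kappa> * l 2 \<and> 0 < \<kappa> * l 3 \<and> 0 < \<kappa> * l 4) + of_bool (\<kappa> * l 1 < 0 \<and> \<kappa> * l 2 < 0 \<and> \<kappa> * l 3 < 0 \<and> \<kappa> * l 4 < 0))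
    + (of_bool (0 < \<kappa> * l 0 \<and> 0 < \<kappa> * l 2 \<and> 0 < \<kappa> * l 3 \<and> 0 < \<kappa> * l 4) + of_bool (\<kappa> * l 0 < 0 \<and> \<kappa> * l 2 < 0 \<and> \<kappa> * l 3 < 0 \<and> \<kappa> * l 4 < 0))
    + (of_bool (0 < \<kappa> * l 0 \<and> 0 < \<kappa> * l 1 \<and> 0 < \<kappa> * l 3 \<and> 0 < \<kappa> * l 4) + of_bool (\<kappa> * l 0 < 0 \<and> \<kappa> * l 1 < 0 \<and> \<kappa> * l 3 < 0 \<and> \<kappa> * l 4 < 0))
    + (of_bool (0 < \<kappa> * l 0 \<and> 0 < \<kappa> * l 1 \<and> 0 < \<kappa> * l 2 \<and> 0 < \<kappa> * l 4) + of_bool (\<kappa> * l 0 < 0 \<and> \<kappa> * l 1 < 0 \<and> \<kappa> * l 2 < 0 \<and> \<kappa> * l 4 < 0))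
    + (of_bool (0 < \<kappa> * l 0 \<and> 0 < \<kappa> * l 1 \<and> 0 < \<kappa> * l 2 \<and> 0 < \<kappa> * l 3) + of_bool (\<kappa> * l 0 < 0 \<and> \<kappa> * l 1 < 0 \<and> \<kappa> * l 2 < 0 \<and> \<kappa> * l 3 < 0))"
    unfolding atLeast0AtMost sum_atMost_4 by (simp add: cone all_le_4)
  then show ?thesis
    unfolding ind prods[symmetric] using count_signs_4[OF suml, of \<kappa>] nz h by (simp only: l \<kappa>_def) auto
qed

text \<open>Ten pairs of equal probability give \<open>4 + 4 * v = 10 * ?q\<close>. The second claim
  amounts to an upper bound for \<open>pi\<close>; it is read off from the constant being the
  integral of a nonnegative function.\<close>

lemma nn_integral_vertex_angle_sum_4:
  "(\<integral>\<^sup>+x. ennreal (vertex_angle_sum (convex hull (x ` {0..4}))) \<partial>PiM {0..4::nat} (\<lambda>_. sphere4)) = ennreal (539 / (288 * pi\<^sup>2) - 1 / 6)"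
  and angle_constant_nonneg: "0 \<le> 539 / (288 * pi\<^sup>2) - 1 / 6"
proof -
  let ?P = "PiM {0..4::nat} (\<lambda>_. sphere4)"
  let ?V = "\<integral>\<^sup>+x. ennreal (vertex_angle_sum (convex hull (x ` {0..4}))) \<partial>?P"
  let ?q = "1 / 3 + 539 / (720 * pi\<^sup>2)"
  interpret prob_space ?P by (intro prob_space_PiM prob_space_uniform_sphere)
  have card: "CARD(5) = Suc DIM(space4)" by simp
  have e: "norm ((0::space3), 1::real) = 1" by (simp add: norm_Pair)
  have dim: "DIM(space4) = 4" and neg: "- ((0::space3), 1::real) = (0, - 1)" by simp_all
  let ?c = "\<lambda>x. (\<Sum>i = 0..4. of_bool (cone_at 4 i x (0, 1)) + of_bool (cone_at 4 i x (0, - 1))) :: ennreal"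
  let ?s = "\<lambda>a b c d e x. indicator {..<0} (volume3 (fst (x a)) (fst (x b)) (fst (x c)) (fst (x d)) * volume3 (fst (x a)) (fst (x b)) (fst (x c)) (fst (x e))) :: ennreal"
  have V: "2 * ?V = (\<integral>\<^sup>+x. ?c x \<partial>?P)"
    using nn_integral_vertex_angle_sum[OF DIM4 card e] unfolding dim neg .
  have [measurable]: "(\<lambda>x. ?c x) \<in> borel_measurable ?P"
  proof (intro borel_measurable_sum)
    fix i :: nat assume "i \<in> {0..4}"
    then have i: "i \<le> 4" by simp
    have "CARD(5) = Suc 4" by simp
    note [measurable] = measurable_cone_at[OF i this, where 'a="space4"]
    show "(\<lambda>x. of_bool (cone_at 4 i x (0, 1)) + of_bool (cone_at 4 i x (0, - 1)) :: ennreal) \<in> borel_measurable ?P"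
      by measurable
  qed
  have "(\<integral>\<^sup>+x. 4 + 2 * ?c x \<partial>?P) = (\<integral>\<^sup>+x. 4 \<partial>?P) + (\<integral>\<^sup>+x. 2 * ?c x \<partial>?P)"
    by (rule nn_integral_add) measurable
  also have "(\<integral>\<^sup>+x. 2 * ?c x \<partial>?P) = 2 * (\<integral>\<^sup>+x. ?c x \<partial>?P)"
    by (rule nn_integral_cmult) measurable
  finally have "4 + 2 * (2 * ?V) = (\<integral>\<^sup>+x. 4 + 2 * ?c x \<partial>?P)"
    unfolding V using emeasure_space_1 by simp
  also have "\<dots> = (\<integral>\<^sup>+x. ?s 2 3 4 0 1 x + ?s 1 3 4 0 2 x + ?s 1 2 4 0 3 x + ?s 1 2 3 0 4 x + ?s 0 3 4 1 2 x + ?s 0 2 4 1 3 x + ?s 0 2 3 1 4 x + ?s 0 1 4 2 3 x + ?s 0 1 3 2 4 x + ?s 0 1 2 3 4 x \<partial>?P)"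
  proof (rule nn_integral_cong_AE)
    have "AE x in ?P. volume3 (fst (x 1)) (fst (x 2)) (fst (x 3)) (fst (x 4)) \<noteq> 0" by (rule AE_volume3_nonzero[of 1 2 3 4 0]) auto
    moreover have "AE x in ?P. volume3 (fst (x 0)) (fst (x 2)) (fst (x 3)) (fst (x 4)) \<noteq> 0" by (rule AE_volume3_nonzero[of 0 2 3 4 1]) auto
    moreover have "AE x in ?P. volume3 (fst (x 0)) (fst (x 1)) (fst (x 3)) (fst (x 4)) \<noteq> 0" by (rule AE_volume3_nonzero[of 0 1 3 4 2]) auto
    moreover have "AE x in ?P. volume3 (fst (x 0)) (fst (x 1)) (fst (x 2)) (fst (x 4)) \<noteq> 0" by (rule AE_volume3_nonzero[of 0 1 2 4 3]) auto
    moreover have "AE x in ?P. volume3 (fst (x 0)) (fst (x 1)) (fst (x 2)) (fst (x 3)) \<noteq> 0" by (rule AE_volume3_nonzero[of 0 1 2 3 4]) auto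
    moreover note AE_radon_height_4
    ultimately show "AE x in ?P. 4 + 2 * ?c x = ?s 2 3 4 0 1 x + ?s 1 3 4 0 2 x + ?s 1 2 4 0 3 x + ?s 1 2 3 0 4 x + ?s 0 3 4 1 2 x + ?s 0 2 4 1 3 x + ?s 0 2 3 1 4 x + ?s 0 1 4 2 3 x + ?s 0 1 3 2 4 x + ?s 0 1 2 3 4 x"
      by eventually_elim (rule cone_count_4)
  qed
  also have "\<dots> = ennreal ?q + ennreal ?q + ennreal ?q + ennreal ?q + ennreal ?q + ennreal ?q + ennreal ?q + ennreal ?q + ennreal ?q + ennreal ?q"
  proof -
    have m: "(\<lambda>x. ?s a b c d e x) \<in> borel_measurable ?P" if "{a, b, c, d, e} \<subseteq> {0..4}" for a b c d e
    proof -
      have [measurable]: "(\<lambda>x. x j) \<in> borel_measurable ?P" if "j \<in> {a, b, c, d, e}" for j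
        using that \<open>{a, b, c, d, e} \<subseteq> {0..4}\<close> measurable_component_singleton[of j "{0..4}" "\<lambda>_. sphere4"] by (auto cong: measurable_cong_sets)
      show ?thesis by measurable
    qed
    show ?thesis
      by (simp add: nn_integral_add borel_measurable_add m nn_integral_PiM_separated4)
  qed
  also have "\<dots> = ennreal (10 * ?q)" by (simp flip: ennreal_plus)
  finally have *: "4 + 2 * (2 * ?V) = ennreal (10 * ?q)" .
  then have "4 + 2 * (2 * ?V) \<noteq> top" by (simp only: ennreal_neq_top not_False_eq_True)
  then have "?V \<noteq> top" by (auto simp: ennreal_mult_eq_top_iff)
  then obtain v where v: "?V = ennreal v" "0 \<le> v" by (cases ?V) auto
  have "ennreal (4 + 2 * (2 * v)) = ennreal (10 * ?q)" using * v by (simp add: ennreal_mult)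
  then have "4 + 2 * (2 * v) = 10 * ?q" using v(2) by (subst (asm) ennreal_inj) auto
  then have "v = 539 / (288 * pi\<^sup>2) - 1 / 6" by (simp add: field_simps)
  then show "?V = ennreal (539 / (288 * pi\<^sup>2) - 1 / 6)" "0 \<le> 539 / (288 * pi\<^sup>2) - 1 / 6"
    using v by simp_all
qed

theorem theorem1p1:
  fixes d :: nat
    and M :: "'w measure"
    and X :: "nat \<Rightarrow> 'w \<Rightarrow> real ^ 'n"
  assumes "d \<in> {3, 4}" and "CARD('n) = d"
    and "prob_space M"
    and "prob_space.indep_vars M (\<lambda>_. borel) X {0..d}"
    and "\<And>i. i \<in> {0..d} \<Longrightarrow> distr M borel (X i) = uniform_sphere"
  shows "integrable M (\<lambda>\<omega>. vertex_angle_sum (convex hull ((\<lambda>i. X i \<omega>) ` {0..d})))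
    \<and> prob_space.expectation M (\<lambda>\<omega>. vertex_angle_sum (convex hull ((\<lambda>i. X i \<omega>) ` {0..d})))
      = (if d = 3 then 1 / 8 else 539 / (288 * pi\<^sup>2) - 1 / 6)"
proof (cases "d = 3")
  case True
  \<comment> \<open>The numeral type \<open>4\<close> indexes the vertices, while
    \<open>DIM3\<close> supplies \<open>3\<close> for the coordinates.\<close>
  have "CARD(4) = Suc DIM(space3)" by simp
  note * = expectation_vertex_angle_sum[OF DIM3 this, of M X "1 / 8"]
  have dim: "DIM(space3) = 3" by simp
  show ?thesis
    using *[unfolded dim] assms(2-5) nn_integral_vertex_angle_sum_3 unfolding True by simp
next
  case False
  then have d: "d = 4" using assms(1) by simp
  have "CARD(5) = Suc DIM(space4)" by simp
  note * = expectation_vertex_angle_sum[OF DIM4 this, of M X "539 / (288 * pi\<^sup>2) - 1 / 6"]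
  have dim: "DIM(space4) = 4" by simp
  show ?thesis
    using *[unfolded dim] assms(2-5) nn_integral_vertex_angle_sum_4 angle_constant_nonneg unfolding d by simp
qed

end
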